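(* The metric measure space $(X_\infty,\hat d_\infty,\mu_\infty)$ admits a $(1,1)$-Poincaré inequality: there are constants $C,\lambda\ge1$ such that for every ball $B=B(p,r)\subset X_\infty$, every integrable function $u$ and every upper gradient $g$ of $u$, $$\frac{1}{\mu_\infty(B)}\int_B|u-u_B|\,d\mu_\infty\le C\,r\,\frac{1}{\mu_\infty(\lambda B)}\int_{\lambda B}g\,d\mu_\infty,$$ where $u_B$ is the mean of $u$ on $B$.
   Context: Standing construction ($n=2$). Fix an integer $L\ge100$, $m=4$, $m_v=3L$. For $j\in\mathbb Z$, $Y_j$ is the cell complex on $\mathbb R^2$ given by the tiling by rectangles $[am^{-j},(a+1)m^{-j}]\times[bm_v^{-j},(b+1)m_v^{-j}]$, $a,b\in\mathbb Z$. Let $\Phi(x,y)=(m^{-1}x,m_v^{-1}y)$. For $k,\ell\in\mathbb Z$, $i\in\{1,2,3\}$, $a_{k,\ell,i}=\{k+\tfrac i4\}\times[(3\ell+i-1)m_v^{-1},(3\ell+i)m_v^{-1}]$. $\mathcal R$ is the equivalence relation on $\mathbb R^2$ generated by $p\sim p+(0,m_v^{-1})$ for $p\in a_{k,\ell,i}$. $\Phi^j_*\mathcal R=\{(\Phi^jp,\Phi^jq):(p,q)\in\mathcal R\}$; $\mathcal R_\infty$ is generated by all $\Phi^j_*\mathcal R$. $X_\infty=\mathbb R^2/\mathcal R_\infty$, $\hat\pi^\infty$ the quotient map, $\hat d_\infty$ the largest pseudodistance on $X_\infty$ such that for every $i\in\mathbb Z$ and every $2$-cell $\hat\sigma$ of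 $Y_i$, $\hat\pi^\infty(\hat\sigma)$ has diameter $\le m^{-i}$; $\mu_\infty=\hat\pi^\infty_\#\mathcal L^2$. A Borel $g\ge0$ is an upper gradient of $u$ if $|u(\gamma(a))-u(\gamma(b))|\le\int_\gamma g\,ds$ for every rectifiable curve $\gamma:[a,b]\to X_\infty$. *)

theory Defs
  imports "HOL-Analysis.Analysis"
begin

definition m_h :: real where "m_h = 4"

definition m_v :: "nat \<Rightarrow> real" where "m_v L = 3 * real L"

definition cellY :: "nat \<Rightarrow> int \<Rightarrow> int \<Rightarrow> int \<Rightarrow> (real \<times> real) set" where
  "cellY L j a b =
     {real_of_int a * m_h powr (- real_of_int j) .. (real_of_int a + 1) * m_h powr (- real_of_int j)} \<times>
     {real_of_int b * m_v L powr (- real_of_int j) .. (real_of_int b + 1) * m_v L powr (- real_of_int j)}"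

definition PhiPow :: "nat \<Rightarrow> int \<Rightarrow> real \<times> real \<Rightarrow> real \<times> real" where
  "PhiPow L j p = (m_h powr (- real_of_int j) * fst p, m_v L powr (- real_of_int j) * snd p)"

definition seg_a :: "nat \<Rightarrow> int \<Rightarrow> int \<Rightarrow> nat \<Rightarrow> (real \<times> real) set" where
  "seg_a L k l i = {real_of_int k + real i / 4} \<times>
     {(3 * real_of_int l + real i - 1) / m_v L .. (3 * real_of_int l + real i) / m_v L}"

definition genR :: "nat \<Rightarrow> ((real \<times> real) \<times> (real \<times> real)) set" where
  "genR L = {(p, p + (0, 1 / m_v L)) | p. \<exists>k l i. i \<in> {1,2,3} \<and> p \<in> seg_a L k l i}"

definition equiv_gen :: "('a \<times> 'a) set \<Rightarrow> ('a \<times> 'a) set" where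
  "equiv_gen G = (G \<union> G\<inverse>)\<^sup>*"

definition relR :: "nat \<Rightarrow> ((real \<times> real) \<times> (real \<times> real)) set" where
  "relR L = equiv_gen (genR L)"

definition relRinf :: "nat \<Rightarrow> ((real \<times> real) \<times> (real \<times> real)) set" where
  "relRinf L = equiv_gen (\<Union>j::int. {(PhiPow L j p, PhiPow L j q) | p q. (p, q) \<in> relR L})"

definition Xinf :: "nat \<Rightarrow> (real \<times> real) set set" where
  "Xinf L = UNIV // relRinf L"

definition piInf :: "nat \<Rightarrow> real \<times> real \<Rightarrow> (real \<times> real) set" where
  "piInf L p = relRinf L `` {p}"

definition pseudodist_on :: "'a set \<Rightarrow> ('a \<Rightarrow> 'a \<Rightarrow> real) \<Rightarrow> bool" where
  "pseudodist_on X \<delta> \<longleftrightarrow>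
     (\<forall>x\<in>X. \<delta> x x = 0) \<and> (\<forall>x\<in>X. \<forall>y\<in>X. 0 \<le> \<delta> x y \<and> \<delta> x y = \<delta> y x) \<and>
     (\<forall>x\<in>X. \<forall>y\<in>X. \<forall>z\<in>X. \<delta> x z \<le> \<delta> x y + \<delta> y z)"

definition admissible :: "nat \<Rightarrow> ((real \<times> real) set \<Rightarrow> (real \<times> real) set \<Rightarrow> real) \<Rightarrow> bool" where
  "admissible L \<delta> \<longleftrightarrow> pseudodist_on (Xinf L) \<delta> \<and>
     (\<forall>i a b. \<forall>x\<in>piInf L ` cellY L i a b. \<forall>y\<in>piInf L ` cellY L i a b.
        \<delta> x y \<le> m_h powr (- real_of_int i))"

definition dInf :: "nat \<Rightarrow> (real \<times> real) set \<Rightarrow> (real \<times> real) set \<Rightarrow> real" where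
  "dInf L x y = Sup {\<delta> x y | \<delta>. admissible L \<delta>}"

definition mball :: "'a set \<Rightarrow> ('a \<Rightarrow> 'a \<Rightarrow> real) \<Rightarrow> 'a \<Rightarrow> real \<Rightarrow> 'a set" where
  "mball X d p r = {x \<in> X. d p x < r}"

definition mopen :: "'a set \<Rightarrow> ('a \<Rightarrow> 'a \<Rightarrow> real) \<Rightarrow> 'a set \<Rightarrow> bool" where
  "mopen X d U \<longleftrightarrow> U \<subseteq> X \<and> (\<forall>x\<in>U. \<exists>e>0. mball X d x e \<subseteq> U)"

definition mborel :: "'a set \<Rightarrow> ('a \<Rightarrow> 'a \<Rightarrow> real) \<Rightarrow> 'a measure" where
  "mborel X d = sigma X {U. mopen X d U}"

definition curve_cont :: "'a set \<Rightarrow> ('a \<Rightarrow> 'a \<Rightarrow> real) \<Rightarrow> (real \<Rightarrow> 'a) \<Rightarrow> real \<Rightarrow> real \<Rightarrow> bool" where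
  "curve_cont X d \<gamma> a b \<longleftrightarrow> (\<forall>t\<in>{a..b}. \<gamma> t \<in> X) \<and>
     (\<forall>t\<in>{a..b}. \<forall>e>0. \<exists>\<delta>>0. \<forall>s\<in>{a..b}. \<bar>s - t\<bar> < \<delta> \<longrightarrow> d (\<gamma> s) (\<gamma> t) < e)"

definition curve_length :: "('a \<Rightarrow> 'a \<Rightarrow> real) \<Rightarrow> (real \<Rightarrow> 'a) \<Rightarrow> real \<Rightarrow> real \<Rightarrow> ennreal" where
  "curve_length d \<gamma> a b = (SUP (n, t) \<in> {(n::nat, t::nat \<Rightarrow> real). t 0 = a \<and> t n = b \<and>
        (\<forall>i<n. t i \<le> t (Suc i))}. \<Sum>i<n. ennreal (d (\<gamma> (t i)) (\<gamma> (t (Suc i)))))"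

definition rectifiable_curve :: "'a set \<Rightarrow> ('a \<Rightarrow> 'a \<Rightarrow> real) \<Rightarrow> (real \<Rightarrow> 'a) \<Rightarrow> real \<Rightarrow> real \<Rightarrow> bool" where
  "rectifiable_curve X d \<gamma> a b \<longleftrightarrow> a \<le> b \<and> curve_cont X d \<gamma> a b \<and> curve_length d \<gamma> a b < \<infinity>"

text \<open>Arc-length parametrisation: gamma = arclen_param o s_gamma with s_gamma(t) = length on [a,t].\<close>
definition arclen_param :: "('a \<Rightarrow> 'a \<Rightarrow> real) \<Rightarrow> (real \<Rightarrow> 'a) \<Rightarrow> real \<Rightarrow> real \<Rightarrow> real \<Rightarrow> 'a" where
  "arclen_param d \<gamma> a b s =
     \<gamma> (SOME t. t \<in> {a..b} \<and> enn2real (curve_length d \<gamma> a t) = s)"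

definition line_integral :: "('a \<Rightarrow> 'a \<Rightarrow> real) \<Rightarrow> ('a \<Rightarrow> ennreal) \<Rightarrow> (real \<Rightarrow> 'a) \<Rightarrow> real \<Rightarrow> real \<Rightarrow> ennreal" where
  "line_integral d g \<gamma> a b =
     (\<integral>\<^sup>+ s \<in> {0 .. enn2real (curve_length d \<gamma> a b)}. g (arclen_param d \<gamma> a b s) \<partial>lborel)"

definition upper_gradient :: "'a set \<Rightarrow> ('a \<Rightarrow> 'a \<Rightarrow> real) \<Rightarrow> ('a \<Rightarrow> real) \<Rightarrow> ('a \<Rightarrow> ennreal) \<Rightarrow> bool" where
  "upper_gradient X d u g \<longleftrightarrow> g \<in> borel_measurable (mborel X d) \<and>
     (\<forall>\<gamma> a b. rectifiable_curve X d \<gamma> a b \<longrightarrow>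
        ennreal \<bar>u (\<gamma> a) - u (\<gamma> b)\<bar> \<le> line_integral d g \<gamma> a b)"

definition muInf :: "nat \<Rightarrow> (real \<times> real) set measure" where
  "muInf L = distr lborel (mborel (Xinf L) (dInf L)) (piInf L)"

end

theory Submission
  imports Defs
begin

text \<open>
Pulled back to the plane, \<open>u\<close> is absolutely continuous along rows and takes equal values at glued points.
Inside a cell of level \<open>n\<close> any two rows at the same height within two strips are joined by a path that
runs through the strips in between, traversing one row in each and changing strips for free at the gluing
lines. Averaging over the height bounds the differences of means over subcells; summing over all finer
levels (cell means converge in \<open>L\<^sup>1\<close>) yields the inequality on each cell, without enlarging it.

For balls one needs that a ball of radius comparable to the width of a level \<open>n\<close> cell meets boundedly many
such cells, and that these are joined by chains of bounded length. This requires lower bounds for the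
metric, that is, admissible pseudodistances \<open>\<bar>\<phi> p - \<phi> q\<bar>\<close>. The vertical coordinate is made invariant
under all finer gluings by composing, level by level, with maps that collapse each glued pair of strips on its line
and stretch the third strip; these converge because the strips shrink by \<open>3 L\<close> while the slopes grow by \<open>7\<close>.
A ball of this size meets at most one coarser gluing line, for which the cutoff is periodised.
\<close>

subsection \<open>The gluing relation and the metric\<close>

text \<open>Why the levels add up: comparing the \<open>4 * M\<close> children of a cell of level
  \<open>n\<close> with their parent costs \<open>M * wd n\<close> times the integral of
  \<open>g\<close> over that same cell, because a climbing path uses each strip once and strips are
  disjoint. Cells of one level are disjoint as well, so each level contributes the same integral,
  with a weight that falls by the factor 4 per level. Why lower bounds for the distance need work:
  it is a supremum of pseudodistances, so chains of cells give upper bounds, while a lower bound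
  requires a test function that respects all gluings at once. Fine gluings can be folded away with a
  displacement that is small compared with \<open>ht L n\<close>. Gluings of level at most
  \<open>n\<close> move points by one or many cell heights and cannot. The periodic cutoff that
  serves for them is supported near up to seven horizontal bands, and some of these may be far from
  the centre; passing to a component in the graph of linked cells discards them. All constants
  depend on \<open>L\<close> only.\<close>

definition wd :: "int \<Rightarrow> real" where "wd j = m_h powr (- real_of_int j)"
definition ht :: "nat \<Rightarrow> int \<Rightarrow> real" where "ht L j = m_v L powr (- real_of_int j)"

text \<open>Gluings are indexed by the spacing \<open>wd j\<close> of the grid carrying their lines, so \<open>glue L j\<close> is the
  paper's \<open>\<Phi>\<^sup>j\<^sup>-\<^sup>1\<close>-image of the generators: \<open>c = 4 k + i\<close>, \<open>s = 3 l + i - 1\<close>, and \<open>(x, y)\<close> is glued to \<open>(x, y + ht L j)\<close>.\<close>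
definition glue :: "nat \<Rightarrow> int \<Rightarrow> real \<Rightarrow> real \<Rightarrow> bool" where
  "glue L j x y \<longleftrightarrow> (\<exists>c s::int. c mod 4 \<noteq> 0 \<and> s mod 3 = c mod 4 - 1 \<and> x = of_int c * wd j \<and>
     of_int s * ht L j \<le> y \<and> y \<le> (of_int s + 1) * ht L j)"

lemma wd_pos [simp]: "0 < wd j"
  by (simp add: wd_def m_h_def)

lemma wd_nonneg [simp]: "0 \<le> wd j" and wd_neq_0 [simp]: "wd j \<noteq> 0"
  using wd_pos[of j] by linarith+

lemma wd_add1: "wd (j + 1) = wd j / 4"
  by (simp add: wd_def m_h_def powr_diff powr_minus_divide powr_add divide_simps)

lemma wd_diff_nat: "wd (j - int k) = wd j * 4 ^ k"
  by (simp add: wd_def m_h_def powr_diff powr_minus_divide powr_realpow)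

lemma wd_add_nat: "wd (j + int k) = wd j / 4 ^ k"
  using wd_diff_nat[of "j + int k" k] by simp

lemma wd_mono: "i \<le> j \<Longrightarrow> wd j \<le> wd i"
  by (simp add: wd_def m_h_def)

lemma wd_small: assumes "0 < e" shows "\<exists>i\<ge>n. wd i < e"
proof -
  obtain k where "(1/4::real) ^ k < e / wd n"
    using real_arch_pow_inv[of "e / wd n" "1/4"] assms by auto
  then have "wd (n + int k) < e" by (simp add: wd_add_nat field_simps)
  then show ?thesis by (intro exI[of _ "n + int k"]) auto
qed

locale cell_tower = fixes L :: nat assumes L100: "100 \<le> L"
begin

abbreviation M where "M \<equiv> m_v L"

lemma M_eq: "M = real (3 * L)" by (simp add: m_v_def)
lemma M_ge: "300 \<le> M" using L100 by (simp add: m_v_def)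
lemma M_pos [simp]: "0 < M" using M_ge by simp

lemma ht_pos [simp]: "0 < ht L j" using M_ge by (simp add: ht_def)

lemma ht_nonneg [simp]: "0 \<le> ht L j" and ht_neq_0 [simp]: "ht L j \<noteq> 0"
  using ht_pos[of j] by linarith+

lemma ht_add1: "ht L (j + 1) = ht L j / M"
  using M_ge by (simp add: ht_def powr_diff powr_minus_divide powr_add divide_simps)

lemma ht_diff_nat: "ht L (j - int k) = ht L j * M ^ k"
  using M_ge by (simp add: ht_def powr_diff powr_minus_divide powr_realpow)

lemma ht_add_nat: "ht L (j + int k) = ht L j / M ^ k"
  using ht_diff_nat[of "j + int k" k] M_ge by simp

lemma ht_mono: "i \<le> j \<Longrightarrow> ht L j \<le> ht L i"
  using M_ge by (simp add: ht_def)

lemma cellY_eq: "cellY L j a b = {of_int a * wd j .. (of_int a + 1) * wd j} \<times> {of_int b * ht L j .. (of_int b + 1) * ht L j}"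
  by (simp add: cellY_def wd_def ht_def)

text \<open>The generators sit on quarter lines, so \<open>PhiPow L j\<close> puts them on the grid
  of spacing \<open>wd (j+1)\<close> with jump \<open>ht L (j+1)\<close>. Both sides range over all
  levels, which absorbs the shift by one.\<close>

lemma gen_iff_glue:
  "(\<exists>j p q. (p, q) \<in> genR L \<and> P = PhiPow L j p \<and> Q = PhiPow L j q) \<longleftrightarrow>
   (\<exists>j x y. glue L j x y \<and> P = (x, y) \<and> Q = (x, y + ht L j))" (is "?l \<longleftrightarrow> ?r")
proof
  assume ?l
  then obtain j p k l i where i: "i \<in> {1,2,3::nat}" and p: "p \<in> seg_a L k l i"
    and P: "P = PhiPow L j p" and Q: "Q = PhiPow L j (p + (0, 1 / M))"
    unfolding genR_def by blast
  have h: "ht L j = ht L (j+1) * M" "wd j = 4 * wd (j+1)" using M_pos by (simp_all add: ht_add1 wd_add1 del: M_pos)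
  have im: "int i mod 4 = int i" using i by auto
  define y where "y = ht L j * snd p"
  have "snd p * M \<ge> 3 * real_of_int l + real i - 1" "snd p * M \<le> 3 * real_of_int l + real i"
    using p M_pos by (auto simp: seg_a_def field_simps)
  then have yy: "(3 * real_of_int l + real i - 1) * ht L (j+1) \<le> y" "y \<le> (3 * real_of_int l + real i) * ht L (j+1)"
    using mult_right_mono[of _ "snd p * M" "ht L (j+1)"] mult_right_mono[of "snd p * M" _ "ht L (j+1)"]
    unfolding y_def h by (simp_all add: mult_ac less_imp_le)
  have "glue L (j+1) (ht L j * 0 + wd j * fst p) y"
    unfolding glue_def
    apply (rule exI[of _ "4 * k + int i"], rule exI[of _ "3 * l + int i - 1"])
    using p yy i im h by (auto simp: seg_a_def algebra_simps mod_simps)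
  moreover have "P = (wd j * fst p, y)" by (simp add: P PhiPow_def wd_def ht_def y_def)
  moreover have "Q = (wd j * fst p, y + ht L (j+1))"
    unfolding Q PhiPow_def wd_def[symmetric] ht_def[symmetric] y_def ht_add1 by (simp add: ring_distribs)
  ultimately show ?r by force
next
  assume ?r
  then obtain j x y where g: "glue L j x y" and P: "P = (x,y)" and Q: "Q = (x, y + ht L j)" by auto
  obtain c s where c: "c mod 4 \<noteq> 0" and s: "s mod 3 = c mod 4 - 1" and x: "x = of_int c * wd j"
    and y: "of_int s * ht L j \<le> y" "y \<le> (of_int s + 1) * ht L j" using g by (auto simp: glue_def)
  define k i l where "k = c div 4" and "i = nat (c mod 4)" and "l = s div 3"
  have i: "i \<in> {1,2,3}" "int i = c mod 4" unfolding i_def using c by auto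
  have ck: "c = 4 * k + int i" and sl: "s = 3 * l + int i - 1"
    using s i unfolding k_def l_def by presburger+
  have h: "ht L (j - 1) = ht L j * M" "wd (j - 1) = 4 * wd j"
    using ht_diff_nat[of j 1] wd_diff_nat[of j 1] by auto
  define p where "p = (of_int k + real i / 4, y / ht L (j-1))"
  have "p \<in> seg_a L k l i"
  proof -
    have "of_int s \<le> y / ht L j" "y / ht L j \<le> of_int s + 1"
      using y ht_pos[of j] by (simp_all add: pos_le_divide_eq pos_divide_le_eq)
    then have "of_int s / M \<le> y / ht L j / M" "y / ht L j / M \<le> (of_int s + 1) / M"
      using M_ge by (intro divide_right_mono; simp)+
    then show ?thesis by (simp add: seg_a_def p_def h sl)
  qed
  then have "(p, p + (0, 1/M)) \<in> genR L" using i(1) unfolding genR_def by blast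
  moreover have "P = PhiPow L (j-1) p"
    unfolding P PhiPow_def wd_def[symmetric] ht_def[symmetric] p_def x ck h
    using ht_pos[of j] M_ge by (auto simp: field_simps simp del: ht_pos M_pos)
  moreover have "Q = PhiPow L (j-1) (p + (0, 1/M))"
    unfolding Q PhiPow_def wd_def[symmetric] ht_def[symmetric] p_def x ck h
    using ht_pos[of j] M_ge by (auto simp: field_simps simp del: ht_pos M_pos)
  ultimately show ?l by blast
qed

section \<open>Functions that descend to the quotient\<close>

lemma relRinf_equiv: "equiv UNIV (relRinf L)"
  unfolding relRinf_def equiv_gen_def
  by (intro equivI refl_rtrancl sym_rtrancl trans_rtrancl) (auto simp: sym_Un_converse)

lemma glue_relRinf:
  assumes "glue L j x y" shows "((x, y), (x, y + ht L j)) \<in> relRinf L"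
proof -
  obtain i p q where "(p,q) \<in> genR L" "(x,y) = PhiPow L i p" "(x, y + ht L j) = PhiPow L i q"
    using gen_iff_glue[of "(x,y)" "(x, y + ht L j)"] assms by blast
  moreover have "(p,q) \<in> relR L" using calculation by (auto simp: relR_def equiv_gen_def)
  ultimately show ?thesis unfolding relRinf_def equiv_gen_def by blast
qed

text \<open>The equivalence closure is taken at each level and then once more over all levels; one
  induction per closure carries invariance from the generators to the classes.\<close>

lemma relRinf_invariant:
  assumes inv: "\<And>j x y. glue L j x y \<Longrightarrow> f (x, y) = f (x, y + ht L j)" and pq: "(p, q) \<in> relRinf L"
  shows "f p = f q"
proof -
  have gen: "f (PhiPow L j p) = f (PhiPow L j q)" if "(p,q) \<in> genR L" for j p q
    using gen_iff_glue[of "PhiPow L j p" "PhiPow L j q"] inv that by metis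
  have rel: "f (PhiPow L j p) = f (PhiPow L j q)" if "(p,q) \<in> relR L" for j p q
    using that unfolding relR_def equiv_gen_def
  proof (induction rule: rtrancl_induct)
    case (step q r)
    then show ?case using gen[of q r j] gen[of r q j] by auto
  qed simp
  show ?thesis using pq unfolding relRinf_def equiv_gen_def
  proof (induction rule: rtrancl_induct)
    case (step q r)
    then obtain j p' q' where "(p', q') \<in> relR L"
      "(q = PhiPow L j p' \<and> r = PhiPow L j q') \<or> (r = PhiPow L j p' \<and> q = PhiPow L j q')" by blast
    then show ?case using step.IH rel[of p' q' j] by metis
  qed simp
qed

lemma piInf_eq_iff: "piInf L p = piInf L q \<longleftrightarrow> (p, q) \<in> relRinf L"
  unfolding piInf_def using eq_equiv_class_iff[OF relRinf_equiv] by simp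

lemma piInf_glue: "glue L j x y \<Longrightarrow> piInf L (x, y) = piInf L (x, y + ht L j)"
  using piInf_eq_iff glue_relRinf by simp

lemma Xinf_eq: "Xinf L = range (piInf L)"
  by (auto simp: Xinf_def piInf_def quotient_def)

lemma piInf_in [simp]: "piInf L p \<in> Xinf L" by (simp add: Xinf_eq)

section \<open>The distance pulled back to the plane\<close>

definition dd :: "real \<times> real \<Rightarrow> real \<times> real \<Rightarrow> real" where
  "dd p q = dInf L (piInf L p) (piInf L q)"

lemma in_cell_floor: "(x, y) \<in> cellY L i \<lfloor>x / wd i\<rfloor> \<lfloor>y / ht L i\<rfloor>"
proof -
  have *: "of_int \<lfloor>z / h\<rfloor> * h \<le> z" "z \<le> (of_int \<lfloor>z / h\<rfloor> + 1) * h" if "0 < h" for z h :: real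
    using floor_divide_lower[OF that, of z] floor_divide_upper[OF that, of z] by simp_all
  show ?thesis using *[of "wd i" x] *[of "ht L i" y] by (simp add: cellY_eq)
qed

text \<open>The cell indices of the two points differ by at most one in each coordinate, so the grid
  point with the larger indices belongs to both cells. A chain of two cells then joins the
  points.\<close>

lemma close_common_corner:
  assumes "\<bar>x - x'\<bar> \<le> wd i" "\<bar>y - y'\<bar> \<le> ht L i"
  shows "\<exists>c a b a' b'. (x,y) \<in> cellY L i a b \<and> c \<in> cellY L i a b \<and> c \<in> cellY L i a' b' \<and> (x',y') \<in> cellY L i a' b'"
proof -
  define a a' b b' where "a = \<lfloor>x / wd i\<rfloor>" and "a' = \<lfloor>x' / wd i\<rfloor>" and "b = \<lfloor>y / ht L i\<rfloor>" and "b' = \<lfloor>y' / ht L i\<rfloor>"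
  have "\<bar>x / wd i - x' / wd i\<bar> \<le> 1" "\<bar>y / ht L i - y' / ht L i\<bar> \<le> 1"
    using assms wd_pos[of i] ht_pos[of i] by (simp_all add: diff_divide_distrib[symmetric] abs_divide)
  then have ab: "\<bar>a - a'\<bar> \<le> 1" "\<bar>b - b'\<bar> \<le> 1" unfolding a_def a'_def b_def b'_def by linarith+
  define c where "c = (of_int (max a a') * wd i, of_int (max b b') * ht L i)"
  have "c \<in> cellY L i a b" "c \<in> cellY L i a' b'"
    using ab by (auto simp: c_def cellY_eq intro!: mult_right_mono less_imp_le[OF wd_pos] less_imp_le[OF ht_pos])
  then show ?thesis using in_cell_floor[of x y i] in_cell_floor[of x' y' i]
    unfolding a_def a'_def b_def b'_def by blast
qed

lemma admissible_close:
  assumes "admissible L \<delta>" "\<bar>x - x'\<bar> \<le> wd i" "\<bar>y - y'\<bar> \<le> ht L i"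
  shows "\<delta> (piInf L (x,y)) (piInf L (x',y')) \<le> 2 * wd i"
proof -
  obtain c a b a' b' where c: "(x,y) \<in> cellY L i a b" "c \<in> cellY L i a b" "c \<in> cellY L i a' b'" "(x',y') \<in> cellY L i a' b'"
    using close_common_corner[OF assms(2,3)] by blast
  have "\<delta> (piInf L (x,y)) (piInf L c) \<le> wd i" "\<delta> (piInf L c) (piInf L (x',y')) \<le> wd i"
    using assms(1) c unfolding admissible_def wd_def by blast+
  moreover have "\<delta> (piInf L (x,y)) (piInf L (x',y')) \<le> \<delta> (piInf L (x,y)) (piInf L c) + \<delta> (piInf L c) (piInf L (x',y'))"
    using assms(1) unfolding admissible_def pseudodist_on_def by (meson piInf_in)
  ultimately show ?thesis by simp
qed

lemma wd_ht_large: "\<exists>i. e \<le> wd i \<and> e' \<le> ht L i"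
proof -
  obtain k where k: "e < 4 ^ k" using real_arch_pow[of 4 e] by auto
  obtain l where l: "e' < M ^ l" using real_arch_pow[of M e'] M_ge by auto
  define n where "n = max k l"
  have "e \<le> 4 ^ n" "e' \<le> M ^ n"
    using k l M_ge power_increasing[of k n "4::real"] power_increasing[of l n M] unfolding n_def by linarith+
  moreover have "wd (0 - int n) = 4 ^ n" "ht L (0 - int n) = M ^ n"
    unfolding wd_diff_nat ht_diff_nat using M_ge by (simp_all add: wd_def ht_def m_h_def)
  ultimately show ?thesis by metis
qed

text \<open>\<open>dInf\<close> is a \<open>Sup\<close> of reals, which is only meaningful for a
  bounded set. Cells of very negative level are large enough to join any two given points.\<close>

lemma admissible_bdd: "bdd_above {\<delta> (piInf L p) (piInf L q) | \<delta>. admissible L \<delta>}"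
proof -
  obtain i where "\<bar>fst p - fst q\<bar> \<le> wd i" "\<bar>snd p - snd q\<bar> \<le> ht L i" using wd_ht_large by blast
  then show ?thesis
    using admissible_close[of _ "fst p" "fst q" i "snd p" "snd q"] by (auto intro!: bdd_aboveI[of _ "2 * wd i"])
qed

lemma admissible_le_dd: "admissible L \<delta> \<Longrightarrow> \<delta> (piInf L p) (piInf L q) \<le> dd p q"
  unfolding dd_def dInf_def by (rule cSup_upper[OF _ admissible_bdd]) auto

lemma admissible_zero: "admissible L (\<lambda>_ _. 0)"
  by (simp add: admissible_def pseudodist_on_def m_h_def)

lemma dd_least: "(\<And>\<delta>. admissible L \<delta> \<Longrightarrow> \<delta> (piInf L p) (piInf L q) \<le> e) \<Longrightarrow> dd p q \<le> e"
  unfolding dd_def dInf_def using admissible_zero by (intro cSup_least) auto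

lemma dd_nonneg: "0 \<le> dd p q" using admissible_le_dd[OF admissible_zero] .

lemma dd_refl [simp]: "dd p p = 0"
  by (intro antisym dd_nonneg dd_least) (simp add: admissible_def pseudodist_on_def)

lemma dd_sym: "dd p q = dd q p"
proof -
  have "dd p q \<le> dd q p" for p q
  proof (rule dd_least)
    fix \<delta> assume "admissible L \<delta>"
    then show "\<delta> (piInf L p) (piInf L q) \<le> dd q p"
      using admissible_le_dd[of \<delta> q p] by (auto simp: admissible_def pseudodist_on_def)
  qed
  then show ?thesis by (metis antisym)
qed

lemma dd_triangle: "dd p r \<le> dd p q + dd q r"
proof (rule dd_least)
  fix \<delta> assume a: "admissible L \<delta>"
  then have "\<delta> (piInf L p) (piInf L r) \<le> \<delta> (piInf L p) (piInf L q) + \<delta> (piInf L q) (piInf L r)"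
    by (auto simp: admissible_def pseudodist_on_def)
  then show "\<delta> (piInf L p) (piInf L r) \<le> dd p q + dd q r"
    using admissible_le_dd[OF a, of p q] admissible_le_dd[OF a, of q r] by linarith
qed

lemma dd_cell: "p \<in> cellY L i a b \<Longrightarrow> q \<in> cellY L i a b \<Longrightarrow> dd p q \<le> wd i"
  by (rule dd_least) (auto simp: admissible_def wd_def)

lemma dd_close: "\<bar>x - x'\<bar> \<le> wd i \<Longrightarrow> \<bar>y - y'\<bar> \<le> ht L i \<Longrightarrow> dd (x,y) (x',y') \<le> 2 * wd i"
  by (rule dd_least) (auto intro: admissible_close)

lemma dd_glue: "glue L j x y \<Longrightarrow> dd (x,y) (x, y + ht L j) = 0"
  using dd_refl[of "(x, y + ht L j)"] piInf_glue[of j x y] unfolding dd_def by metis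

text \<open>Source of all lower bounds: such an \<open>f\<close> descends to the quotient, and the
  difference of its values is one of the pseudodistances in the supremum.\<close>

lemma dd_ge_invariant:
  assumes inv: "\<And>j x y. glue L j x y \<Longrightarrow> f (x, y) = f (x, y + ht L j)"
    and osc: "\<And>i a b p q. p \<in> cellY L i a b \<Longrightarrow> q \<in> cellY L i a b \<Longrightarrow> \<bar>f p - f q\<bar> \<le> wd i"
  shows "\<bar>f p - f q\<bar> \<le> dd p q"
proof -
  \<comment> \<open>\<open>F\<close> reads \<open>f\<close> off a chosen representative; invariance
    makes the choice immaterial.\<close>
  define F where "F C = f (SOME p. piInf L p = C)" for C
  have F: "F (piInf L p) = f p" for p
  proof -
    have "piInf L (SOME q. piInf L q = piInf L p) = piInf L p" by (rule someI) simp
    then have "(SOME q. piInf L q = piInf L p, p) \<in> relRinf L" by (simp only: piInf_eq_iff)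
    then show ?thesis unfolding F_def by (rule relRinf_invariant[of f, rotated]) (rule inv)
  qed
  have "admissible L (\<lambda>C D. \<bar>F C - F D\<bar>)"
    unfolding admissible_def pseudodist_on_def by (auto simp: F osc[unfolded wd_def])
  from admissible_le_dd[OF this, of p q] show ?thesis by (simp add: F)
qed

lemma dd_ge_fst: "\<bar>fst p - fst q\<bar> \<le> dd p q"
  by (rule dd_ge_invariant) (auto simp: cellY_eq algebra_simps)

text \<open>The segment meets at most \<open>\<bar>x - x'\<bar> / wd i + 2\<close> cells in a row,
  each of cost \<open>wd i\<close>; the excess \<open>2 * wd i\<close> vanishes as the level
  grows.\<close>

lemma dd_row_le: "dd (x, y) (x', y) \<le> \<bar>x - x'\<bar>"
proof -
  have *: "dd (x, y) (x', y) \<le> real (nat (a' - a) + 1) * wd i"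
    if "(x,y) \<in> cellY L i a b" "(x',y) \<in> cellY L i a' b" "a \<le> a'" for x x' i a a' b
    using that
  proof (induction "nat (a' - a)" arbitrary: a' x')
    case 0 then show ?case using dd_cell[of "(x,y)" i a b "(x',y)"] by simp
  next
    case (Suc k)
    let ?x = "of_int a' * wd i"
    have "(?x, y) \<in> cellY L i (a' - 1) b" "(?x, y) \<in> cellY L i a' b"
      using Suc.prems(2) by (auto simp: cellY_eq intro!: mult_right_mono less_imp_le[OF wd_pos])
    then have "dd (x, y) (?x, y) \<le> real (nat (a' - 1 - a) + 1) * wd i" "dd (?x, y) (x', y) \<le> wd i"
      using Suc.hyps(1)[of "a' - 1" ?x] Suc.hyps(2) Suc.prems dd_cell by simp_all
    moreover have "nat (a' - a) = nat (a' - 1 - a) + 1" using Suc.hyps(2) by simp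
    ultimately show ?case using dd_triangle[of "(x,y)" "(x',y)" "(?x,y)"] by (simp add: algebra_simps)
  qed
  have le: "dd (x, y) (x', y) \<le> \<bar>x - x'\<bar>" if "x \<le> x'" for x x'
  proof (rule field_le_epsilon)
    fix e :: real assume "0 < e"
    then obtain i where i: "wd i < e / 2" using wd_small[of "e/2" 0] by auto
    define a a' where "a = \<lfloor>x / wd i\<rfloor>" "a' = \<lfloor>x' / wd i\<rfloor>"
    have a: "a \<le> a'" using that unfolding a_a'_def by (intro floor_mono divide_right_mono less_imp_le[OF wd_pos])
    have "real (nat (a' - a) + 1) \<le> (x' / wd i - x / wd i) + 2" using a unfolding a_a'_def by linarith
    then have "real (nat (a' - a) + 1) * wd i \<le> ((x' / wd i - x / wd i) + 2) * wd i"
      by (intro mult_right_mono less_imp_le[OF wd_pos])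
    also have "\<dots> = x' - x + 2 * wd i" using less_imp_neq[OF wd_pos[of i]] by (simp add: algebra_simps)
    finally show "dd (x, y) (x', y) \<le> \<bar>x - x'\<bar> + e"
      using *[OF in_cell_floor[of x y i] in_cell_floor[of x' y i]] a that i unfolding a_a'_def by linarith
  qed
  show ?thesis using le[of x x'] le[of x' x] dd_sym[of "(x,y)" "(x',y)"] by (cases "x \<le> x'") auto
qed

text \<open>Rows embed isometrically, which later makes them curves parametrised by arc
  length.\<close>

lemma dd_row: "dd (x, y) (x', y) = \<bar>x - x'\<bar>"
  using dd_row_le[of x y x'] dd_ge_fst[of "(x,y)" "(x',y)"] by simp

section \<open>Balls, open sets and Borel measurability\<close>

lemma mball_mopen: "mopen (Xinf L) (dInf L) (mball (Xinf L) (dInf L) C r)" if C: "C \<in> Xinf L"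
  unfolding mopen_def
proof (intro conjI ballI)
  show "mball (Xinf L) (dInf L) C r \<subseteq> Xinf L" by (auto simp: mball_def)
  fix D assume D: "D \<in> mball (Xinf L) (dInf L) C r"
  obtain p where p: "C = piInf L p" using C unfolding Xinf_eq by blast
  obtain q where q: "D = piInf L q" using D unfolding Xinf_eq mball_def by blast
  note pq = p q
  have "mball (Xinf L) (dInf L) D (r - dd p q) \<subseteq> mball (Xinf L) (dInf L) C r"
  proof
    fix E assume "E \<in> mball (Xinf L) (dInf L) D (r - dd p q)"
    moreover obtain s where "E = piInf L s" using calculation by (auto simp: Xinf_eq mball_def)
    ultimately show "E \<in> mball (Xinf L) (dInf L) C r"
      using dd_triangle[of p s q] pq by (auto simp: mball_def dd_def)
  qed
  then show "\<exists>e>0. mball (Xinf L) (dInf L) D e \<subseteq> mball (Xinf L) (dInf L) C r"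
    using D pq by (intro exI[of _ "r - dd p q"]) (auto simp: mball_def dd_def)
qed

lemma open_piInf_vimage:
  assumes "mopen (Xinf L) (dInf L) V" shows "open (piInf L -` V)"
proof (rule openI)
  fix p assume p: "p \<in> piInf L -` V"
  then obtain e where e: "e > 0" "mball (Xinf L) (dInf L) (piInf L p) e \<subseteq> V"
    using assms by (auto simp: mopen_def)
  obtain i where i: "wd i < e / 2" using wd_small[of "e/2" 0] e by auto
  define d where "d = min (wd i) (ht L i)"
  have "ball p d \<subseteq> piInf L -` V"
  proof
    fix q assume q: "q \<in> ball p d"
    have "\<bar>fst p - fst q\<bar> \<le> wd i" "\<bar>snd p - snd q\<bar> \<le> ht L i"
      using q dist_fst_le[of p q] dist_snd_le[of p q] by (auto simp: d_def dist_real_def)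
    then have "dd p q \<le> 2 * wd i" using dd_close[of "fst p" "fst q" i "snd p" "snd q"] by simp
    then show "q \<in> piInf L -` V" using e i by (auto simp: mball_def dd_def)
  qed
  then show "\<exists>e>0. ball p e \<subseteq> piInf L -` V" by (intro exI[of _ d]) (auto simp: d_def)
qed

lemma sets_mborel: "sets (mborel (Xinf L) (dInf L)) = sigma_sets (Xinf L) {V. mopen (Xinf L) (dInf L) V}"
  and space_mborel [simp]: "space (mborel (Xinf L) (dInf L)) = Xinf L"
proof -
  have "{V. mopen (Xinf L) (dInf L) V} \<subseteq> Pow (Xinf L)" by (auto simp: mopen_def)
  then show "sets (mborel (Xinf L) (dInf L)) = sigma_sets (Xinf L) {V. mopen (Xinf L) (dInf L) V}"
    "space (mborel (Xinf L) (dInf L)) = Xinf L"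
    unfolding mborel_def by simp_all
qed

lemma piInf_measurable [measurable]: "piInf L \<in> borel \<rightarrow>\<^sub>M mborel (Xinf L) (dInf L)"
  unfolding mborel_def
proof (rule measurable_measure_of)
  show "piInf L -` V \<inter> space borel \<in> sets borel" if "V \<in> {V. mopen (Xinf L) (dInf L) V}" for V
    using open_piInf_vimage[of V] that by simp
qed (auto simp: mopen_def)

end

subsection \<open>A height function compatible with fine gluings\<close>

definition dist_Ints :: "real \<Rightarrow> real" where "dist_Ints u = \<bar>u - of_int (round u)\<bar>"

lemma dist_Ints_le: "dist_Ints u \<le> \<bar>u - of_int m\<bar>"
  unfolding dist_Ints_def by (rule round_diff_minimal)

lemma dist_Ints_lipschitz: "\<bar>dist_Ints u - dist_Ints v\<bar> \<le> \<bar>u - v\<bar>"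
  using dist_Ints_le[of u "round v"] dist_Ints_le[of v "round u"] unfolding dist_Ints_def by linarith

lemma dist_Ints_nonneg [simp]: "0 \<le> dist_Ints u" by (simp add: dist_Ints_def)

lemma dist_Ints_of_int [simp]: "dist_Ints (of_int m) = 0" by (simp add: dist_Ints_def)

lemma dist_Ints_add_int: "dist_Ints (u + of_int m) = dist_Ints u"
proof -
  have "dist_Ints (u + of_int m) \<le> dist_Ints u" for u m
    using dist_Ints_le[of "u + of_int m" "round u + m"] by (simp add: dist_Ints_def)
  from this[of u m] this[of "u + of_int m" "- m"] show ?thesis by simp
qed

lemma dist_Ints_minus: "dist_Ints (- u) = dist_Ints u"
proof -
  have "dist_Ints (- u) \<le> dist_Ints u" for u
    using dist_Ints_le[of "- u" "- round u"] by (simp add: dist_Ints_def)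
  from this[of u] this[of "- u"] show ?thesis by simp
qed

text \<open>1/4 and 3/4 are 1/2 apart modulo 1, so \<open>u\<close> cannot be closer than 1/4 to
  both classes. This allows a cut to be placed away from the zeros of a periodic tent.\<close>

lemma dist_Ints_quarters: "1/4 \<le> dist_Ints (u - 1/4) \<or> 1/4 \<le> dist_Ints (u - 3/4)"
proof (rule ccontr)
  assume "\<not> ?thesis"
  then have "\<bar>u - 1/4 - of_int (round (u - 1/4))\<bar> < 1/4" "\<bar>u - 3/4 - of_int (round (u - 3/4))\<bar> < 1/4"
    by (auto simp: dist_Ints_def)
  then have "real_of_int (round (u - 3/4)) > of_int (round (u - 1/4)) - 1"
    "real_of_int (round (u - 3/4)) < of_int (round (u - 1/4))" by linarith+
  then show False by simp
qed

lemma abs_max_diff_le: "\<bar>max a b - max c d\<bar> \<le> max \<bar>a - c\<bar> \<bar>b - d\<bar>" for a b c d :: real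
  unfolding max_def by (auto simp: abs_if)

lemma abs_min_diff_le: "\<bar>min a b - min a d\<bar> \<le> \<bar>b - d\<bar>" for a b d :: real
  unfolding min_def by (auto simp: abs_if)

lemma floor_third:
  fixes u :: real shows "3 * of_int \<lfloor>(u + 1) / 3\<rfloor> \<le> u + 1" "u + 1 < 3 * of_int \<lfloor>(u + 1) / 3\<rfloor> + 3"
  using floor_divide_lower[of 3 "u + 1"] floor_divide_upper[of 3 "u + 1"] by (simp_all add: algebra_simps)

text \<open>\<open>wave\<close> is the 3-periodic function with \<open>wave u = - u\<close> on \<open>[-1,1]\<close>, so that \<open>u + wave u\<close>
  collapses \<open>[-1,1]\<close> to a point.\<close>

definition wave :: "real \<Rightarrow> real" where
  "wave u = (let v = u - 3 * of_int \<lfloor>(u + 1) / 3\<rfloor> in max (- v) (2 * v - 3))"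

lemma wave_bound: "\<bar>wave u\<bar> \<le> 1"
  using floor_third[of u] unfolding wave_def Let_def by (smt (verit))

text \<open>The slopes on a period are -1 and 2, and the pieces match across periods. Points less
  than 1 apart lie in the same or in adjacent periods; for other points the bound 1 on
  \<open>wave\<close> suffices.\<close>

lemma wave_lipschitz: "\<bar>wave u - wave v\<bar> \<le> 2 * \<bar>u - v\<bar>"
proof -
  have "\<bar>wave u - wave v\<bar> \<le> 2 * (v - u)" if "u \<le> v" for u v
  proof (cases "1 \<le> v - u")
    case True then show ?thesis using wave_bound[of u] wave_bound[of v] by (smt (verit))
  next
    case False
    define k l where "k = \<lfloor>(u + 1) / 3\<rfloor>" and "l = \<lfloor>(v + 1) / 3\<rfloor>"
    have k: "3 * of_int k \<le> u + 1" "u + 1 < 3 * of_int k + 3" unfolding k_def by (rule floor_third)+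
    have l: "3 * of_int l \<le> v + 1" "v + 1 < 3 * of_int l + 3" unfolding l_def by (rule floor_third)+
    have "l = k \<or> l = k + 1" using k l False that by linarith
    then show ?thesis
    proof
      assume "l = k"
      then have w: "wave u = max (- (u - 3 * of_int k)) (2 * (u - 3 * of_int k) - 3)"
        "wave v = max (- (v - 3 * of_int k)) (2 * (v - 3 * of_int k) - 3)"
        by (simp_all add: wave_def Let_def k_def l_def)
      show ?thesis unfolding w using that by (simp add: max_def abs_if)
    next
      assume lk: "l = k + 1"
      have w: "wave u = max (- (u - 3 * of_int k)) (2 * (u - 3 * of_int k) - 3)"
        "wave v = max (- (v - 3 * of_int l)) (2 * (v - 3 * of_int l) - 3)"
        by (simp_all add: wave_def Let_def k_def l_def)
      show ?thesis unfolding w lk using k l[unfolded lk] that False by (simp add: max_def)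
    qed
  qed
  from this[of u v] this[of v u] show ?thesis by (cases "u \<le> v") (simp_all add: abs_minus_commute)
qed

lemma wave_eq:
  assumes "3 * of_int k - 1 \<le> u" "u \<le> 3 * of_int k + 1" shows "wave u = 3 * of_int k - u"
proof -
  have "\<lfloor>(u + 1) / 3\<rfloor> = k" using assms by (intro floor_unique) auto
  then show ?thesis using assms by (simp add: wave_def)
qed

text \<open>\<open>4 * dist_Ints ((\<xi> - of_int i) / 4)\<close> is the distance from
  \<open>\<xi>\<close> to the integers congruent to \<open>i\<close> modulo 4.\<close>

definition tent :: "int \<Rightarrow> real \<Rightarrow> real" where
  "tent i \<xi> = max 0 (1 - 4 * dist_Ints ((\<xi> - of_int i) / 4))"

lemma tent_bounds: "0 \<le> tent i \<xi>" "tent i \<xi> \<le> 1"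
  by (auto simp: tent_def)

lemma tent_lipschitz: "\<bar>tent i \<xi> - tent i \<xi>'\<bar> \<le> \<bar>\<xi> - \<xi>'\<bar>"
proof -
  have "\<bar>(\<xi> - of_int i) / 4 - (\<xi>' - of_int i) / 4\<bar> = \<bar>\<xi> - \<xi>'\<bar> / 4"
    by (simp add: diff_divide_distrib[symmetric])
  then have "4 * \<bar>dist_Ints ((\<xi> - of_int i) / 4) - dist_Ints ((\<xi>' - of_int i) / 4)\<bar> \<le> \<bar>\<xi> - \<xi>'\<bar>"
    using dist_Ints_lipschitz[of "(\<xi> - of_int i) / 4" "(\<xi>' - of_int i) / 4"] by simp
  then show ?thesis
    using abs_max_diff_le[of 0 "1 - 4 * dist_Ints ((\<xi> - of_int i) / 4)" 0 "1 - 4 * dist_Ints ((\<xi>' - of_int i) / 4)"]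
    unfolding tent_def by (smt (verit))
qed

lemma tent_int: "tent i (of_int c) = (if (c - i) mod 4 = 0 then 1 else 0)"
proof (cases "(c - i) mod 4 = 0")
  case True
  then have "c - i = 4 * ((c - i) div 4)" using mult_div_mod_eq[of 4 "c - i"] by simp
  then have "real_of_int (c - i) = of_int (4 * ((c - i) div 4))" by (rule arg_cong)
  then have "(real_of_int c - of_int i) / 4 = of_int ((c - i) div 4)" by simp
  then show ?thesis using True by (simp add: tent_def)
next
  case False
  define m where "m = round ((real_of_int c - of_int i) / 4)"
  have "c - i - 4 * m \<noteq> 0" using False by auto
  then have "1 \<le> \<bar>real_of_int (c - i - 4 * m)\<bar>" by linarith
  moreover have eq: "(real_of_int c - of_int i) / 4 - of_int m = of_int (c - i - 4 * m) / 4" by simp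
  ultimately have "1/4 \<le> dist_Ints ((real_of_int c - of_int i) / 4)"
    unfolding dist_Ints_def m_def[symmetric] eq abs_divide by simp
  then show ?thesis using False by (simp add: tent_def)
qed

text \<open>At an integer of class 1, 2 or 3 modulo 4 exactly one tent equals 1 and the others
  vanish; the shift of \<open>wave\<close> by that class puts its collapsing interval on the pair of
  strips glued there. Between lines the tents interpolate, and at class 0 there is no
  correction.\<close>

definition corr :: "real \<Rightarrow> real \<Rightarrow> real" where
  "corr \<xi> \<eta> = tent 1 \<xi> * wave (\<eta> - 1) + tent 2 \<xi> * wave (\<eta> - 2) + tent 3 \<xi> * wave (\<eta> - 3)"

lemma corr_bound: "\<bar>corr \<xi> \<eta>\<bar> \<le> 3"
proof -
  have "\<bar>tent i \<xi> * wave u\<bar> \<le> 1" for i u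
    using tent_bounds[of i \<xi>] wave_bound[of u] mult_mono[of "tent i \<xi>" 1 "\<bar>wave u\<bar>" 1] by (simp add: abs_mult)
  from this[of 1 "\<eta> - 1"] this[of 2 "\<eta> - 2"] this[of 3 "\<eta> - 3"] show ?thesis unfolding corr_def by (smt (verit))
qed

lemma corr_lipschitz1: "\<bar>corr \<xi> \<eta> - corr \<xi>' \<eta>\<bar> \<le> 3 * \<bar>\<xi> - \<xi>'\<bar>"
proof -
  have "\<bar>tent i \<xi> * wave u - tent i \<xi>' * wave u\<bar> \<le> \<bar>\<xi> - \<xi>'\<bar>" for i u
    using tent_lipschitz[of i \<xi> \<xi>'] wave_bound[of u] mult_mono[of "\<bar>tent i \<xi> - tent i \<xi>'\<bar>" "\<bar>\<xi> - \<xi>'\<bar>" "\<bar>wave u\<bar>" 1]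
    by (simp add: abs_mult left_diff_distrib[symmetric])
  from this[of 1 "\<eta> - 1"] this[of 2 "\<eta> - 2"] this[of 3 "\<eta> - 3"] show ?thesis unfolding corr_def by (smt (verit))
qed

lemma corr_lipschitz2: "\<bar>corr \<xi> \<eta> - corr \<xi> \<eta>'\<bar> \<le> 6 * \<bar>\<eta> - \<eta>'\<bar>"
proof -
  have "\<bar>tent i \<xi> * wave (\<eta> - a) - tent i \<xi> * wave (\<eta>' - a)\<bar> \<le> 2 * \<bar>\<eta> - \<eta>'\<bar>" for i a
    using tent_bounds[of i \<xi>] wave_lipschitz[of "\<eta> - a" "\<eta>' - a"]
      mult_mono[of "tent i \<xi>" 1 "\<bar>wave (\<eta> - a) - wave (\<eta>' - a)\<bar>" "2 * \<bar>\<eta> - \<eta>'\<bar>"]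
    by (simp add: abs_mult right_diff_distrib[symmetric])
  from this[of 1 1] this[of 2 2] this[of 3 3] show ?thesis unfolding corr_def by (smt (verit))
qed

lemma corr_zero: "c mod 4 = 0 \<Longrightarrow> corr (of_int c) \<eta> = 0"
proof -
  assume "c mod 4 = 0"
  then have "(c - 1) mod 4 \<noteq> 0" "(c - 2) mod 4 \<noteq> 0" "(c - 3) mod 4 \<noteq> 0" by presburger+
  then show ?thesis by (simp add: corr_def tent_int)
qed

text \<open>With \<open>s = 3 * l + i - 1\<close> both \<open>\<eta> - i\<close> and
  \<open>\<eta> + 1 - i\<close> lie within 1 of \<open>3 * l\<close>, where \<open>wave\<close> has
  slope -1; both sides equal \<open>3 * l + i\<close>.\<close>

lemma corr_glue:
  assumes c: "c mod 4 \<noteq> 0" and s: "s mod 3 = c mod 4 - 1" and \<eta>: "of_int s \<le> \<eta>" "\<eta> \<le> of_int s + 1"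
  shows "\<eta> + corr (of_int c) \<eta> = (\<eta> + 1) + corr (of_int c) (\<eta> + 1)"
proof -
  define i where "i = c mod 4"
  have i: "i = 1 \<or> i = 2 \<or> i = 3" unfolding i_def using c by presburger
  have corr: "corr (of_int c) u = wave (u - of_int i)" for u
  proof -
    have "(c - k) mod 4 = 0 \<longleftrightarrow> k = i" if "k \<in> {1,2,3}" for k using that unfolding i_def by auto presburger+
    then show ?thesis using i by (auto simp: corr_def tent_int)
  qed
  define l where "l = s div 3"
  have sl: "s = 3 * l + i - 1" using s unfolding l_def i_def by presburger
  have "wave (\<eta> - of_int i) = 3 * of_int l - (\<eta> - of_int i)" "wave (\<eta> + 1 - of_int i) = 3 * of_int l - (\<eta> + 1 - of_int i)"
    using \<eta> by (auto intro!: wave_eq simp: sl)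
  then show ?thesis by (simp add: corr)
qed

text \<open>Both \<open>e\<close> and \<open>a + e\<close> are decreasing and bounded below, so
  \<open>a\<close> converges as their difference.\<close>

lemma telescoping_limit:
  fixes a e :: "nat \<Rightarrow> real"
  assumes step: "\<And>k. \<bar>a (Suc k) - a k\<bar> \<le> e k - e (Suc k)" and e: "\<And>k. 0 \<le> e k"
  shows "a \<longlonglongrightarrow> lim a" "\<bar>lim a - a k\<bar> \<le> e k"
proof -
  have far: "\<bar>a (k + m) - a k\<bar> \<le> e k - e (k + m)" for k m
  proof (induction m)
    case (Suc m) then show ?case using step[of "k + m"] by simp
  qed simp
  have "decseq e" by (rule decseq_SucI) (use step in \<open>smt (verit)\<close>)
  then obtain l where l: "e \<longlonglongrightarrow> l" using decseq_convergent[of e 0] e by blast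
  have "decseq (\<lambda>k. a k + e k)" by (rule decseq_SucI) (use step in \<open>smt (verit)\<close>)
  moreover have "a 0 - e 0 \<le> a k + e k" for k using far[of 0 k] e[of k] by simp
  ultimately obtain b where b: "(\<lambda>k. a k + e k) \<longlonglongrightarrow> b" using decseq_convergent by blast
  have "a \<longlonglongrightarrow> b - l" using tendsto_diff[OF b l] by simp
  then show lim: "a \<longlonglongrightarrow> lim a" by (metis limI)
  have "(\<lambda>m. \<bar>a m - a k\<bar>) \<longlonglongrightarrow> \<bar>lim a - a k\<bar>" by (intro tendsto_intros lim)
  moreover have "\<bar>a m - a k\<bar> \<le> e k" if "m \<ge> k" for m using far[of k "m - k"] e[of m] that by simp
  ultimately show "\<bar>lim a - a k\<bar> \<le> e k" using LIMSEQ_le_const2 by blast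
qed

context cell_tower begin

section \<open>Folds of one level, their compositions and the limit\<close>

definition strip_fold :: "int \<Rightarrow> real \<Rightarrow> real \<Rightarrow> real" where
  "strip_fold j x y = y + ht L j * corr (x / wd j) (y / ht L j)"

lemma strip_fold_near: "\<bar>strip_fold j x y - y\<bar> \<le> 3 * ht L j"
  using corr_bound[of "x / wd j" "y / ht L j"] mult_left_mono[of _ 3 "ht L j"] less_imp_le[OF ht_pos[of j]]
  by (simp add: strip_fold_def abs_mult mult.commute)

lemma strip_fold_lipschitz_x: "\<bar>strip_fold j x y - strip_fold j x' y\<bar> \<le> 3 * ht L j / wd j * \<bar>x - x'\<bar>"
proof -
  have "\<bar>strip_fold j x y - strip_fold j x' y\<bar> = ht L j * \<bar>corr (x / wd j) (y / ht L j) - corr (x' / wd j) (y / ht L j)\<bar>"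
    using abs_of_pos[OF ht_pos[of j]] by (simp add: strip_fold_def abs_mult right_diff_distrib[symmetric])
  also have "\<dots> \<le> ht L j * (3 * \<bar>x / wd j - x' / wd j\<bar>)"
    by (intro mult_left_mono corr_lipschitz1 less_imp_le[OF ht_pos])
  also have "\<dots> = 3 * ht L j / wd j * \<bar>x - x'\<bar>"
    using abs_of_pos[OF wd_pos[of j]] by (simp add: diff_divide_distrib[symmetric] abs_divide)
  finally show ?thesis .
qed

text \<open>Slope 1 from the identity and 6 from three waves of slope 2.\<close>

lemma strip_fold_lipschitz_y: "\<bar>strip_fold j x y - strip_fold j x y'\<bar> \<le> 7 * \<bar>y - y'\<bar>"
proof -
  have "\<bar>strip_fold j x y - strip_fold j x y'\<bar> \<le> \<bar>y - y'\<bar> + ht L j * \<bar>corr (x / wd j) (y / ht L j) - corr (x / wd j) (y' / ht L j)\<bar>"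
  proof -
    have "strip_fold j x y - strip_fold j x y' = (y - y') + ht L j * (corr (x / wd j) (y / ht L j) - corr (x / wd j) (y' / ht L j))"
      by (simp add: strip_fold_def right_diff_distrib)
    then show ?thesis using abs_triangle_ineq[of "y - y'" "ht L j * (corr (x / wd j) (y / ht L j) - corr (x / wd j) (y' / ht L j))"]
      abs_of_pos[OF ht_pos[of j]] by (simp add: abs_mult)
  qed
  also have "\<dots> \<le> \<bar>y - y'\<bar> + ht L j * (6 * \<bar>y / ht L j - y' / ht L j\<bar>)"
    by (intro add_left_mono mult_left_mono corr_lipschitz2 less_imp_le[OF ht_pos])
  also have "\<dots> = 7 * \<bar>y - y'\<bar>"
    using abs_of_pos[OF ht_pos[of j]] less_imp_neq[OF ht_pos[of j]] by (simp add: diff_divide_distrib[symmetric] abs_divide)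
  finally show ?thesis .
qed

lemma strip_fold_glue:
  assumes "glue L j x y" shows "strip_fold j x y = strip_fold j x (y + ht L j)"
proof -
  obtain c s where c: "c mod 4 \<noteq> 0" "s mod 3 = c mod 4 - 1" and x: "x = of_int c * wd j"
    and y: "of_int s * ht L j \<le> y" "y \<le> (of_int s + 1) * ht L j" using assms by (auto simp: glue_def)
  define \<eta> where "\<eta> = y / ht L j"
  have h: "ht L j \<noteq> 0" "wd j \<noteq> 0" using ht_pos[of j] wd_pos[of j] by linarith+
  have \<eta>: "of_int s \<le> \<eta>" "\<eta> \<le> of_int s + 1" "y = \<eta> * ht L j" "(y + ht L j) / ht L j = \<eta> + 1"
    using y ht_pos[of j] h by (simp_all add: \<eta>_def field_simps)
  have "ht L j * (\<eta> + corr (of_int c) \<eta>) = ht L j * ((\<eta> + 1) + corr (of_int c) (\<eta> + 1))"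
    using corr_glue[OF c \<eta>(1,2)] by simp
  then show ?thesis unfolding strip_fold_def \<eta>(4) using h x \<eta>(3) by (simp add: \<eta>_def[symmetric] algebra_simps)
qed

text \<open>A line of a coarser grid has an index divisible by 4 in every finer grid, and there
  \<open>corr\<close> vanishes. Hence folds do not disturb the gluing lines of coarser
  levels.\<close>

lemma strip_fold_trivial: "i < j \<Longrightarrow> strip_fold j (of_int c * wd i) y = y"
proof -
  assume "i < j"
  define k where "k = nat (j - i)"
  have k: "i = j - int k" "k > 0" using \<open>i < j\<close> by (auto simp: k_def)
  have "of_int c * wd i / wd j = of_int (c * 4 ^ k)"
    unfolding k(1) wd_diff_nat using less_imp_neq[OF wd_pos[of j]] by simp
  moreover have "(c * 4 ^ k) mod 4 = 0" using k(2) by (cases k) auto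
  ultimately show ?thesis unfolding strip_fold_def by (simp only: corr_zero mult_zero_right add_0_right)
qed

text \<open>The finest fold acts first. On a gluing line of level \<open>j\<close> the finer folds
  are trivial, the fold of level \<open>j\<close> merges glued points, and the coarser folds then
  receive equal arguments.\<close>

primrec height_approx :: "int \<Rightarrow> nat \<Rightarrow> real \<Rightarrow> real \<Rightarrow> real" where
  "height_approx n 0 x y = y"
| "height_approx n (Suc k) x y = height_approx n k x (strip_fold (n + 1 + int k) x y)"

definition height :: "int \<Rightarrow> real \<Rightarrow> real \<Rightarrow> real" where
  "height n x y = lim (\<lambda>k. height_approx n k x y)"

lemma height_approx_lipschitz_y: "\<bar>height_approx n k x y - height_approx n k x y'\<bar> \<le> 7 ^ k * \<bar>y - y'\<bar>"
proof (induction k arbitrary: y y')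
  case (Suc k)
  have "\<bar>height_approx n (Suc k) x y - height_approx n (Suc k) x y'\<bar> \<le>
      7 ^ k * \<bar>strip_fold (n + 1 + int k) x y - strip_fold (n + 1 + int k) x y'\<bar>" using Suc by simp
  also have "\<dots> \<le> 7 ^ k * (7 * \<bar>y - y'\<bar>)" by (intro mult_left_mono strip_fold_lipschitz_y) simp
  finally show ?case by simp
qed simp

lemma ratio_ht_wd: "ht L (n + int k) / wd (n + int k) = ht L n / wd n * (4 / M) ^ k"
  by (simp add: ht_add_nat wd_add_nat power_divide)

text \<open>The fold added at stage \<open>k\<close> has slope
  \<open>3 * \<rho> * (4 / M) ^ k\<close> in \<open>x\<close>, and the coarser folds applied
  afterwards stretch this by at most \<open>7 ^ k\<close>. The result is a geometric series of ratio
  \<open>28 / M\<close>.\<close>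

lemma height_approx_lipschitz_x:
  "\<bar>height_approx n k x y - height_approx n k x' y\<bar> \<le> 4 * ht L (n+1) / wd (n+1) * (1 - (28 / M) ^ k) * \<bar>x - x'\<bar>"
proof (induction k arbitrary: y)
  case (Suc k)
  define \<rho> q where "\<rho> = ht L (n+1) / wd (n+1)" and "q = 28 / M"
  have \<rho>: "0 < \<rho>" and q: "0 \<le> q" "q \<le> 1/4" using M_ge by (auto simp: \<rho>_def q_def)
  let ?f = "\<lambda>x. strip_fold (n + 1 + int k) x y"
  have "\<bar>height_approx n k x' (?f x) - height_approx n k x' (?f x')\<bar> \<le> 7 ^ k * \<bar>?f x - ?f x'\<bar>"
    by (rule height_approx_lipschitz_y)
  also have "\<dots> \<le> 7 ^ k * (3 * ht L (n + 1 + int k) / wd (n + 1 + int k) * \<bar>x - x'\<bar>)"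
    by (intro mult_left_mono strip_fold_lipschitz_x) simp
  also have "\<dots> = 3 * \<rho> * q ^ k * \<bar>x - x'\<bar>"
  proof -
    have "7 ^ k * (4 / M) ^ k = q ^ k" by (simp add: q_def power_divide power_mult_distrib[symmetric])
    then have "7 ^ k * (ht L (n + 1 + int k) / wd (n + 1 + int k)) = \<rho> * q ^ k"
      unfolding ratio_ht_wd \<rho>_def by (metis mult.left_commute)
    then show ?thesis by (metis (no_types, opaque_lifting) mult.assoc mult.left_commute times_divide_eq_right)
  qed
  finally have 1: "\<bar>height_approx n k x' (?f x) - height_approx n k x' (?f x')\<bar> \<le> 3 * \<rho> * q ^ k * \<bar>x - x'\<bar>" .
  have 2: "\<bar>height_approx n k x (?f x) - height_approx n k x' (?f x)\<bar> \<le> 4 * \<rho> * (1 - q ^ k) * \<bar>x - x'\<bar>"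
    using Suc[of "?f x"] by (simp add: \<rho>_def q_def)
  \<comment> \<open>The induction closes with the constant 4 because
    \<open>4 * q \<le> 1\<close>.\<close>
  have "q ^ k * q \<le> q ^ k * (1/4)" using q by (intro mult_left_mono) auto
  then have "3 * q ^ k + 4 * (1 - q ^ k) \<le> 4 * (1 - q ^ Suc k)" by (simp add: mult.commute)
  then have "\<rho> * (3 * q ^ k + 4 * (1 - q ^ k)) * \<bar>x - x'\<bar> \<le> \<rho> * (4 * (1 - q ^ Suc k)) * \<bar>x - x'\<bar>"
    using \<rho> by (intro mult_right_mono mult_left_mono) auto
  then have "3 * \<rho> * q ^ k * \<bar>x - x'\<bar> + 4 * \<rho> * (1 - q ^ k) * \<bar>x - x'\<bar> \<le> 4 * \<rho> * (1 - q ^ Suc k) * \<bar>x - x'\<bar>"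
    by (simp add: algebra_simps)
  then show ?case using 1 2 by (simp add: \<rho>_def q_def)
qed simp

text \<open>A fold moves by at most 3 strip heights, stretched by \<open>7 ^ k\<close>. The bound
  with 4 in place of 3 telescopes since \<open>28 \<le> M\<close>.\<close>

lemma height_limit:
  "(\<lambda>k. height_approx n k x y) \<longlonglongrightarrow> height n x y"
  "\<bar>height n x y - height_approx n k x y\<bar> \<le> 4 * 7 ^ k * ht L (n + 1 + int k)"
proof -
  define e where "e k = 4 * 7 ^ k * ht L (n + 1 + int k)" for k
  have step: "\<bar>height_approx n (Suc k) x y - height_approx n k x y\<bar> \<le> e k - e (Suc k)" for k
  proof -
    have "\<bar>height_approx n (Suc k) x y - height_approx n k x y\<bar> \<le> 7 ^ k * (3 * ht L (n + 1 + int k))"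
      using order_trans[OF height_approx_lipschitz_y[of n k x "strip_fold (n + 1 + int k) x y" y]
        mult_left_mono[OF strip_fold_near[of "n + 1 + int k" x y], of "7 ^ k"]] by simp
    also have "\<dots> \<le> e k - e (Suc k)"
    proof -
      have "n + 1 + int (Suc k) = (n + 1 + int k) + 1" by simp
      then have "e (Suc k) = 7 ^ k * (28 * ht L (n + 1 + int k) / M)"
        unfolding e_def by (simp only: ht_add1) simp
      moreover have "28 * ht L (n + 1 + int k) / M \<le> ht L (n + 1 + int k)"
        using M_ge ht_pos[of "n + 1 + int k"] by (simp add: field_simps)
      then have "7 ^ k * (28 * ht L (n + 1 + int k) / M) \<le> 7 ^ k * ht L (n + 1 + int k)"
        by (intro mult_left_mono) auto
      ultimately show ?thesis by (simp add: e_def)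
    qed
    finally show ?thesis .
  qed
  have "0 \<le> e k" for k by (simp add: e_def less_imp_le)
  from telescoping_limit[of "\<lambda>k. height_approx n k x y" e, OF step this] show "(\<lambda>k. height_approx n k x y) \<longlonglongrightarrow> height n x y"
    "\<bar>height n x y - height_approx n k x y\<bar> \<le> 4 * 7 ^ k * ht L (n + 1 + int k)"
    unfolding height_def e_def by auto
qed

lemma height_near: "\<bar>height n x y - y\<bar> \<le> 4 * ht L (n + 1)"
  using height_limit(2)[of n x y 0] by simp

text \<open>Gluing lines of level at most \<open>n\<close> are of this form, so there the height is
  the plain coordinate, on which a periodic function can act.\<close>

lemma height_on_lines: "height n (of_int c * wd n) y = y"
proof -
  have "height_approx n k (of_int c * wd n) y = y" for k
    by (induction k) (auto simp: strip_fold_trivial)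
  then have "(\<lambda>k. y) \<longlonglongrightarrow> height n (of_int c * wd n) y" using height_limit(1)[of n "of_int c * wd n" y] by simp
  then show ?thesis by (simp add: LIMSEQ_const_iff)
qed

lemma height_glue:
  assumes "glue L j x y" "n < j" shows "height n x y = height n x (y + ht L j)"
proof -
  define k where "k = nat (j - n - 1)"
  have j: "j = n + 1 + int k" using assms(2) by (simp add: k_def)
  obtain c where x: "x = of_int c * wd j" using assms(1) by (auto simp: glue_def)
  \<comment> \<open>At stage \<open>Suc k\<close> the first fold has level \<open>j\<close> and
    merges the two points; later stages only precede it by folds that fix this line.\<close>
  have eq: "height_approx n (Suc k + m) x y = height_approx n (Suc k + m) x (y + ht L j)" for m
  proof (induction m)
    case 0 show ?case using strip_fold_glue[OF assms(1)] j by simp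
  next
    case (Suc m)
    have "strip_fold (n + 1 + int (Suc k + m)) x y = y" for y unfolding x by (rule strip_fold_trivial) (simp add: j)
    then show ?case using Suc by simp
  qed
  have "(\<lambda>m. height_approx n (m + Suc k) x z) \<longlonglongrightarrow> height n x z" for z
    using LIMSEQ_ignore_initial_segment[OF height_limit(1)] .
  from this[of y] this[of "y + ht L j"] show ?thesis
    using eq by (simp add: add.commute LIMSEQ_unique)
qed

text \<open>Composing only the folds coarser than \<open>i\<close> keeps the stretched cell height
  \<open>7 ^ k * ht L i\<close> below \<open>\<rho> * wd i\<close>, because the aspect ratio decays
  like \<open>(4 / M) ^ k\<close>.\<close>

lemma height_osc:
  assumes "n < i" "\<bar>x - x'\<bar> \<le> wd i" "\<bar>y - y'\<bar> \<le> ht L i"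
  shows "\<bar>height n x y - height n x' y'\<bar> \<le> 16 * ht L (n+1) / wd (n+1) * wd i"
proof -
  define k where "k = nat (i - n - 1)"
  have i: "i = n + 1 + int k" using assms(1) by (simp add: k_def)
  define \<rho> q where "\<rho> = ht L (n+1) / wd (n+1)" and "q = 28 / M"
  have \<rho>: "0 < \<rho>" and q: "0 \<le> q" "q \<le> 1" using M_ge by (auto simp: \<rho>_def q_def)
  have "7 ^ k * ht L i = 7 ^ k * (ht L i / wd i) * wd i" using less_imp_neq[OF wd_pos[of i]] by simp
  also have "\<dots> = \<rho> * q ^ k * wd i" unfolding i ratio_ht_wd
    by (simp add: \<rho>_def q_def power_divide power_mult_distrib[symmetric])
  also have "\<dots> \<le> \<rho> * 1 * wd i" using \<rho> q by (intro mult_right_mono mult_left_mono power_le_one) auto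
  finally have e: "7 ^ k * ht L i \<le> \<rho> * wd i" by simp
  have 1: "\<bar>height n x y - height_approx n k x y\<bar> \<le> 4 * (\<rho> * wd i)" for x y
    using height_limit(2)[of n x y k] e unfolding i by simp
  have 2: "\<bar>height_approx n k x' y - height_approx n k x' y'\<bar> \<le> \<rho> * wd i"
    using height_approx_lipschitz_y[of n k x' y y'] mult_left_mono[OF assms(3), of "7 ^ k"] e
    by (meson order_trans zero_le_numeral zero_le_power)
  have "4 * \<rho> * (1 - q ^ k) * \<bar>x - x'\<bar> \<le> 4 * \<rho> * 1 * wd i"
    using assms(2) \<rho> q power_le_one[OF q] less_imp_le[OF wd_pos[of i]] by (intro mult_mono) auto
  then have 3: "\<bar>height_approx n k x y - height_approx n k x' y\<bar> \<le> 4 * (\<rho> * wd i)"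
    using height_approx_lipschitz_x[of n k x y x'] by (simp add: \<rho>_def q_def)
  have "0 \<le> \<rho> * wd i" using \<rho> by (simp add: less_imp_le)
  \<comment> \<open>The errors are 4 + 4 from the two limits, 1 from \<open>y\<close> and 4 from
    \<open>x\<close>; their sum 13 is rounded up to 16.\<close>
  then have "\<bar>height n x y - height n x' y'\<bar> \<le> 16 * (\<rho> * wd i)"
    using 1[of x y] 1[of x' y'] 2 3 by linarith
  then show ?thesis by (simp add: \<rho>_def)
qed

end

subsection \<open>Cutoff functions\<close>

context cell_tower begin

section \<open>Arithmetic of coarse gluing lines\<close>

lemma ht_next_le: "300 * ht L (n + 1) \<le> ht L n"
proof -
  have "300 * ht L (n + 1) \<le> M * ht L (n + 1)" using M_ge by (intro mult_right_mono) auto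
  then show ?thesis using M_pos by (simp add: ht_add1 del: M_pos)
qed

lemma coarse_line: "j \<le> n \<Longrightarrow> \<exists>c'. of_int c * wd j = of_int c' * wd n"
proof -
  assume "j \<le> n"
  define k where "k = nat (n - j)"
  have "j = n - int k" using \<open>j \<le> n\<close> by (simp add: k_def)
  then show ?thesis by (intro exI[of _ "c * 4 ^ k"]) (simp add: wd_diff_nat)
qed

lemma coarse_height: assumes "j \<le> n" obtains D :: int where "1 \<le> D" "ht L j = of_int D * ht L n"
proof -
  define k where "k = nat (n - j)"
  have j: "j = n - int k" using assms by (simp add: k_def)
  show ?thesis
  proof (rule that)
    show "1 \<le> (3 * int L) ^ k" using L100 by (intro one_le_power) simp
    show "ht L j = of_int ((3 * int L) ^ k) * ht L n" by (simp add: j ht_diff_nat M_eq)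
  qed
qed

text \<open>An index not divisible by 4 shows that the line is absent from every coarser grid, so
  the line determines its level.\<close>

lemma line_unique:
  assumes "c mod 4 \<noteq> 0" "c' mod 4 \<noteq> 0" "of_int c * wd j = of_int c' * wd j'"
  shows "j = j'" "c = c'"
proof -
  have le: "j' \<le> j" if "c mod 4 \<noteq> 0" "c' mod 4 \<noteq> 0" "of_int c * wd j = of_int c' * wd j'" for c c' j j'
  proof (rule ccontr)
    assume "\<not> j' \<le> j"
    define k where "k = nat (j' - j)"
    have j: "j = j' - int k" and "k > 0" using \<open>\<not> j' \<le> j\<close> by (auto simp: k_def)
    have "of_int (c * 4 ^ k) * wd j' = of_int c' * wd j'" using that(3) by (simp add: j wd_diff_nat)
    then have "c' = c * 4 ^ k" by (simp only: mult_cancel_right wd_neq_0 of_int_eq_iff simp_thms)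
    then show False using that(2) \<open>k > 0\<close> by (cases k) auto
  qed
  show "j = j'" using le[OF assms] le[OF assms(2,1) assms(3)[symmetric]] by simp
  then show "c = c'" using assms(3) by simp
qed

text \<open>Both lines belong to the grid of spacing \<open>wd n\<close>, hence a window narrower
  than that contains at most one of them.\<close>

lemma line_close:
  assumes "j \<le> n" "j' \<le> n" "\<bar>of_int c * wd j - of_int c' * wd j'\<bar> < wd n"
  shows "of_int c * wd j = of_int c' * wd j'"
proof -
  obtain d d' where d: "of_int c * wd j = of_int d * wd n" "of_int c' * wd j' = of_int d' * wd n"
    using coarse_line assms(1,2) by metis
  have "\<bar>real_of_int (d - d')\<bar> * wd n < 1 * wd n"
    using assms(3) unfolding d by (simp add: abs_mult left_diff_distrib[symmetric])
  then have "\<bar>real_of_int (d - d')\<bar> < 1" using mult_less_cancel_right_pos[OF wd_pos] by blast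
  then have "d = d'" by linarith
  then show ?thesis using d by simp
qed

text \<open>A tent around \<open>z\<close>, repeated with the period of the only coarse line that meets the window, and cut
  off to a union of strips that is saturated for that line.\<close>

lemma periodic_tent_exists:
  fixes z x0 e :: real
  assumes e: "0 < e" "e \<le> ht L n / 4"
  shows "\<exists>\<tau> h. (\<forall>y y'. \<bar>\<tau> y - \<tau> y'\<bar> \<le> \<bar>y - y'\<bar>) \<and> (\<forall>y. 0 \<le> \<tau> y \<and> \<tau> y \<le> e) \<and> \<tau> z = (0::real) \<and>
    (\<forall>j x y. j \<le> n \<longrightarrow> glue L j x y \<longrightarrow> \<bar>x - x0\<bar> < wd n / 4 \<longrightarrow> \<tau> y = \<tau> (y + ht L j)) \<and>
    (\<forall>y. \<tau> y < e \<longrightarrow> (\<exists>k\<in>{-3..3::int}. \<bar>y - z - of_int k * h\<bar> < e))"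
proof (cases "\<exists>j c. j \<le> n \<and> c mod 4 \<noteq> 0 \<and> \<bar>of_int c * wd j - x0\<bar> < wd n / 4")
  case False
  \<comment> \<open>No coarse gluing line meets the window, so a single truncated tent works, with
    period 0.\<close>
  define \<tau> where "\<tau> y = min e \<bar>y - z\<bar>" for y
  have 1: "\<bar>\<tau> y - \<tau> y'\<bar> \<le> \<bar>y - y'\<bar>" for y y' unfolding \<tau>_def by (smt (verit))
  have 2: "\<tau> y = \<tau> (y + ht L j)" if "j \<le> n" "glue L j x y" "\<bar>x - x0\<bar> < wd n / 4" for j x y
    using False that unfolding glue_def by blast
  have 3: "\<exists>k\<in>{-3..3::int}. \<bar>y - z - of_int k * 0\<bar> < e" if "\<tau> y < e" for y
    using that by (intro bexI[of _ 0]) (auto simp: \<tau>_def)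
  have 4: "0 \<le> \<tau> y \<and> \<tau> y \<le> e" "\<tau> z = 0" for y using e by (auto simp: \<tau>_def)
  from 1 2 3 4 show ?thesis by metis
next
  case True
  then obtain j c where j: "j \<le> n" and c: "c mod 4 \<noteq> 0" and x0: "\<bar>of_int c * wd j - x0\<bar> < wd n / 4" by blast
  define h i where "h = ht L j" and "i = c mod 4"
  have h: "0 < h" "e \<le> h / 4" using e ht_mono[OF j] by (auto simp: h_def)
  \<comment> \<open>\<open>\<theta>\<close> keeps the edges of the cut at distance at least
    \<open>h / 4 \<ge> e\<close> from all translates of \<open>z\<close> by multiples of
    \<open>h\<close>. There the tent already has the value \<open>e\<close>, so the cut creates no
    jump.\<close>
  obtain \<theta> where \<theta>: "\<theta> = 1/4 \<or> \<theta> = 3/4" and far: "1/4 \<le> dist_Ints (z / h - \<theta>)"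
    using dist_Ints_quarters[of "z / h"] by blast
  \<comment> \<open>The edges \<open>3 * l + off\<close> fall inside the third, unglued strip of
    each period, so no glued pair is split.\<close>
  define off where "off = of_int i - 2 + \<theta>"
  define l where "l = \<lfloor>(z / h - off) / 3\<rfloor>"
  define A where "A = 3 * of_int l + off"
  have zA: "A \<le> z / h" "z / h < A + 3"
    unfolding A_def l_def using floor_divide_lower[of 3 "z / h - off"] floor_divide_upper[of 3 "z / h - off"]
    by (simp_all add: algebra_simps)
  define f where "f y = h * dist_Ints ((y - z) / h)" for y
  define \<tau> where "\<tau> y = (if A \<le> y / h \<and> y / h \<le> A + 3 then min e (f y) else e)" for y
  have f_lip: "\<bar>f y - f y'\<bar> \<le> \<bar>y - y'\<bar>" for y y'
  proof -
    have "\<bar>f y - f y'\<bar> = h * \<bar>dist_Ints ((y - z) / h) - dist_Ints ((y' - z) / h)\<bar>"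
      using h by (simp add: f_def right_diff_distrib[symmetric] abs_mult)
    also have "\<dots> \<le> h * \<bar>(y - z) / h - (y' - z) / h\<bar>" using h by (intro mult_left_mono dist_Ints_lipschitz) auto
    also have "\<dots> = \<bar>y - y'\<bar>" using h by (simp add: diff_divide_distrib[symmetric] abs_divide)
    finally show ?thesis .
  qed
  have f_edge: "e \<le> f (h * (A + 3 * of_int m))" for m
  proof -
    have "(h * (A + 3 * of_int m) - z) / h = - (z / h - \<theta>) + of_int (3 * l + i - 2 + 3 * m)"
      using h by (simp add: A_def off_def diff_divide_distrib)
    then have "dist_Ints ((h * (A + 3 * of_int m) - z) / h) = dist_Ints (z / h - \<theta>)" by (simp only: dist_Ints_add_int dist_Ints_minus)
    then have "h * (1/4) \<le> f (h * (A + 3 * of_int m))" unfolding f_def using far h by (intro mult_left_mono) auto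
    then show ?thesis using h by linarith
  qed
  have edge: "\<bar>\<tau> y - e\<bar> \<le> \<bar>y - y'\<bar>" if y: "A \<le> y / h" "y / h \<le> A + 3" and y': "\<not> (A \<le> y' / h \<and> y' / h \<le> A + 3)" for y y'
  proof -
    \<comment> \<open>\<open>b\<close> is the edge of the cut that lies between \<open>y\<close> and
      \<open>y'\<close>.\<close>
    have "\<exists>b. e \<le> f b \<and> \<bar>y - b\<bar> \<le> \<bar>y - y'\<bar>"
    proof (cases "A \<le> y' / h")
      case True
      then have "h * (A + 3) \<le> y'" "y \<le> h * (A + 3)" using y y' h by (simp_all add: field_simps)
      then show ?thesis using f_edge[of 1] by (intro exI[of _ "h * (A + 3)"]) auto
    next
      case False
      then have "y' \<le> h * A" "h * A \<le> y" using y y' h by (simp_all add: field_simps)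
      then show ?thesis using f_edge[of 0] by (intro exI[of _ "h * A"]) auto
    qed
    then show ?thesis using y f_lip unfolding \<tau>_def by (smt (verit))
  qed
  have 1: "\<bar>\<tau> y - \<tau> y'\<bar> \<le> \<bar>y - y'\<bar>" for y y'
  proof (cases "A \<le> y / h \<and> y / h \<le> A + 3"; cases "A \<le> y' / h \<and> y' / h \<le> A + 3")
    assume a: "A \<le> y / h \<and> y / h \<le> A + 3" "A \<le> y' / h \<and> y' / h \<le> A + 3"
    show ?thesis unfolding \<tau>_def if_P[OF a(1)] if_P[OF a(2)] using abs_min_diff_le f_lip order_trans by blast
  next
    assume a: "A \<le> y / h \<and> y / h \<le> A + 3" "\<not> (A \<le> y' / h \<and> y' / h \<le> A + 3)"
    then have "\<tau> y' = e" by (auto simp: \<tau>_def)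
    then show ?thesis using edge[of y y'] a by simp
  next
    assume a: "\<not> (A \<le> y / h \<and> y / h \<le> A + 3)" "A \<le> y' / h \<and> y' / h \<le> A + 3"
    then have "\<tau> y = e" by (auto simp: \<tau>_def)
    then show ?thesis using edge[of y' y] a by (simp add: abs_minus_commute)
  next
    assume a: "\<not> (A \<le> y / h \<and> y / h \<le> A + 3)" "\<not> (A \<le> y' / h \<and> y' / h \<le> A + 3)"
    show ?thesis unfolding \<tau>_def if_not_P[OF a(1)] if_not_P[OF a(2)] by simp
  qed
  have 2: "\<tau> y = \<tau> (y + ht L j')" if j': "j' \<le> n" and g: "glue L j' x y" and x: "\<bar>x - x0\<bar> < wd n / 4" for j' x y
  proof -
    obtain c' s where c': "c' mod 4 \<noteq> 0" and s: "s mod 3 = c' mod 4 - 1" and xc: "x = of_int c' * wd j'"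
      and y: "of_int s * ht L j' \<le> y" "y \<le> (of_int s + 1) * ht L j'" using g by (auto simp: glue_def)
    have "\<bar>of_int c * wd j - of_int c' * wd j'\<bar> < wd n" using x0 x wd_pos[of n] unfolding xc by argo
    then have "of_int c * wd j = of_int c' * wd j'" by (rule line_close[OF j j'])
    then have jj: "j' = j" "c' = c" using line_unique[OF c c'] by auto
    define l' where "l' = s div 3"
    have sl: "s = 3 * l' + i - 1" using s unfolding l'_def i_def jj by presburger
    have yh: "3 * of_int l' + of_int i - 1 \<le> y / h" "y / h \<le> 3 * of_int l' + of_int i" "(y + h) / h = y / h + 1"
      using y h unfolding jj h_def[symmetric] sl by (simp_all add: pos_le_divide_eq pos_divide_le_eq add_divide_distrib)
    \<comment> \<open>Both strips of the pair \<open>l'\<close> lie in the cut for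
      \<open>l' = l\<close> and both lie outside otherwise.\<close>
    have in_iff: "(A \<le> y / h \<and> y / h \<le> A + 3) \<longleftrightarrow> l' = l" "(A \<le> y / h + 1 \<and> y / h + 1 \<le> A + 3) \<longleftrightarrow> l' = l"
    proof -
      have "l' = l \<or> l' \<le> l - 1 \<or> l' \<ge> l + 1" by linarith
      moreover have "l' \<le> l - 1 \<Longrightarrow> real_of_int l' \<le> of_int l - 1" "l' \<ge> l + 1 \<Longrightarrow> real_of_int l' \<ge> of_int l + 1" by linarith+
      ultimately show "(A \<le> y / h \<and> y / h \<le> A + 3) \<longleftrightarrow> l' = l" "(A \<le> y / h + 1 \<and> y / h + 1 \<le> A + 3) \<longleftrightarrow> l' = l"
        using yh \<theta> unfolding A_def off_def by auto
    qed
    have "f (y + h) = f y"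
    proof -
      have "(y + h - z) / h = (y - z) / h + of_int 1" using h by (simp add: field_simps)
      then show ?thesis unfolding f_def by (simp only: dist_Ints_add_int)
    qed
    then show ?thesis unfolding jj(1) h_def[symmetric] \<tau>_def yh(3) in_iff by simp
  qed
  have 3: "\<exists>k\<in>{-3..3::int}. \<bar>y - z - of_int k * h\<bar> < e" if t: "\<tau> y < e" for y
  proof -
    have y: "A \<le> y / h" "y / h \<le> A + 3" "f y < e" using t by (auto simp: \<tau>_def split: if_splits)
    define k where "k = round ((y - z) / h)"
    have "\<bar>y - z - of_int k * h\<bar> = h * \<bar>(y - z) / h - of_int k\<bar>"
    proof -
      have "y - z - of_int k * h = h * ((y - z) / h - of_int k)" using h by (simp add: field_simps)
      then show ?thesis using h by (simp add: abs_mult)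
    qed
    also have "\<dots> = f y" by (simp add: f_def dist_Ints_def k_def)
    finally have 1: "\<bar>y - z - of_int k * h\<bar> < e" using y by simp
    \<comment> \<open>Both points lie in a cut of length 3 in units of \<open>h\<close>, which
      leaves seven possible translates.\<close>
    have "\<bar>(y - z) / h\<bar> \<le> 3" using y zA by (simp add: diff_divide_distrib)
    then have "-3 \<le> (y - z) / h" "(y - z) / h \<le> 3" unfolding abs_le_iff by linarith+
    then have "round (-3 :: real) \<le> k" "k \<le> round (3::real)" unfolding k_def by (intro round_mono; simp)+
    then have "k \<in> {-3..3}" using round_of_int[where 'a=real, of "-3"] round_of_int[where 'a=real, of 3] by simp
    then show ?thesis using 1 by blast
  qed
  have 4: "0 \<le> \<tau> y \<and> \<tau> y \<le> e" for y using e h by (auto simp: \<tau>_def f_def)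
  have 5: "\<tau> z = 0" using e zA by (simp add: \<tau>_def f_def dist_Ints_def)
  from 1 2 3 4 5 show ?thesis by blast
qed

text \<open>The cutoff is the larger of the horizontal distance and a rescaled tent of the height,
  truncated at \<open>wd (n+1)\<close>. Truncation settles all cells of level at most
  \<open>n\<close>, and also the gluings on lines at least \<open>wd (n+1)\<close> away from
  \<open>x0\<close>. On nearer lines, fine gluings preserve the height and coarse ones the
  tent.\<close>

lemma cutoff_exists:
  "\<exists>\<phi> h. (\<forall>j x y. glue L j x y \<longrightarrow> \<phi> (x, y) = \<phi> (x, y + ht L j)) \<and>
     (\<forall>i a b. \<forall>p\<in>cellY L i a b. \<forall>q\<in>cellY L i a b. \<bar>\<phi> p - \<phi> q\<bar> \<le> wd i) \<and>
     \<phi> (x0, y0) = 0 \<and> (\<forall>p. 0 \<le> \<phi> p \<and> \<phi> p \<le> wd (n+1)) \<and>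
     (\<forall>x y. \<phi> (x, y) < wd (n+1) \<longrightarrow> \<bar>x - x0\<bar> < wd (n+1) \<and> (\<exists>k\<in>{-3..3::int}. \<bar>y - y0 - of_int k * h\<bar> < ht L n))"
proof -
  \<comment> \<open>16 is the constant of \<open>height_osc\<close>: the factor \<open>K\<close>
    turns that bound into exactly \<open>wd i\<close>.\<close>
  define c0 e K where "c0 = wd (n+1)" and "e = 16 * ht L (n+1)" and "K = wd (n+1) / (16 * ht L (n+1))"
  have c0: "0 < c0" "c0 = wd n / 4" and K: "0 < K" "K * e = c0" by (simp_all add: c0_def K_def e_def wd_add1)
  have e: "0 < e" "e \<le> ht L n / 4"
    using ht_next_le[of n] ht_pos[of "n+1"] unfolding e_def by linarith+
  obtain \<tau> h where \<tau>: "\<And>y y'. \<bar>\<tau> y - \<tau> y'\<bar> \<le> \<bar>y - y'\<bar>" "\<And>y. 0 \<le> \<tau> y" "\<And>y. \<tau> y \<le> e" "\<tau> (height n x0 y0) = 0"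
    and \<tau>_glue: "\<And>j x y. j \<le> n \<Longrightarrow> glue L j x y \<Longrightarrow> \<bar>x - x0\<bar> < wd n / 4 \<Longrightarrow> \<tau> y = \<tau> (y + ht L j)"
    and \<tau>_supp: "\<And>y. \<tau> y < e \<Longrightarrow> \<exists>k\<in>{-3..3::int}. \<bar>y - height n x0 y0 - of_int k * h\<bar> < e"
    using periodic_tent_exists[OF e, of "height n x0 y0" x0] by blast
  define \<phi> where "\<phi> p = min c0 (max \<bar>fst p - x0\<bar> (K * \<tau> (height n (fst p) (snd p))))" for p
  have glue: "\<phi> (x, y) = \<phi> (x, y + ht L j)" if g: "glue L j x y" for j x y
  proof (cases "\<bar>x - x0\<bar> < c0")
    case True
    have "\<tau> (height n x y) = \<tau> (height n x (y + ht L j))"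
    proof (cases "j \<le> n")
      case jn: True
      obtain c where "x = of_int c * wd j" using g by (auto simp: glue_def)
      then obtain c' where "x = of_int c' * wd n" using coarse_line[OF jn] by metis
      then have "height n x y = y" for y by (simp add: height_on_lines)
      then show ?thesis using \<tau>_glue[OF jn g] True c0 by simp
    qed (use height_glue[OF g] in simp)
    then show ?thesis by (simp add: \<phi>_def)
  qed (simp add: \<phi>_def)
  have range: "0 \<le> \<phi> p" "\<phi> p \<le> c0" for p using c0(1) by (auto simp: \<phi>_def le_max_iff_disj)
  have osc: "\<bar>\<phi> p - \<phi> q\<bar> \<le> wd i" if p: "p \<in> cellY L i a b" and q: "q \<in> cellY L i a b" for i a b p q
  proof (cases "i \<le> n")
    case True
    have "c0 \<le> wd i" using wd_mono[of i "n+1"] True by (simp add: c0_def)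
    then show ?thesis using range[of p] range[of q] by (smt (verit))
  next
    case False
    have d: "\<bar>fst p - fst q\<bar> \<le> wd i" "\<bar>snd p - snd q\<bar> \<le> ht L i"
      using p q by (auto simp: cellY_eq algebra_simps)
    have "\<bar>\<tau> (height n (fst p) (snd p)) - \<tau> (height n (fst q) (snd q))\<bar> \<le> 16 * ht L (n+1) / wd (n+1) * wd i"
      using \<tau>(1) height_osc[OF _ d, of n] False order_trans by (meson not_le)
    then have "K * \<bar>\<tau> (height n (fst p) (snd p)) - \<tau> (height n (fst q) (snd q))\<bar> \<le> K * (16 * ht L (n+1) / wd (n+1) * wd i)"
      using K by (intro mult_left_mono) auto
    also have "\<dots> = wd i" by (simp add: K_def)
    finally have 2: "\<bar>K * \<tau> (height n (fst p) (snd p)) - K * \<tau> (height n (fst q) (snd q))\<bar> \<le> wd i"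
      using K by (simp add: right_diff_distrib[symmetric] abs_mult)
    have 1: "\<bar>\<bar>fst p - x0\<bar> - \<bar>fst q - x0\<bar>\<bar> \<le> wd i" using d(1) by (smt (verit))
    have "\<bar>\<phi> p - \<phi> q\<bar> \<le> \<bar>max \<bar>fst p - x0\<bar> (K * \<tau> (height n (fst p) (snd p))) - max \<bar>fst q - x0\<bar> (K * \<tau> (height n (fst q) (snd q)))\<bar>"
      unfolding \<phi>_def by (rule abs_min_diff_le)
    also have "\<dots> \<le> wd i" using 1 2 by (intro order_trans[OF abs_max_diff_le]) simp
    finally show ?thesis .
  qed
  have zero: "\<phi> (x0, y0) = 0" using c0(1) \<tau>(4) by (simp add: \<phi>_def)
  have supp: "\<bar>x - x0\<bar> < c0 \<and> (\<exists>k\<in>{-3..3::int}. \<bar>y - y0 - of_int k * h\<bar> < ht L n)" if lt: "\<phi> (x, y) < c0" for x y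
  proof -
    have x: "\<bar>x - x0\<bar> < c0" and "K * \<tau> (height n x y) < K * e" using lt K by (auto simp: \<phi>_def min_def split: if_splits)
    then have "\<tau> (height n x y) < e" using mult_less_cancel_left_pos[OF K(1)] by blast
    then obtain k where k: "k \<in> {-3..3::int}" "\<bar>height n x y - height n x0 y0 - of_int k * h\<bar> < e" using \<tau>_supp by blast
    \<comment> \<open>The heights differ from the coordinates by 4 units \<open>ht L (n+1)\<close>
      each; together with \<open>e\<close> this makes 24, well below 300.\<close>
    then have "\<bar>y - y0 - of_int k * h\<bar> < ht L n"
      using k(2) height_near[of n x y] height_near[of n x0 y0] ht_next_le[of n] ht_pos[of "n+1"]
      unfolding e_def by (smt (verit))
    then show ?thesis using x k(1) by blast
  qed
  from glue osc zero range supp show ?thesis unfolding c0_def by blast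
qed

end

subsection \<open>Cells meeting a small ball\<close>

context cell_tower begin

section \<open>Adjacency of cells of one level\<close>

abbreviation cell :: "int \<Rightarrow> int \<times> int \<Rightarrow> (real \<times> real) set" where
  "cell n v \<equiv> cellY L n (fst v) (snd v)"

definition touching :: "int \<times> int \<Rightarrow> int \<times> int \<Rightarrow> bool" where
  "touching u v \<longleftrightarrow> \<bar>fst u - fst v\<bar> \<le> 1 \<and> \<bar>snd u - snd v\<bar> \<le> 1"

text \<open>One line glues the two cells along their full height, so row averages can be compared
  across it. The cell \<open>u\<close> is the lower one.\<close>

definition glued :: "int \<Rightarrow> int \<times> int \<Rightarrow> int \<times> int \<Rightarrow> bool" where
  "glued n u v \<longleftrightarrow> fst u = fst v \<and> (\<exists>j\<le>n. \<exists>x. of_int (snd v) * ht L n = of_int (snd u) * ht L n + ht L j \<and>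
     of_int (fst u) * wd n \<le> x \<and> x \<le> (of_int (fst u) + 1) * wd n \<and>
     (\<forall>y. of_int (snd u) * ht L n \<le> y \<longrightarrow> y \<le> (of_int (snd u) + 1) * ht L n \<longrightarrow> glue L j x y))"

definition link :: "int \<Rightarrow> ((int \<times> int) \<times> (int \<times> int)) set" where
  "link n = {(u, v). touching u v \<or> glued n u v \<or> glued n v u}"

lemma touching_common:
  assumes "p \<in> cell n u" "p \<in> cell n v" shows "touching u v"
proof -
  have le: "a \<le> b + 1" if "of_int a * h \<le> t" "t \<le> (of_int b + 1) * h" "0 < h" for a b :: int and t h :: real
  proof -
    have "of_int a * h \<le> (of_int b + 1) * h" using that by linarith
    then have "real_of_int a \<le> of_int b + 1" using that(3) by simp
    then show ?thesis by linarith
  qed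
  have "fst u \<le> fst v + 1 \<and> snd u \<le> snd v + 1" if "p \<in> cell n u" "p \<in> cell n v" for u v
    using that le[OF _ _ wd_pos, of "fst u" n "fst p" "fst v"] le[OF _ _ ht_pos, of "snd u" n "snd p" "snd v"]
    by (simp add: cellY_eq mem_Times_iff)
  from this[OF assms] this[OF assms(2,1)] show ?thesis unfolding touching_def by linarith
qed

lemma cell_cover: "(x, y) \<in> cell n (\<lfloor>x / wd n\<rfloor>, \<lfloor>y / ht L n\<rfloor>)"
  using in_cell_floor by simp

lemma glue_cells:
  assumes g: "glue L j x y" and "j \<le> n" and a: "of_int a * wd n \<le> x" "x \<le> (of_int a + 1) * wd n"
  shows "\<exists>b b'. (x, y) \<in> cell n (a, b) \<and> (x, y + ht L j) \<in> cell n (a, b') \<and> glued n (a, b) (a, b')"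
proof -
  obtain c s where c: "c mod 4 \<noteq> 0" "s mod 3 = c mod 4 - 1" "x = of_int c * wd j"
    and y: "of_int s * ht L j \<le> y" "y \<le> (of_int s + 1) * ht L j" using g by (auto simp: glue_def)
  obtain D :: int where D: "1 \<le> D" "ht L j = of_int D * ht L n" using coarse_height[OF assms(2)] by blast
  define t where "t = \<lfloor>y / ht L n\<rfloor>"
  have t: "of_int t * ht L n \<le> y" "y \<le> (of_int t + 1) * ht L n"
    using cell_cover[of x y n] by (auto simp: t_def cellY_eq)
  have "real_of_int (s * D) \<le> y / ht L n" using y by (simp add: D pos_le_divide_eq mult.assoc)
  then have "s * D \<le> t" unfolding t_def by (simp add: le_floor_iff)
  \<comment> \<open>If \<open>y\<close> is the top end of the gluing strip, its floor names the cell
    above the strip; the minimum selects the one below, which lies inside the strip.\<close>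
  define b where "b = min t ((s + 1) * D - 1)"
  have b: "s * D \<le> b" "b + 1 \<le> (s + 1) * D" using \<open>s * D \<le> t\<close> D(1) by (auto simp: b_def algebra_simps)
  have "real_of_int b * ht L n \<le> of_int t * ht L n" by (intro mult_right_mono) (auto simp: b_def)
  then have y1: "of_int b * ht L n \<le> y" using t(1) by linarith
  have y2: "y \<le> (of_int b + 1) * ht L n"
  proof (cases "t \<le> (s + 1) * D - 1")
    case True then show ?thesis using t by (simp add: b_def)
  next
    case False
    then have "b + 1 = (s + 1) * D" by (simp add: b_def)
    then have "(real_of_int b + 1) * ht L n = (of_int s + 1) * ht L j"
      by (metis D(2) mult.assoc of_int_1 of_int_add of_int_mult)
    then show ?thesis using y(2) by simp
  qed
  have strip: "glue L j x z" if z: "of_int b * ht L n \<le> z" "z \<le> (of_int b + 1) * ht L n" for z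
  proof -
    have "real_of_int (s * D) * ht L n \<le> of_int b * ht L n" "(real_of_int b + 1) * ht L n \<le> real_of_int ((s + 1) * D) * ht L n"
      using b by (intro mult_right_mono; linarith?; simp)+
    then have "of_int s * ht L j \<le> z" "z \<le> (of_int s + 1) * ht L j"
    proof -
      have "real_of_int (s * D) * ht L n = of_int s * ht L j" "real_of_int ((s + 1) * D) * ht L n = (of_int s + 1) * ht L j"
        by (simp_all add: D(2))
      then show "of_int s * ht L j \<le> z" "z \<le> (of_int s + 1) * ht L j"
        using z \<open>real_of_int (s * D) * ht L n \<le> of_int b * ht L n\<close>
          \<open>(real_of_int b + 1) * ht L n \<le> real_of_int ((s + 1) * D) * ht L n\<close> by linarith+
    qed
    then show ?thesis using c unfolding glue_def by blast
  qed
  have b': "of_int (b + D) * ht L n = of_int b * ht L n + ht L j" by (simp add: D(2) algebra_simps)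
  have "(x, y + ht L j) \<in> cell n (a, b + D)" using a y1 y2 by (simp add: cellY_eq D(2) algebra_simps)
  moreover have "(x, y) \<in> cell n (a, b)" using a y1 y2 by (simp add: cellY_eq)
  moreover have "glued n (a, b) (a, b + D)" unfolding glued_def using strip b' a assms(2) by fastforce
  ultimately show ?thesis by blast
qed

lemma cell_parent:
  assumes "n \<le> i" shows "\<exists>v. cellY L i a b \<subseteq> cell n v"
proof -
  have anc: "\<exists>a'. {of_int a * w .. (of_int a + 1) * w} \<subseteq> {of_int a' * (of_int D * w) .. (of_int a' + 1) * (of_int D * w)}"
    if "0 < w" "1 \<le> D" for a D :: int and w :: real
  proof -
    have "D * (a div D) \<le> a" "a + 1 \<le> D * (a div D + 1)"
    proof -
      have "D * (a div D) + a mod D = a" "0 \<le> a mod D" "a mod D < D" using that(2) by simp_all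
      moreover have "D * (a div D + 1) = D * (a div D) + D" by (simp add: distrib_left)
      ultimately show "D * (a div D) \<le> a" "a + 1 \<le> D * (a div D + 1)" by linarith+
    qed
    then have "real_of_int (D * (a div D)) * w \<le> of_int a * w" "real_of_int (a + 1) * w \<le> of_int (D * (a div D + 1)) * w"
      using that(1) by (intro mult_right_mono; linarith?; simp)+
    then show ?thesis by (intro exI[of _ "a div D"]) (auto simp: algebra_simps)
  qed
  obtain D where D: "1 \<le> D" "ht L n = of_int D * ht L i" using coarse_height[OF assms] by blast
  define k where "k = nat (i - n)"
  have "n = i - int k" using assms by (simp add: k_def)
  then have E: "wd n = of_int (4 ^ k) * wd i" "(1::int) \<le> 4 ^ k" by (simp_all add: wd_diff_nat)
  obtain a' b' where "{of_int a * wd i .. (of_int a + 1) * wd i} \<subseteq> {of_int a' * wd n .. (of_int a' + 1) * wd n}"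
    "{of_int b * ht L i .. (of_int b + 1) * ht L i} \<subseteq> {of_int b' * ht L n .. (of_int b' + 1) * ht L n}"
    using anc[OF wd_pos[of i] E(2), of a] anc[OF ht_pos[of i] D(1), of b] unfolding E(1) D(2) by blast
  then have "cellY L i a b \<subseteq> cell n (a', b')" unfolding cellY_eq by (intro Sigma_mono) auto
  then show ?thesis by blast
qed

text \<open>63 is the product of 3 columns, 7 translates \<open>k\<close> and 3 rows around each
  translate.\<close>

lemma finite_window:
  fixes a0 :: int and h :: real and \<phi> :: "real \<times> real \<Rightarrow> real"
  assumes p0: "(x0, y0) \<in> cell n (a0, b0)"
    and supp: "\<And>x y. \<phi> (x, y) < c0 \<Longrightarrow> \<bar>x - x0\<bar> < wd (n+1) \<and> (\<exists>k\<in>{-3..3::int}. \<bar>y - y0 - of_int k * h\<bar> < ht L n)"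
  shows "finite {v. \<exists>q\<in>cell n v. \<phi> q < c0}" "card {v. \<exists>q\<in>cell n v. \<phi> q < c0} \<le> 63"
proof -
  define \<beta> where "\<beta> k = \<lfloor>(y0 + of_int k * h) / ht L n\<rfloor>" for k :: int
  define S where "S = {a0-1..a0+1} \<times> (\<lambda>(k, m). \<beta> k + m) ` ({-3..3} \<times> {-1..1})"
  have "{v. \<exists>q\<in>cell n v. \<phi> q < c0} \<subseteq> S"
  proof clarify
    fix a b x y assume "(x, y) \<in> cell n (a, b)" and lt: "\<phi> (x, y) < c0"
    then have x: "of_int a * wd n \<le> x" "x \<le> (of_int a + 1) * wd n" and y: "of_int b * ht L n \<le> y" "y \<le> (of_int b + 1) * ht L n"
      by (auto simp: cellY_eq)
    have x0: "of_int a0 * wd n \<le> x0" "x0 \<le> (of_int a0 + 1) * wd n" using p0 by (auto simp: cellY_eq)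
    obtain k where k: "k \<in> {-3..3}" "\<bar>y - y0 - of_int k * h\<bar> < ht L n" and xx: "\<bar>x - x0\<bar> < wd (n+1)" using supp[OF lt] by blast
    have "\<bar>x - x0\<bar> < wd n" using xx wd_mono[of n "n+1"] by simp
    then have "of_int a * wd n < (of_int a0 + 2) * wd n" "of_int a0 * wd n < (of_int a + 2) * wd n"
      using x x0 by (simp_all add: algebra_simps abs_less_iff)
    then have a: "real_of_int a < of_int a0 + 2" "real_of_int a0 < of_int a + 2" using mult_less_cancel_right_pos[OF wd_pos] by blast+
    have \<beta>: "of_int (\<beta> k) * ht L n \<le> y0 + of_int k * h" "y0 + of_int k * h \<le> (of_int (\<beta> k) + 1) * ht L n"
      using cell_cover[of x "y0 + of_int k * h" n] by (auto simp: \<beta>_def cellY_eq)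
    have "of_int b * ht L n < (of_int (\<beta> k) + 2) * ht L n" "of_int (\<beta> k) * ht L n < (of_int b + 2) * ht L n"
      using y \<beta> k(2) by (simp_all add: algebra_simps abs_less_iff)
    then have b: "real_of_int b < of_int (\<beta> k) + 2" "real_of_int (\<beta> k) < of_int b + 2" using mult_less_cancel_right_pos[OF ht_pos] by blast+
    have "b = \<beta> k + (b - \<beta> k)" "b - \<beta> k \<in> {-1..1}" using b by auto
    then have "b \<in> (\<lambda>(k, m). \<beta> k + m) ` ({-3..3} \<times> {-1..1})" using k(1) by force
    then show "(a, b) \<in> S" unfolding S_def using a by auto
  qed
  moreover have "finite S" by (simp add: S_def)
  moreover have "card S \<le> 63"
  proof -
    have "card ((\<lambda>(k, m). \<beta> k + m) ` ({-3..3} \<times> {-1..1})) \<le> card ({-3..3::int} \<times> {-1..1::int})" by (rule card_image_le) simp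
    then show ?thesis by (simp add: S_def card_cartesian_product)
  qed
  ultimately show "finite {v. \<exists>q\<in>cell n v. \<phi> q < c0}" "card {v. \<exists>q\<in>cell n v. \<phi> q < c0} \<le> 63"
    by (auto intro: finite_subset order_trans[OF card_mono])
qed

text \<open>The cutoff function, replaced by its maximal value off the connected component of the start cell,
  still is admissible; hence small balls only see cells joined to the start cell by a short chain.\<close>

lemma ball_cells:
  assumes p0: "(x0, y0) \<in> cell n u0"
  shows "\<exists>W. finite W \<and> card W \<le> 63 \<and>
    (\<forall>q v. dd (x0, y0) q < wd (n+1) \<longrightarrow> q \<in> cell n v \<longrightarrow> v \<in> W \<and> (\<exists>k\<le>3969. (u0, v) \<in> link n ^^ k))"
proof -
  define c0 where "c0 = wd (n+1)"
  obtain \<phi> h where glue: "\<And>j x y. glue L j x y \<Longrightarrow> \<phi> (x, y) = \<phi> (x, y + ht L j)"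
    and osc: "\<And>i a b p q. p \<in> cellY L i a b \<Longrightarrow> q \<in> cellY L i a b \<Longrightarrow> \<bar>\<phi> p - \<phi> q\<bar> \<le> wd i"
    and zero: "\<phi> (x0, y0) = 0" and range: "\<And>p. 0 \<le> \<phi> p" "\<And>p. \<phi> p \<le> c0"
    and supp: "\<And>x y. \<phi> (x, y) < c0 \<Longrightarrow> \<bar>x - x0\<bar> < wd (n+1) \<and> (\<exists>k\<in>{-3..3::int}. \<bar>y - y0 - of_int k * h\<bar> < ht L n)"
    using cutoff_exists[of x0 y0 n] unfolding c0_def by metis
  define W where "W = {v. \<exists>q\<in>cell n v. \<phi> q < c0}"
  have W: "finite W" "card W \<le> 63"
    using finite_window[of x0 y0 n "fst u0" "snd u0" \<phi> c0 h] p0 supp unfolding W_def by auto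
  \<comment> \<open>Links are restricted to \<open>W\<close> so that paths stay among finitely many
    cells.\<close>
  define E where "E = link n \<inter> W \<times> W"
  define comp where "comp = {v. (u0, v) \<in> E\<^sup>*}"
  have u0: "u0 \<in> W" using p0 zero by (auto simp: W_def c0_def intro!: bexI[of _ "(x0, y0)"])
  have compW: "v \<in> W" if "v \<in> comp" for v
  proof -
    have "(u0, v) \<in> E\<^sup>*" using that by (simp add: comp_def)
    then show ?thesis by (cases rule: rtranclE) (use u0 in \<open>auto simp: E_def\<close>)
  qed
  have comp_step: "w \<in> comp" if "v \<in> comp" "(v, w) \<in> link n" "w \<in> W" for v w
  proof -
    have "(v, w) \<in> E" using that compW by (simp add: E_def)
    then show ?thesis using that(1) unfolding comp_def by (simp add: rtrancl_into_rtrancl)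
  qed
  define cov where "cov q \<longleftrightarrow> (\<exists>v\<in>comp. q \<in> cell n v)" for q
  \<comment> \<open>Below the threshold, being covered does not depend on which of the cells
    containing the point is considered, since these cells touch.\<close>
  have cov_all: "v \<in> comp" if c: "cov q" "q \<in> cell n v" "\<phi> q < c0" for q v
  proof -
    obtain u where u: "u \<in> comp" "q \<in> cell n u" using c(1) unfolding cov_def by blast
    have "(u, v) \<in> link n" using touching_common[OF u(2) c(2)] by (simp add: link_def)
    moreover have "v \<in> W" using c(2,3) unfolding W_def by blast
    ultimately show ?thesis using comp_step[OF u(1)] by blast
  qed
  have cov_glue: "cov (x, y) \<longleftrightarrow> cov (x, y + ht L j)" if g: "glue L j x y" and lt: "\<phi> (x, y) < c0" for j x y
  proof -
    define a where "a = \<lfloor>x / wd n\<rfloor>"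
    have lt': "\<phi> (x, y + ht L j) < c0" using lt glue[OF g] by simp
    have "\<exists>b b'. (x, y) \<in> cell n (a, b) \<and> (x, y + ht L j) \<in> cell n (a, b') \<and> ((a, b), (a, b')) \<in> link n \<and> ((a, b'), (a, b)) \<in> link n"
    proof (cases "j \<le> n")
      case True
      have "of_int a * wd n \<le> x" "x \<le> (of_int a + 1) * wd n" using cell_cover[of x y n] by (auto simp: a_def cellY_eq)
      from glue_cells[OF g True this] show ?thesis by (auto simp: link_def)
    next
      case False
      \<comment> \<open>A gluing finer than level \<open>n\<close> moves a point by at most one cell
        height, so the cells before and after it touch.\<close>
      have hj: "ht L j \<le> ht L n" using ht_mono[of n j] False by simp
      have "y / ht L n \<le> (y + ht L j) / ht L n" "(y + ht L j) / ht L n \<le> y / ht L n + 1"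
        using hj by (simp_all add: divide_right_mono add_divide_distrib)
      then have "\<bar>\<lfloor>y / ht L n\<rfloor> - \<lfloor>(y + ht L j) / ht L n\<rfloor>\<bar> \<le> 1" by linarith
      then show ?thesis using cell_cover[of x y n] cell_cover[of x "y + ht L j" n] unfolding a_def
        by (intro exI conjI) (auto simp: link_def touching_def)
    qed
    then obtain b b' where b: "(x, y) \<in> cell n (a, b)" "(x, y + ht L j) \<in> cell n (a, b')"
      "((a, b), (a, b')) \<in> link n" "((a, b'), (a, b)) \<in> link n" by blast
    have inW: "(a, b) \<in> W" "(a, b') \<in> W" using b(1,2) lt lt' unfolding W_def by blast+
    show ?thesis
    proof
      assume "cov (x, y)"
      then have "(a, b') \<in> comp" using comp_step[OF cov_all[OF _ b(1) lt] b(3) inW(2)] by blast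
      then show "cov (x, y + ht L j)" unfolding cov_def using b(2) by blast
    next
      assume "cov (x, y + ht L j)"
      then have "(a, b) \<in> comp" using comp_step[OF cov_all[OF _ b(2) lt'] b(4) inW(1)] by blast
      then show "cov (x, y)" unfolding cov_def using b(1) by blast
    qed
  qed
  define \<psi> where "\<psi> q = (if cov q then \<phi> q else c0)" for q
  have \<psi>_range: "0 \<le> \<psi> q" "\<psi> q \<le> c0" for q using range by (auto simp: \<psi>_def c0_def)
  have \<psi>_le: "\<bar>\<psi> p - \<psi> q\<bar> \<le> dd p q" for p q
  proof (rule dd_ge_invariant)
    fix j x y assume g: "glue L j x y"
    show "\<psi> (x, y) = \<psi> (x, y + ht L j)"
    proof (cases "\<phi> (x, y) < c0")
      case True then show ?thesis using cov_glue[OF g] glue[OF g] by (simp add: \<psi>_def)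
    next
      case False
      then have "\<phi> (x, y) = c0" "\<phi> (x, y + ht L j) = c0" using range[of "(x,y)"] glue[OF g] by auto
      then show ?thesis by (simp add: \<psi>_def)
    qed
  next
    fix i a b p q assume p: "p \<in> cellY L i a b" and q: "q \<in> cellY L i a b"
    show "\<bar>\<psi> p - \<psi> q\<bar> \<le> wd i"
    proof (cases "i \<le> n")
      case True
      have "c0 \<le> wd i" using wd_mono[of i "n+1"] True by (simp add: c0_def)
      then show ?thesis using \<psi>_range[of p] \<psi>_range[of q] by (smt (verit))
    next
      case False
      then obtain v where v: "cellY L i a b \<subseteq> cell n v" using cell_parent[of n i a b] by auto
      have both: "cov q'" if "cov p'" "p' \<in> cell n v" "q' \<in> cell n v" "\<phi> p' < c0" for p' q'
        using cov_all[OF that(1,2,4)] that(3) by (auto simp: cov_def)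
      \<comment> \<open>Points of one cell of level \<open>n\<close> below the threshold are covered
        together or not at all; a mixed pair therefore has both values \<open>c0\<close>.\<close>
      have *: "\<psi> p' = \<phi> p' \<and> \<psi> q' = \<phi> q' \<or> \<psi> p' = c0 \<and> \<psi> q' = c0" if "p' \<in> cell n v" "q' \<in> cell n v" for p' q'
      proof -
        have "\<phi> p' = c0 \<or> \<phi> p' < c0" "\<phi> q' = c0 \<or> \<phi> q' < c0" using range(2)[of p'] range(2)[of q'] by linarith+
        then show ?thesis using both[of p' q'] both[of q' p'] that unfolding \<psi>_def by (cases "cov p'"; cases "cov q'") auto
      qed
      have "p \<in> cell n v" "q \<in> cell n v" using v p q by blast+
      from *[OF this] show ?thesis
      proof
        assume "\<psi> p = \<phi> p \<and> \<psi> q = \<phi> q" then show ?thesis using osc[OF p q] by simp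
      next
        assume "\<psi> p = c0 \<and> \<psi> q = c0" then show ?thesis by simp
      qed
    qed
  qed
  have "u0 \<in> comp" by (simp add: comp_def)
  then have "\<psi> (x0, y0) = 0" using p0 zero by (auto simp: \<psi>_def cov_def)
  have fin: "finite E" by (rule finite_subset[of _ "W \<times> W"]) (auto simp: E_def W(1))
  have cardE: "card E \<le> 3969"
  proof -
    have "card E \<le> card (W \<times> W)" using W(1) unfolding E_def by (intro card_mono) auto
    also have "\<dots> \<le> 63 * 63" unfolding card_cartesian_product using W(2) by (intro mult_mono) auto
    finally show ?thesis by simp
  qed
  have "v \<in> W \<and> (\<exists>k\<le>3969. (u0, v) \<in> link n ^^ k)" if "dd (x0, y0) q < wd (n+1)" "q \<in> cell n v" for q v
  proof -
    have "\<psi> q < c0" using \<psi>_le[of "(x0,y0)" q] \<open>\<psi> (x0, y0) = 0\<close> that by (simp add: c0_def)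
    then have "cov q" "\<phi> q < c0" by (auto simp: \<psi>_def split: if_splits)
    then have v: "v \<in> comp" using cov_all that(2) by blast
    \<comment> \<open>A reachable cell is reached in at most as many steps as there are edges, here
      at most 63 * 63 = 3969.\<close>
    have "(u0, v) \<in> (\<Union>k\<in>{k. k \<le> card E}. E ^^ k)"
      using v rtrancl_finite_eq_relpow[OF fin] unfolding comp_def by simp
    then obtain k where k: "k \<le> card E" "(u0, v) \<in> E ^^ k" by blast
    have "E \<subseteq> link n" by (auto simp: E_def)
    then have "E ^^ m \<subseteq> link n ^^ m" for m by (induction m) (simp_all add: relcomp_mono)
    then have "(u0, v) \<in> link n ^^ k" using k(2) by blast
    moreover have "k \<le> 3969" using k(1) cardE by linarith
    ultimately show ?thesis using v compW by blast
  qed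
  then show ?thesis using W by blast
qed

end

subsection \<open>Cell averages\<close>

lemma ennreal_tendsto_0_le:
  fixes a b :: "nat \<Rightarrow> ennreal"
  assumes "\<And>k. a k \<le> b k" "b \<longlonglongrightarrow> 0" shows "a \<longlonglongrightarrow> 0"
  by (rule tendsto_sandwich[of "\<lambda>_. 0" a sequentially b 0]) (use assms in auto)

context cell_tower begin

definition idx :: "int \<Rightarrow> real \<times> real \<Rightarrow> int \<times> int" where
  "idx n p = (\<lfloor>fst p / wd n\<rfloor>, \<lfloor>snd p / ht L n\<rfloor>)"

text \<open>Half-open cells partition the plane, whereas the closed cells of the complex
  overlap.\<close>

definition hcell :: "int \<Rightarrow> int \<times> int \<Rightarrow> (real \<times> real) set" where
  "hcell n v = {p. idx n p = v}"

definition area :: "int \<Rightarrow> real" where "area n = wd n * ht L n"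

definition children :: "int \<times> int \<Rightarrow> (int \<times> int) set" where
  "children v = {4 * fst v..<4 * fst v + 4} \<times> {3 * int L * snd v..<3 * int L * snd v + 3 * int L}"

lemma ht_small: assumes "0 < e" shows "\<exists>i\<ge>n. ht L i < e"
proof -
  obtain k where "(1 / M) ^ k < e / ht L n"
    using real_arch_pow_inv[of "e / ht L n" "1 / M"] assms M_ge by auto
  then have "ht L (n + int k) < e"
    by (simp add: ht_add_nat power_divide pos_less_divide_eq)
  then show ?thesis by (intro exI[of _ "n + int k"]) auto
qed

lemma area_pos [simp]: "0 < area n" by (simp add: area_def)

lemma area_nonneg [simp]: "0 \<le> area n" and area_neq_0 [simp]: "area n \<noteq> 0"
  using area_pos[of n] by linarith+

lemma area_add1: "area (n + 1) = area n / (4 * M)"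
  by (simp add: area_def wd_add1 ht_add1)

lemma floor_div_eq_iff: "0 < h \<Longrightarrow> \<lfloor>z / h\<rfloor> = a \<longleftrightarrow> of_int a * h \<le> z \<and> z < (of_int a + 1) * h" for z h :: real
  by (simp add: floor_eq_iff pos_le_divide_eq pos_divide_less_eq)

lemma hcell_eq: "hcell n v = {of_int (fst v) * wd n..<(of_int (fst v) + 1) * wd n} \<times>
    {of_int (snd v) * ht L n..<(of_int (snd v) + 1) * ht L n}"
  by (auto simp: hcell_def idx_def floor_div_eq_iff prod_eq_iff)

lemma hcell_subset_cell: "hcell n v \<subseteq> cell n v"
  by (auto simp: hcell_eq cellY_eq)

lemma hcell_measurable [measurable]: "hcell n v \<in> sets borel"
  unfolding hcell_eq by (intro borel_Times) auto

lemma emeasure_lborel_Times: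
  fixes A B :: "real set"
  assumes "A \<in> sets borel" "B \<in> sets borel"
  shows "emeasure lborel (A \<times> B) = emeasure lborel A * emeasure lborel B"
  unfolding lborel_prod[symmetric] using assms by (simp add: lborel.emeasure_pair_measure_Times)

lemma emeasure_hcell: "emeasure lborel (hcell n v) = ennreal (area n)"
  unfolding hcell_eq by (simp add: emeasure_lborel_Times area_def ennreal_mult[symmetric] algebra_simps)

lemma idx_parent: "idx n p = (fst (idx (n+1) p) div 4, snd (idx (n+1) p) div (3 * int L))"
proof -
  have "fst p / wd n = fst p / wd (n+1) / of_int 4" by (simp add: wd_add1)
  then have "\<lfloor>fst p / wd n\<rfloor> = \<lfloor>fst p / wd (n+1)\<rfloor> div 4" by (simp only: floor_divide_real_eq_div zero_le_numeral)
  moreover have "snd p / ht L n = snd p / ht L (n+1) / of_int (3 * int L)"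
    using M_ge by (simp add: ht_add1 M_eq)
  then have "\<lfloor>snd p / ht L n\<rfloor> = \<lfloor>snd p / ht L (n+1)\<rfloor> div (3 * int L)"
    by (metis floor_divide_real_eq_div mult_nonneg_nonneg of_nat_0_le_iff zero_le_numeral)
  ultimately show ?thesis by (simp add: idx_def)
qed

lemma in_children_iff: "u \<in> children v \<longleftrightarrow> (fst u div 4, snd u div (3 * int L)) = v"
proof -
  have div: "a div d = b \<longleftrightarrow> a \<in> {d * b..<d * b + d}" if "0 < d" for a b d :: int
  proof
    assume "a div d = b"
    then have "d * b + a mod d = a" "0 \<le> a mod d" "a mod d < d" using that by auto
    then show "a \<in> {d * b..<d * b + d}" unfolding atLeastLessThan_iff by linarith
  next
    assume "a \<in> {d * b..<d * b + d}"
    then have "a div d = b" by (intro int_div_pos_eq[of a d b "a - d * b"]) auto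
    then show "a div d = b" .
  qed
  have "0 < 3 * int L" using L100 by simp
  then show ?thesis using div[of 4 "fst u" "fst v"] div[of "3 * int L" "snd u" "snd v"]
    by (cases u; cases v) (auto simp: children_def)
qed

lemma finite_children [simp]: "finite (children v)" by (simp add: children_def)

lemma card_children: "real (card (children v)) = 4 * M"
  by (simp add: children_def card_cartesian_product M_eq)

lemma indicator_hcell_children:
  "indicator (hcell n v) p = (\<Sum>u\<in>children v. indicator (hcell (n+1) u) p :: 'a :: semiring_1)"
proof -
  have "(\<Sum>u\<in>children v. indicator (hcell (n+1) u) p :: 'a) = (\<Sum>u\<in>children v. if u = idx (n+1) p then 1 else 0)"
    by (intro sum.cong) (auto simp: hcell_def indicator_def)
  also have "\<dots> = indicator (hcell n v) p"
    by (simp add: in_children_iff hcell_def indicator_def idx_parent[of n p, symmetric])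
  finally show ?thesis ..
qed

lemma nn_integral_hcell_children:
  assumes [measurable]: "f \<in> borel_measurable borel"
  shows "(\<integral>\<^sup>+p\<in>hcell n v. f p \<partial>lborel) = (\<Sum>u\<in>children v. \<integral>\<^sup>+p\<in>hcell (n+1) u. f p \<partial>lborel)"
proof -
  have "(\<integral>\<^sup>+p\<in>hcell n v. f p \<partial>lborel) = (\<integral>\<^sup>+p. (\<Sum>u\<in>children v. f p * indicator (hcell (n+1) u) p) \<partial>lborel)"
    by (simp add: indicator_hcell_children[of n v] sum_distrib_left)
  also have "\<dots> = (\<Sum>u\<in>children v. \<integral>\<^sup>+p\<in>hcell (n+1) u. f p \<partial>lborel)"
    by (intro nn_integral_sum) measurable
  finally show ?thesis .
qed

section \<open>Integrals and mean deviations on cells\<close>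

definition cint :: "int \<Rightarrow> (real \<times> real \<Rightarrow> real) \<Rightarrow> int \<times> int \<Rightarrow> real" where
  "cint n f v = (LINT p:hcell n v|lborel. f p)"

lemma integrable_hcell: "integrable lborel f \<Longrightarrow> integrable lborel (\<lambda>p. indicator (hcell n v) p *\<^sub>R f p)" for f :: "real \<times> real \<Rightarrow> real"
  by (rule integrable_mult_indicator) simp_all

lemma cint_children: "integrable lborel f \<Longrightarrow> cint n f v = (\<Sum>u\<in>children v. cint (n+1) f u)"
  unfolding cint_def set_lebesgue_integral_def indicator_hcell_children[of n v]
  by (subst Bochner_Integration.integral_sum[symmetric])
     (auto simp: scaleR_sum_left sum_distrib_right intro: integrable_hcell[simplified])

text \<open>Left unnormalised, so that deviations of the children can be added and compared with the
  parent.\<close>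

definition dev :: "int \<Rightarrow> (real \<times> real \<Rightarrow> real) \<Rightarrow> int \<times> int \<Rightarrow> ennreal" where
  "dev n f v = (\<integral>\<^sup>+p\<in>hcell n v. ennreal \<bar>f p - cint n f v / area n\<bar> \<partial>lborel)"

lemma dev_mult:
  assumes "integrable lborel f" shows "dev n (\<lambda>p. c * f p) v = ennreal \<bar>c\<bar> * dev n f v"
proof -
  have [measurable]: "f \<in> borel_measurable borel" using borel_measurable_integrable[OF assms] by simp
  have "cint n (\<lambda>p. c * f p) v = c * cint n f v" by (simp add: cint_def)
  then have "dev n (\<lambda>p. c * f p) v = (\<integral>\<^sup>+p. ennreal \<bar>c\<bar> * (ennreal \<bar>f p - cint n f v / area n\<bar> * indicator (hcell n v) p) \<partial>lborel)"
    unfolding dev_def by (intro nn_integral_cong)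
      (simp add: mult.assoc[symmetric] ennreal_mult[symmetric] abs_mult[symmetric] right_diff_distrib)
  also have "\<dots> = ennreal \<bar>c\<bar> * dev n f v" unfolding dev_def by (intro nn_integral_cmult) measurable
  finally show ?thesis .
qed

lemma dev_add:
  assumes "integrable lborel f" "integrable lborel g"
  shows "dev n (\<lambda>p. f p + g p) v \<le> dev n f v + dev n g v"
proof -
  have [measurable]: "f \<in> borel_measurable borel" "g \<in> borel_measurable borel"
    using assms[THEN borel_measurable_integrable] by simp_all
  have "cint n (\<lambda>p. f p + g p) v = cint n f v + cint n g v"
    unfolding cint_def by (intro set_integral_add) (auto simp: set_integrable_def intro: integrable_hcell[simplified] assms)
  then have "dev n (\<lambda>p. f p + g p) v \<le> (\<integral>\<^sup>+p. ennreal \<bar>f p - cint n f v / area n\<bar> * indicator (hcell n v) p +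
     ennreal \<bar>g p - cint n g v / area n\<bar> * indicator (hcell n v) p \<partial>lborel)"
    unfolding dev_def by (intro nn_integral_mono)
      (auto simp: indicator_def ennreal_plus[symmetric] add_divide_distrib simp del: ennreal_plus intro!: ennreal_leI)
  also have "\<dots> = dev n f v + dev n g v" unfolding dev_def by (intro nn_integral_add) measurable
  finally show ?thesis .
qed

lemma cint_bound:
  assumes "integrable lborel f" shows "ennreal \<bar>cint n f v\<bar> \<le> (\<integral>\<^sup>+p\<in>hcell n v. ennreal \<bar>f p\<bar> \<partial>lborel)"
proof -
  have "ennreal (norm (cint n f v)) \<le> (\<integral>\<^sup>+p. norm (indicator (hcell n v) p *\<^sub>R f p) \<partial>lborel)"
    unfolding cint_def set_lebesgue_integral_def
    by (rule integral_norm_bound_ennreal) (rule integrable_hcell[OF assms])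
  also have "\<dots> = (\<integral>\<^sup>+p\<in>hcell n v. ennreal \<bar>f p\<bar> \<partial>lborel)"
    by (intro nn_integral_cong) (simp add: indicator_def)
  finally show ?thesis by simp
qed

lemma dev_le:
  assumes "integrable lborel f"
  shows "dev n f v \<le> 2 * (\<integral>\<^sup>+p\<in>hcell n v. ennreal \<bar>f p\<bar> \<partial>lborel)"
proof -
  have [measurable]: "f \<in> borel_measurable borel" using borel_measurable_integrable[OF assms] by simp
  define m where "m = cint n f v / area n"
  have "dev n f v \<le> (\<integral>\<^sup>+p. ennreal \<bar>f p\<bar> * indicator (hcell n v) p + ennreal \<bar>m\<bar> * indicator (hcell n v) p \<partial>lborel)"
    unfolding dev_def m_def[symmetric] by (intro nn_integral_mono)
      (auto simp: indicator_def ennreal_plus[symmetric] abs_triangle_ineq4 simp del: ennreal_plus intro!: ennreal_leI)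
  also have "\<dots> = (\<integral>\<^sup>+p\<in>hcell n v. ennreal \<bar>f p\<bar> \<partial>lborel) + ennreal \<bar>m\<bar> * emeasure lborel (hcell n v)"
    by (subst nn_integral_add) (auto simp: nn_integral_cmult_indicator)
  also have "ennreal \<bar>m\<bar> * emeasure lborel (hcell n v) = ennreal \<bar>cint n f v\<bar>"
    by (simp add: emeasure_hcell ennreal_mult[symmetric] abs_divide m_def)
  also have "\<dots> \<le> (\<integral>\<^sup>+p\<in>hcell n v. ennreal \<bar>f p\<bar> \<partial>lborel)" by (rule cint_bound[OF assms])
  finally show ?thesis by (simp add: mult_2 add_left_mono)
qed

text \<open>Total deviation from the means over the descendants \<open>k\<close> levels below
  \<open>v\<close>.\<close>

primrec devs :: "nat \<Rightarrow> int \<Rightarrow> (real \<times> real \<Rightarrow> real) \<Rightarrow> int \<times> int \<Rightarrow> ennreal" where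
  "devs 0 n f v = dev n f v"
| "devs (Suc k) n f v = (\<Sum>u\<in>children v. devs k (n+1) f u)"

lemma devs_mult: "integrable lborel f \<Longrightarrow> devs k n (\<lambda>p. c * f p) v = ennreal \<bar>c\<bar> * devs k n f v"
  by (induction k arbitrary: n v) (simp_all add: dev_mult sum_distrib_left)

lemma devs_add: "integrable lborel f \<Longrightarrow> integrable lborel g \<Longrightarrow> devs k n (\<lambda>p. f p + g p) v \<le> devs k n f v + devs k n g v"
  by (induction k arbitrary: n v) (auto simp: dev_add sum.distrib[symmetric] intro!: sum_mono)

lemma devs_le:
  assumes "integrable lborel f"
  shows "devs k n f v \<le> 2 * (\<integral>\<^sup>+p\<in>hcell n v. ennreal \<bar>f p\<bar> \<partial>lborel)"
proof -
  have [measurable]: "f \<in> borel_measurable borel" using borel_measurable_integrable[OF assms] by simp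
  show ?thesis
  proof (induction k arbitrary: n v)
    case 0 show ?case using dev_le[OF assms] by simp
  next
    case (Suc k)
    have "devs (Suc k) n f v \<le> (\<Sum>u\<in>children v. 2 * (\<integral>\<^sup>+p\<in>hcell (n+1) u. ennreal \<bar>f p\<bar> \<partial>lborel))"
      using Suc by (simp add: sum_mono)
    then show ?case by (subst nn_integral_hcell_children) (simp_all add: sum_distrib_left)
  qed
qed

text \<open>Stability in L1 uniformly in \<open>k\<close>: functions with vanishing
  \<open>devs\<close> form an L1-closed class.\<close>

lemma devs_approx:
  assumes "integrable lborel f" "integrable lborel g"
  shows "devs k n f v \<le> devs k n g v + 2 * (\<integral>\<^sup>+p. ennreal \<bar>f p - g p\<bar> \<partial>lborel)"
proof -
  have "devs k n (\<lambda>p. g p + (f p - g p)) v \<le> devs k n g v + devs k n (\<lambda>p. f p - g p) v"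
    by (intro devs_add assms Bochner_Integration.integrable_diff)
  also have "devs k n (\<lambda>p. f p - g p) v \<le> 2 * (\<integral>\<^sup>+p\<in>hcell n v. ennreal \<bar>f p - g p\<bar> \<partial>lborel)"
    by (intro devs_le assms Bochner_Integration.integrable_diff)
  also have "\<dots> \<le> 2 * (\<integral>\<^sup>+p. ennreal \<bar>f p - g p\<bar> \<partial>lborel)"
    by (intro mult_left_mono nn_integral_mono) (auto simp: indicator_def)
  finally show ?thesis by (simp add: add_left_mono)
qed

text \<open>For an open set only the cells that are not contained in it contribute, and these exhaust no
  point of the set.\<close>

lemma devs_open:
  assumes "open S" "emeasure lborel S < \<infinity>"
  shows "(\<lambda>k. devs k n (indicator S) v) \<longlonglongrightarrow> 0"
proof -
  \<comment> \<open>The part of \<open>S\<close> in cells of level \<open>m\<close> that leave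
    \<open>S\<close>; on all other cells the indicator is constant.\<close>
  define B where "B m = S - (\<Union>u\<in>{u. hcell m u \<subseteq> S}. hcell m u)" for m
  have [measurable]: "S \<in> sets borel" "B m \<in> sets borel" for m
    using assms(1) unfolding B_def by (auto intro!: sets.Diff sets.countable_UN' simp: countableI_type)
  have int: "integrable lborel (indicator S :: _ \<Rightarrow> real)" using assms by (simp add: integrable_indicator_iff)
  have base: "dev m (indicator S) u \<le> 2 * emeasure lborel (B m \<inter> hcell m u)" for m u
  proof (cases "hcell m u \<subseteq> S")
    case True
    have "cint m (indicator S) u = (LINT p:hcell m u|lborel. 1)"
      unfolding cint_def using True by (intro set_lebesgue_integral_cong) auto
    then have "cint m (indicator S) u = area m" by (simp add: set_lebesgue_integral_def measure_def emeasure_hcell)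
    then have "dev m (indicator S) u = (\<integral>\<^sup>+p. 0 \<partial>(lborel :: (real \<times> real) measure))" unfolding dev_def using True
      by (intro nn_integral_cong) (auto simp: indicator_def)
    then show ?thesis by simp
  next
    case False
    then have "B m \<inter> hcell m u = S \<inter> hcell m u" by (auto simp: B_def hcell_def)
    then have "(\<integral>\<^sup>+p\<in>hcell m u. ennreal \<bar>indicator S p\<bar> \<partial>lborel) = emeasure lborel (B m \<inter> hcell m u)"
      by (simp add: nn_integral_indicator[symmetric] indicator_inter_arith ennreal_indicator mult.commute del: nn_integral_indicator)
    then show ?thesis using dev_le[OF int, of m u] by simp
  qed
  have bound: "devs k m (indicator S) u \<le> 2 * emeasure lborel (B (m + int k) \<inter> hcell m u)" for k m u
  proof (induction k arbitrary: m u)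
    case 0 then show ?case using base by simp
  next
    case (Suc k)
    have "devs (Suc k) m (indicator S) u \<le> (\<Sum>w\<in>children u. 2 * emeasure lborel (B (m + int (Suc k)) \<inter> hcell (m+1) w))"
      using Suc[of "m+1"] by (auto intro!: sum_mono simp: add.assoc add.commute add.left_commute)
    also have "\<dots> = 2 * (\<Sum>w\<in>children u. \<integral>\<^sup>+p\<in>hcell (m+1) w. indicator (B (m + int (Suc k))) p \<partial>lborel)"
      by (simp add: sum_distrib_left nn_integral_indicator[symmetric] indicator_inter_arith del: nn_integral_indicator)
    also have "\<dots> = 2 * (\<integral>\<^sup>+p\<in>hcell m u. indicator (B (m + int (Suc k))) p \<partial>lborel)"
      by (subst nn_integral_hcell_children) simp_all
    also have "\<dots> = 2 * emeasure lborel (B (m + int (Suc k)) \<inter> hcell m u)"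
      by (simp add: nn_integral_indicator[symmetric] indicator_inter_arith del: nn_integral_indicator)
    finally show ?case .
  qed
  \<comment> \<open>Every point of \<open>S\<close> lies in a contained cell from some level on, so
    dominated convergence applies.\<close>
  have "(\<lambda>k. \<integral>\<^sup>+p. indicator (B (n + int k) \<inter> hcell n v) p \<partial>lborel) \<longlonglongrightarrow> (\<integral>\<^sup>+p. 0 \<partial>(lborel :: (real \<times> real) measure))"
  proof (rule nn_integral_dominated_convergence[where w = "indicator (hcell n v)"])
    have "\<forall>\<^sub>F k in sequentially. indicator (B (n + int k) \<inter> hcell n v) p = (0::ennreal)" for p
    proof (cases "p \<in> S")
      case True
      then obtain e where e: "e > 0" "ball p e \<subseteq> S" using assms(1) openE by blast
      obtain i1 i2 where "i1 \<ge> n" "wd i1 < e / 2" "ht L i2 < e / 2"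
        using wd_small[of "e/2" n] ht_small[of "e/2" n] e by auto
      then have "max i1 i2 \<ge> n" "wd (max i1 i2) < e / 2" "ht L (max i1 i2) < e / 2"
        using wd_mono[of i1 "max i1 i2"] ht_mono[of i2 "max i1 i2"] by simp_all
      then obtain i where i: "i \<ge> n" "wd i < e / 2" "ht L i < e / 2" by blast
      have "p \<notin> B (n + int k)" if "k \<ge> nat (i - n)" for k
      proof -
        define m where "m = n + int k"
        have "i \<le> m" using that i by (simp add: m_def)
        have small: "wd m < e / 2" "ht L m < e / 2"
          using i(2,3) wd_mono[OF \<open>i \<le> m\<close>] ht_mono[OF \<open>i \<le> m\<close>] by linarith+
        have "hcell m (idx m p) \<subseteq> ball p e"
        proof
          fix q assume "q \<in> hcell m (idx m p)"
          then have q: "idx m q = idx m p" by (simp add: hcell_def)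
          then have "q \<in> hcell m (idx m p)" "p \<in> hcell m (idx m p)" by (auto simp: hcell_def)
          then have "\<bar>fst p - fst q\<bar> \<le> wd m" "\<bar>snd p - snd q\<bar> \<le> ht L m"
            by (auto simp: hcell_eq algebra_simps)
          then have "dist p q < e" using small sqrt_sum_squares_le_sum_abs[of "dist (fst p) (fst q)" "dist (snd p) (snd q)"]
            by (simp add: dist_prod_def dist_real_def)
          then show "q \<in> ball p e" by simp
        qed
        then have "hcell m (idx m p) \<subseteq> S" using e by blast
        then have "p \<in> (\<Union>u\<in>{u. hcell m u \<subseteq> S}. hcell m u)" by (intro UN_I[of "idx m p"]) (auto simp: hcell_def)
        then show ?thesis by (simp add: B_def m_def)
      qed
      then show ?thesis unfolding eventually_sequentially by (intro exI[of _ "nat (i - n)"]) (auto simp: indicator_def)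
    next
      case False
      then show ?thesis by (intro always_eventually) (auto simp: B_def)
    qed
    then show "AE p in lborel. (\<lambda>k. indicator (B (n + int k) \<inter> hcell n v) p) \<longlonglongrightarrow> (0::ennreal)"
      by (intro AE_I2 tendsto_eventually) auto
    show "(\<integral>\<^sup>+p. indicator (hcell n v) p \<partial>lborel) < \<infinity>" by (simp add: emeasure_hcell)
  qed (auto simp: indicator_def)
  then have "(\<lambda>k. 2 * emeasure lborel (B (n + int k) \<inter> hcell n v)) \<longlonglongrightarrow> 2 * 0"
    by (intro ennreal_tendsto_cmult) (simp_all)
  then have "(\<lambda>k. 2 * emeasure lborel (B (n + int k) \<inter> hcell n v)) \<longlonglongrightarrow> 0" by simp
  then show ?thesis by (rule ennreal_tendsto_0_le[OF bound])
qed

text \<open>Open sets give sets of finite measure by outer regularity, these give simple functions,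
  and these are dense in L1.\<close>

lemma devs_tendsto_0:
  assumes "integrable lborel f" shows "(\<lambda>k. devs k n f v) \<longlonglongrightarrow> 0"
proof -
  \<comment> \<open>Closedness under L1 approximation, applied both to outer approximations of a set
    and to limits of simple functions.\<close>
  have approx: "(\<lambda>k. devs k n f v) \<longlonglongrightarrow> 0"
    if f: "integrable lborel f"
      and g: "\<And>e::real. 0 < e \<Longrightarrow> \<exists>g. integrable lborel g \<and> (\<lambda>k. devs k n g v) \<longlonglongrightarrow> 0 \<and>
         (\<integral>\<^sup>+p. ennreal \<bar>f p - g p\<bar> \<partial>lborel) < ennreal e" for f
  proof (rule order_tendstoI)
    fix a :: ennreal assume "0 < a"
    obtain e where e: "0 < e" "ennreal (3 * e) < a"
    proof -
      obtain x where x: "0 < x" "ennreal x < a"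
      proof (cases "a = \<infinity>")
        case True then show ?thesis using that[of 1] by simp
      next
        case False
        then obtain b where "a = ennreal b" "0 \<le> b" by (cases a) auto
        then show ?thesis using that[of "b/2"] \<open>0 < a\<close> by (simp add: ennreal_less_iff)
      qed
      then show ?thesis using that[of "x/3"] by simp
    qed
    obtain g where int: "integrable lborel g" and lim: "(\<lambda>k. devs k n g v) \<longlonglongrightarrow> 0"
      and fg: "(\<integral>\<^sup>+p. ennreal \<bar>f p - g p\<bar> \<partial>lborel) < ennreal e" using g[OF e(1)] by blast
    have "\<forall>\<^sub>F k in sequentially. devs k n g v < ennreal e" using order_tendstoD(2)[OF lim, of "ennreal e"] e by simp
    then show "\<forall>\<^sub>F k in sequentially. devs k n f v < a"
    proof eventually_elim
      case (elim k)
      have "devs k n f v \<le> devs k n g v + 2 * (\<integral>\<^sup>+p. ennreal \<bar>f p - g p\<bar> \<partial>lborel)" by (rule devs_approx[OF f int])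
      also have "\<dots> \<le> ennreal e + 2 * ennreal e" using elim fg by (intro add_mono mult_left_mono) auto
      also have "\<dots> = ennreal (3 * e)" using e 
        proof -
          have "2 * ennreal e = ennreal (2 * e)" by (simp add: ennreal_mult')
          then have "ennreal e + 2 * ennreal e = ennreal (e + 2 * e)" using e by (simp only: ennreal_plus[symmetric] less_imp_le mult_nonneg_nonneg zero_le_numeral)
          then show ?thesis by simp
        qed
      finally show ?case using e by simp
    qed
  qed (auto)
  show ?thesis using assms
  proof (induction f rule: integrable_induct)
    case (base A c)
    have [measurable]: "A \<in> sets borel" using base by simp
    have A: "(\<lambda>k. devs k n (indicator A) v) \<longlonglongrightarrow> 0"
    proof (rule approx)
      show "integrable lborel (indicator A :: _ \<Rightarrow> real)" using base by (simp add: integrable_indicator_iff)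
      fix e :: real assume "0 < e"
      then obtain S where S: "open S" "A \<subseteq> S" "emeasure lborel (S - A) < ennreal e"
        using outer_regular_lborel[of A e] base by auto
      have [measurable]: "S \<in> sets borel" using S by simp
      have "emeasure lborel S \<le> emeasure lborel (S - A) + emeasure lborel A"
        using S(2) emeasure_subadditive[of "S - A" lborel A] by (simp add: Un_absorb2)
      also have "\<dots> < \<infinity>" using S(3) base by (simp add: less_top) (metis ennreal_less_top order_less_trans)
      finally have fin: "emeasure lborel S < \<infinity>" .
      have "(\<integral>\<^sup>+p. ennreal \<bar>indicator A p - indicator S p\<bar> \<partial>lborel) = (\<integral>\<^sup>+p. indicator (S - A) p \<partial>lborel)"
        using S(2) by (intro nn_integral_cong) (auto simp: indicator_def)
      then have "(\<integral>\<^sup>+p. ennreal \<bar>indicator A p - indicator S p\<bar> \<partial>lborel) < ennreal e" using S(3) by simp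
      then show "\<exists>g. integrable lborel g \<and> (\<lambda>k. devs k n g v) \<longlonglongrightarrow> 0 \<and>
         (\<integral>\<^sup>+p. ennreal \<bar>indicator A p - g p\<bar> \<partial>lborel) < ennreal e"
        using devs_open[OF S(1) fin] fin by (intro exI[of _ "indicator S"]) (simp add: integrable_indicator_iff)
    qed
    have "integrable lborel (indicator A :: _ \<Rightarrow> real)" using base by (simp add: integrable_indicator_iff)
    then have "devs k n (\<lambda>p. indicator A p *\<^sub>R c) v = ennreal \<bar>c\<bar> * devs k n (indicator A) v" for k
      using devs_mult[of "indicator A" k n c v] by (simp add: mult.commute)
    moreover have "(\<lambda>k. ennreal \<bar>c\<bar> * devs k n (indicator A) v) \<longlonglongrightarrow> ennreal \<bar>c\<bar> * 0"
      by (intro ennreal_tendsto_cmult A) simp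
    ultimately show ?case by simp
  next
    case (add f g)
    have "(\<lambda>k. devs k n f v + devs k n g v) \<longlonglongrightarrow> 0 + 0" by (intro tendsto_add add)
    then have "(\<lambda>k. devs k n f v + devs k n g v) \<longlonglongrightarrow> 0" by simp
    then show ?case by (rule ennreal_tendsto_0_le[OF devs_add[OF add(1,2)]])
  next
    case (lim f s)
    show ?case
    proof (rule approx[OF lim(4)])
      fix e :: real assume "0 < e"
      have "(\<lambda>i. \<integral>\<^sup>+p. norm (f p - s i p) \<partial>lborel) \<longlonglongrightarrow> 0"
      proof (rule nn_integral_dominated_convergence_norm[where w = "\<lambda>p. 2 * norm (f p)"])
        show "(\<integral>\<^sup>+p. ennreal (2 * norm (f p)) \<partial>lborel) < \<infinity>"
          using integrableD(2)[OF integrable_mult_right[OF integrable_norm[OF lim(4)], of 2]] by (simp add: less_top)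
      qed (use lim in \<open>auto intro: borel_measurable_integrable\<close>)
      then have "\<forall>\<^sub>F i in sequentially. (\<integral>\<^sup>+p. norm (f p - s i p) \<partial>lborel) < ennreal e"
        by (rule order_tendstoD(2)) (simp add: \<open>0 < e\<close>)
      then obtain i where "(\<integral>\<^sup>+p. norm (f p - s i p) \<partial>lborel) < ennreal e" using eventually_happens' by force
      then show "\<exists>g. integrable lborel g \<and> (\<lambda>k. devs k n g v) \<longlonglongrightarrow> 0 \<and> (\<integral>\<^sup>+p. ennreal \<bar>f p - g p\<bar> \<partial>lborel) < ennreal e"
        using lim(1)[of i] lim(5)[of i] by auto
    qed
  qed
qed

end

subsection \<open>Functions with an upper gradient along rows\<close>

text \<open>What the quotient leaves on the plane: the upper gradient inequality along rows and
  equality at glued points. The averaging argument takes place in this setting.\<close>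

locale glued_gradient = cell_tower +
  fixes U :: "real \<times> real \<Rightarrow> real" and G :: "real \<times> real \<Rightarrow> ennreal"
  assumes U_int: "integrable lborel U" and G_meas [measurable]: "G \<in> borel_measurable borel"
    and U_row: "\<And>x x' y. x \<le> x' \<Longrightarrow> ennreal \<bar>U (x, y) - U (x', y)\<bar> \<le> (\<integral>\<^sup>+\<xi>\<in>{x..x'}. G (\<xi>, y) \<partial>lborel)"
    and U_glue: "\<And>j x y. glue L j x y \<Longrightarrow> U (x, y) = U (x, y + ht L j)"
begin

lemma U_meas [measurable]: "U \<in> borel_measurable borel"
  using borel_measurable_integrable[OF U_int] by simp

section \<open>Row integrals and integrals over strips\<close>

definition rowint :: "real \<Rightarrow> real \<Rightarrow> real \<Rightarrow> ennreal" where
  "rowint l r y = (\<integral>\<^sup>+\<xi>\<in>{l..<r}. G (\<xi>, y) \<partial>lborel)"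

lemma rowint_measurable [measurable]: "rowint l r \<in> borel_measurable borel"
proof -
  have "G \<in> borel_measurable (borel \<Otimes>\<^sub>M borel)" by (simp add: borel_prod)
  then show ?thesis unfolding rowint_def by measurable
qed

lemma row_bound:
  assumes "x \<in> {l..r}" "x' \<in> {l..r}" shows "ennreal \<bar>U (x, y) - U (x', y)\<bar> \<le> rowint l r y"
proof -
  have "ennreal \<bar>U (x, y) - U (x', y)\<bar> \<le> rowint l r y" if "x \<in> {l..r}" "x' \<in> {l..r}" "x \<le> x'" for x x'
  proof -
    have "(\<integral>\<^sup>+\<xi>\<in>{x..x'}. G (\<xi>, y) \<partial>lborel) \<le> rowint l r y"
      unfolding rowint_def
    proof (rule nn_integral_mono_AE)
      show "AE \<xi> in lborel. G (\<xi>, y) * indicator {x..x'} \<xi> \<le> G (\<xi>, y) * indicator {l..<r} \<xi>"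
        using AE_lborel_singleton[of r] by eventually_elim (use that in \<open>auto simp: indicator_def\<close>)
    qed
    then show ?thesis using U_row[OF that(3), of y] by (rule order_trans[rotated])
  qed
  from this[of x x'] this[of x' x] assms show ?thesis by (cases "x \<le> x'") (auto simp: abs_minus_commute)
qed

lemma rect_measurable [measurable]: "{l..<r} \<times> {c..<d} \<in> sets (borel :: (real \<times> real) measure)"
  by (intro borel_Times) auto

lemma nn_integral_rect:
  fixes f :: "real \<times> real \<Rightarrow> ennreal"
  assumes [measurable]: "f \<in> borel_measurable borel"
  shows "(\<integral>\<^sup>+p\<in>{l..<r}\<times>{c..<d}. f p \<partial>lborel) = (\<integral>\<^sup>+y\<in>{c..<d}. (\<integral>\<^sup>+x\<in>{l..<r}. f (x, y) \<partial>lborel) \<partial>lborel)"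
proof -
  let ?g = "\<lambda>p. f p * indicator ({l..<r}\<times>{c..<d}) p"
  have "?g \<in> borel_measurable borel" by measurable
  then have "?g \<in> borel_measurable (lborel \<Otimes>\<^sub>M lborel)" unfolding lborel_prod by simp
  then have "(\<integral>\<^sup>+p. ?g p \<partial>(lborel \<Otimes>\<^sub>M lborel)) = (\<integral>\<^sup>+y. (\<integral>\<^sup>+x. ?g (x, y) \<partial>lborel) \<partial>lborel)"
    by (rule lborel_pair.nn_integral_snd[symmetric])
  also have "\<dots> = (\<integral>\<^sup>+y\<in>{c..<d}. (\<integral>\<^sup>+x\<in>{l..<r}. f (x, y) \<partial>lborel) \<partial>lborel)"
    by (intro nn_integral_cong) (auto simp: indicator_def)
  finally show ?thesis unfolding lborel_prod .
qed

lemma strip_integral: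
  "(\<integral>\<^sup>+y\<in>{0..<h}. rowint l r (c + y) \<partial>lborel) = (\<integral>\<^sup>+p\<in>{l..<r}\<times>{c..<c+h}. G p \<partial>lborel)"
proof -
  have "(\<integral>\<^sup>+p\<in>{l..<r}\<times>{c..<c+h}. G p \<partial>lborel) = (\<integral>\<^sup>+y. rowint l r y * indicator {c..<c+h} y \<partial>lborel)"
    by (subst nn_integral_rect) (simp_all add: rowint_def)
  also have "\<dots> = (\<integral>\<^sup>+y. rowint l r (c + y) * indicator {c..<c+h} (c + y) \<partial>lborel)"
    by (subst nn_integral_real_affine[where c = 1 and t = c]) auto
  also have "\<dots> = (\<integral>\<^sup>+y\<in>{0..<h}. rowint l r (c + y) \<partial>lborel)"
    by (intro nn_integral_cong) (auto simp: indicator_def)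
  finally show ?thesis ..
qed

section \<open>Comparing the integrals over two cells\<close>

definition corner :: "int \<Rightarrow> int \<times> int \<Rightarrow> real \<times> real" where
  "corner n v = (of_int (fst v) * wd n, of_int (snd v) * ht L n)"

lemma cint_translate:
  "integrable lborel (\<lambda>p. indicator ({0..<wd n} \<times> {0..<ht L n}) p *\<^sub>R U (corner n v + p))"
  "cint n U v = (LINT p:({0..<wd n} \<times> {0..<ht L n})|lborel. U (corner n v + p))"
proof -
  let ?c = "corner n v"
  have ind: "indicator (hcell n v) (?c + p) = (indicator ({0..<wd n} \<times> {0..<ht L n}) p :: real)" for p
    by (cases p) (auto simp: indicator_def hcell_eq corner_def algebra_simps)
  have L: "(lborel :: (real \<times> real) measure) = distr lborel borel ((+) ?c)" by (simp add: lborel_distr_plus)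
  have m: "(\<lambda>p. indicator (hcell n v) p *\<^sub>R U p) \<in> borel_measurable borel" by measurable
  have "integrable (distr lborel borel ((+) ?c)) (\<lambda>p. indicator (hcell n v) p *\<^sub>R U p)"
    using integrable_hcell[OF U_int, of n v] L by simp
  then have "integrable lborel (\<lambda>p. indicator (hcell n v) (?c + p) *\<^sub>R U (?c + p))"
    by (subst (asm) integrable_distr_eq) (use m in auto)
  then show "integrable lborel (\<lambda>p. indicator ({0..<wd n} \<times> {0..<ht L n}) p *\<^sub>R U (?c + p))" by (simp only: ind)
  have "cint n U v = (LINT p|distr lborel borel ((+) ?c). indicator (hcell n v) p *\<^sub>R U p)"
    using L by (simp add: cint_def set_lebesgue_integral_def)
  also have "\<dots> = (LINT p|lborel. indicator (hcell n v) (?c + p) *\<^sub>R U (?c + p))"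
    by (rule integral_distr) (use m in auto)
  finally show "cint n U v = (LINT p:({0..<wd n} \<times> {0..<ht L n})|lborel. U (?c + p))"
    unfolding set_lebesgue_integral_def by (simp only: ind)
qed

text \<open>Points at the same relative position in the two cells are compared. The bound does not
  depend on \<open>x\<close>, so integrating over it yields the factor \<open>wd n\<close>.\<close>

lemma cint_diff_rows:
  assumes F [measurable]: "F \<in> borel_measurable borel"
    and le: "\<And>x y. 0 \<le> x \<Longrightarrow> x < wd n \<Longrightarrow> 0 \<le> y \<Longrightarrow> y < ht L n \<Longrightarrow>
      ennreal \<bar>U (corner n u + (x, y)) - U (corner n v + (x, y))\<bar> \<le> F y"
  shows "ennreal \<bar>cint n U u - cint n U v\<bar> \<le> ennreal (wd n) * (\<integral>\<^sup>+y\<in>{0..<ht L n}. F y \<partial>lborel)"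
proof -
  let ?B = "{0..<wd n} \<times> {0..<ht L n}"
  have "ennreal \<bar>cint n U u - cint n U v\<bar> =
      ennreal (norm (LINT p|lborel. indicator ?B p *\<^sub>R U (corner n u + p) - indicator ?B p *\<^sub>R U (corner n v + p)))"
    unfolding cint_translate(2) set_lebesgue_integral_def
    by (subst Bochner_Integration.integral_diff) (simp_all add: cint_translate(1)[simplified])
  also have "\<dots> \<le> (\<integral>\<^sup>+p. norm (indicator ?B p *\<^sub>R U (corner n u + p) - indicator ?B p *\<^sub>R U (corner n v + p)) \<partial>lborel)"
    by (intro integral_norm_bound_ennreal Bochner_Integration.integrable_diff cint_translate(1))
  also have "\<dots> \<le> (\<integral>\<^sup>+p\<in>?B. F (snd p) \<partial>lborel)"
    using le by (intro nn_integral_mono) (auto simp: indicator_def)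
  also have "\<dots> = (\<integral>\<^sup>+y\<in>{0..<ht L n}. (\<integral>\<^sup>+x\<in>{0..<wd n}. F y \<partial>lborel) \<partial>lborel)"
  proof -
    have "(\<lambda>p :: real \<times> real. F (snd p)) \<in> borel_measurable borel" unfolding borel_prod[symmetric] by measurable
    then show ?thesis by (subst nn_integral_rect) simp_all
  qed
  also have "\<dots> = (\<integral>\<^sup>+y. ennreal (wd n) * (F y * indicator {0..<ht L n} y) \<partial>lborel)"
    by (intro nn_integral_cong) (simp add: nn_integral_cmult_indicator mult_ac)
  also have "\<dots> = ennreal (wd n) * (\<integral>\<^sup>+y\<in>{0..<ht L n}. F y \<partial>lborel)"
    by (intro nn_integral_cmult) measurable
  finally show ?thesis .
qed

lemma ennreal_abs_diff_triangle: "ennreal \<bar>a - c\<bar> \<le> ennreal \<bar>a - b\<bar> + ennreal \<bar>b - c\<bar>" for a b c :: real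
  by (simp add: ennreal_plus[symmetric] del: ennreal_plus)

text \<open>A path that climbs through consecutive strips, one gluing line of level \<open>n\<close> per strip, traverses each row once.\<close>

lemma row_transfer:
  assumes x: "x \<in> {of_int (4 * a) * wd n..of_int (4 * a + 4) * wd n}"
    and "x' \<in> {of_int (4 * a) * wd n..of_int (4 * a + 4) * wd n}" and t: "0 \<le> t" "t \<le> ht L n"
  shows "ennreal \<bar>U (x, of_int b * ht L n + t) - U (x', of_int (b + int k) * ht L n + t)\<bar> \<le>
    (\<Sum>s\<in>{b..b + int k}. rowint (of_int (4 * a) * wd n) (of_int (4 * a + 4) * wd n) (of_int s * ht L n + t))"
  using assms(2)
proof (induction k arbitrary: x')
  case 0
  then show ?case using row_bound[OF x, of x'] by simp
next
  case (Suc k)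
  let ?I = "{of_int (4 * a) * wd n..of_int (4 * a + 4) * wd n}"
  define s where "s = b + int k"
  \<comment> \<open>Strip \<open>s\<close> is glued to \<open>s + 1\<close> on lines of class
    \<open>s mod 3 + 1\<close>; a block of four columns contains one line of each such
    class.\<close>
  define c where "c = 4 * a + (s mod 3 + 1)"
  have r: "0 \<le> s mod 3" "s mod 3 < 3" by simp_all
  have c: "c mod 4 \<noteq> 0" "s mod 3 = c mod 4 - 1" using r unfolding c_def by presburger+
  have cI: "of_int c * wd n \<in> ?I"
  proof -
    have "real_of_int (4 * a) \<le> of_int c" "real_of_int c \<le> of_int (4 * a + 4)" using r unfolding c_def by linarith+
    then show ?thesis using mult_right_mono[OF _ wd_nonneg[of n]] by (simp only: atLeastAtMost_iff)
  qed
  have "glue L n (of_int c * wd n) (of_int s * ht L n + t)"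
    unfolding glue_def using c t by (intro exI[of _ c] exI[of _ s]) (auto simp: algebra_simps)
  from U_glue[OF this] have eq: "U (of_int c * wd n, of_int s * ht L n + t) = U (of_int c * wd n, of_int (s + 1) * ht L n + t)"
    by (simp add: algebra_simps)
  have "ennreal \<bar>U (x, of_int b * ht L n + t) - U (x', of_int (s + 1) * ht L n + t)\<bar> \<le>
     ennreal \<bar>U (x, of_int b * ht L n + t) - U (of_int c * wd n, of_int s * ht L n + t)\<bar> +
     ennreal \<bar>U (of_int c * wd n, of_int (s + 1) * ht L n + t) - U (x', of_int (s + 1) * ht L n + t)\<bar>"
    using ennreal_abs_diff_triangle eq by metis
  also have "\<dots> \<le> (\<Sum>s\<in>{b..b + int k}. rowint (of_int (4 * a) * wd n) (of_int (4 * a + 4) * wd n) (of_int s * ht L n + t)) +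
      rowint (of_int (4 * a) * wd n) (of_int (4 * a + 4) * wd n) (of_int (s + 1) * ht L n + t)"
    using Suc.IH[OF cI] row_bound[OF cI Suc.prems] unfolding s_def by (intro add_mono) auto
  also have "\<dots> = (\<Sum>s\<in>{b..b + int (Suc k)}. rowint (of_int (4 * a) * wd n) (of_int (4 * a + 4) * wd n) (of_int s * ht L n + t))"
  proof -
    have "{b..b + int (Suc k)} = insert (s + 1) {b..b + int k}" by (auto simp: s_def)
    then show ?thesis by (simp add: s_def add.commute)
  qed
  finally show ?case by (simp add: s_def algebra_simps)
qed

lemma sum_strips:
  assumes "b \<le> b'"
  shows "(\<Sum>s\<in>{b..b'}. \<integral>\<^sup>+p\<in>{l..<r}\<times>{of_int s * ht L n..<of_int s * ht L n + ht L n}. G p \<partial>lborel) =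
    (\<integral>\<^sup>+p\<in>{l..<r}\<times>{of_int b * ht L n..<(of_int b' + 1) * ht L n}. G p \<partial>lborel)"
proof -
  have "(\<integral>\<^sup>+p\<in>{l..<r}\<times>{of_int b * ht L n..<(of_int b' + 1) * ht L n}. G p \<partial>lborel) =
     (\<integral>\<^sup>+p. (\<Sum>s\<in>{b..b'}. G p * indicator ({l..<r}\<times>{of_int s * ht L n..<of_int s * ht L n + ht L n}) p) \<partial>lborel)"
  proof (intro nn_integral_cong)
    fix p :: "real \<times> real"
    let ?f = "\<lfloor>snd p / ht L n\<rfloor>"
    have 1: "of_int s * ht L n \<le> snd p \<and> snd p < of_int s * ht L n + ht L n \<longleftrightarrow> ?f = s" for s
      using floor_div_eq_iff[OF ht_pos[of n], of "snd p" s] by (simp add: algebra_simps)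
    have 2: "of_int b * ht L n \<le> snd p \<longleftrightarrow> b \<le> ?f" by (simp add: le_floor_iff pos_le_divide_eq)
    have 3: "snd p < (of_int b' + 1) * ht L n \<longleftrightarrow> ?f \<le> b'"
      by (simp add: floor_le_iff pos_divide_less_eq)
    have "(\<Sum>s\<in>{b..b'}. G p * indicator ({l..<r}\<times>{of_int s * ht L n..<of_int s * ht L n + ht L n}) p) =
       (\<Sum>s\<in>{b..b'}. if s = ?f then G p * indicator {l..<r} (fst p) else 0)"
      using 1 by (intro sum.cong) (auto simp: indicator_def mem_Times_iff)
    then show "G p * indicator ({l..<r}\<times>{of_int b * ht L n..<(of_int b' + 1) * ht L n}) p =
       (\<Sum>s\<in>{b..b'}. G p * indicator ({l..<r}\<times>{of_int s * ht L n..<of_int s * ht L n + ht L n}) p)"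
      using 2 3 by (auto simp: indicator_def mem_Times_iff)
  qed
  also have "\<dots> = (\<Sum>s\<in>{b..b'}. \<integral>\<^sup>+p\<in>{l..<r}\<times>{of_int s * ht L n..<of_int s * ht L n + ht L n}. G p \<partial>lborel)"
    by (intro nn_integral_sum) measurable
  finally show ?thesis ..
qed

text \<open>Averaging the climbing path over the height turns its row integrals into integrals over
  disjoint strips, which fill the rectangle once: no factor counts the strips.\<close>

lemma column_step:
  assumes u: "fst u div 4 = a" "fst v div 4 = a" and le: "snd u \<le> snd v"
  shows "ennreal \<bar>cint n U u - cint n U v\<bar> \<le> ennreal (wd n) *
    (\<integral>\<^sup>+p\<in>{of_int (4 * a) * wd n..<of_int (4 * a + 4) * wd n}\<times>{of_int (snd u) * ht L n..<(of_int (snd v) + 1) * ht L n}. G p \<partial>lborel)"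
proof -
  let ?l = "of_int (4 * a) * wd n" and ?r = "of_int (4 * a + 4) * wd n"
  define F where "F y = (\<Sum>s\<in>{snd u..snd v}. rowint ?l ?r (of_int s * ht L n + y))" for y
  have [measurable]: "F \<in> borel_measurable borel" unfolding F_def by measurable
  have "ennreal \<bar>cint n U u - cint n U v\<bar> \<le> ennreal (wd n) * (\<integral>\<^sup>+y\<in>{0..<ht L n}. F y \<partial>lborel)"
  proof (rule cint_diff_rows)
    fix x y assume xy: "0 \<le> x" "x < wd n" "0 \<le> y" "y < ht L n"
    have I: "of_int c * wd n + x \<in> {?l..?r}" if "c div 4 = a" for c
    proof -
      have "4 * a \<le> c" "c + 1 \<le> 4 * a + 4" using that by linarith+
      then have "real_of_int (4 * a) * wd n \<le> of_int c * wd n" "real_of_int (c + 1) * wd n \<le> of_int (4 * a + 4) * wd n"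
        by (intro mult_right_mono; simp)+
      moreover have "real_of_int (c + 1) * wd n = of_int c * wd n + wd n" by (simp add: algebra_simps)
      ultimately show ?thesis using xy(1,2) unfolding atLeastAtMost_iff by linarith
    qed
    have "ennreal \<bar>U (of_int (fst u) * wd n + x, of_int (snd u) * ht L n + y) -
        U (of_int (fst v) * wd n + x, of_int (snd u + int (nat (snd v - snd u))) * ht L n + y)\<bar> \<le> F y"
      using row_transfer[OF I[OF u(1)] I[OF u(2)] xy(3) less_imp_le[OF xy(4)], of "snd u" "nat (snd v - snd u)"] le
      unfolding F_def by simp
    then show "ennreal \<bar>U (corner n u + (x, y)) - U (corner n v + (x, y))\<bar> \<le> F y"
      using le by (simp add: corner_def)
  qed measurable
  also have "(\<integral>\<^sup>+y\<in>{0..<ht L n}. F y \<partial>lborel) = (\<integral>\<^sup>+y. (\<Sum>s\<in>{snd u..snd v}. rowint ?l ?r (of_int s * ht L n + y) * indicator {0..<ht L n} y) \<partial>lborel)"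
    unfolding F_def by (simp add: sum_distrib_right)
  also have "\<dots> = (\<Sum>s\<in>{snd u..snd v}. \<integral>\<^sup>+y\<in>{0..<ht L n}. rowint ?l ?r (of_int s * ht L n + y) \<partial>lborel)"
    by (intro nn_integral_sum) measurable
  also have "\<dots> = (\<integral>\<^sup>+p\<in>{?l..<?r}\<times>{of_int (snd u) * ht L n..<(of_int (snd v) + 1) * ht L n}. G p \<partial>lborel)"
    unfolding strip_integral by (rule sum_strips[OF le])
  finally show ?thesis .
qed

text \<open>Siblings share a block of four columns, and the rows climbed between them stay inside
  the parent.\<close>

lemma children_step:
  assumes "u \<in> children v" "u' \<in> children v"
  shows "ennreal \<bar>cint (n+1) U u - cint (n+1) U u'\<bar> \<le> ennreal (wd (n+1)) * (\<integral>\<^sup>+p\<in>hcell n v. G p \<partial>lborel)"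
proof -
  have "ennreal \<bar>cint (n+1) U u - cint (n+1) U u'\<bar> \<le> ennreal (wd (n+1)) * (\<integral>\<^sup>+p\<in>hcell n v. G p \<partial>lborel)"
    if u: "u \<in> children v" "u' \<in> children v" "snd u \<le> snd u'" for u u'
  proof -
    have "fst u div 4 = fst v" "fst u' div 4 = fst v" using u(1,2) by (auto simp: in_children_iff)
    note step = column_step[OF this u(3), of "n+1"]
    have rows: "3 * int L * snd v \<le> snd u" "snd u' + 1 \<le> 3 * int L * (snd v + 1)"
      using u(1,2) by (auto simp: children_def algebra_simps)
    have h: "ht L n = of_int (3 * int L) * ht L (n+1)" "wd n = 4 * wd (n+1)"
      using M_ge by (simp_all add: ht_add1 wd_add1 M_eq)
    have "real_of_int (3 * int L * snd v) * ht L (n+1) \<le> of_int (snd u) * ht L (n+1)"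
      "real_of_int (snd u' + 1) * ht L (n+1) \<le> of_int (3 * int L * (snd v + 1)) * ht L (n+1)"
      using rows by (intro mult_right_mono; linarith?; simp)+
    then have b: "of_int (snd v) * ht L n \<le> of_int (snd u) * ht L (n+1)" "(of_int (snd u') + 1) * ht L (n+1) \<le> (of_int (snd v) + 1) * ht L n"
      unfolding h by (simp_all add: mult_ac)
    have "{of_int (4 * fst v) * wd (n+1)..<of_int (4 * fst v + 4) * wd (n+1)} \<times>
        {of_int (snd u) * ht L (n+1)..<(of_int (snd u') + 1) * ht L (n+1)} \<subseteq> hcell n v"
      unfolding hcell_eq using b by (intro Sigma_mono) (auto simp: h(2) algebra_simps)
    then have "(\<integral>\<^sup>+p\<in>{of_int (4 * fst v) * wd (n+1)..<of_int (4 * fst v + 4) * wd (n+1)} \<times>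
        {of_int (snd u) * ht L (n+1)..<(of_int (snd u') + 1) * ht L (n+1)}. G p \<partial>lborel) \<le> (\<integral>\<^sup>+p\<in>hcell n v. G p \<partial>lborel)"
      by (rule nn_set_integral_set_mono)
    then show ?thesis using step by (meson mult_left_mono order_trans zero_le)
  qed
  from this[OF assms] this[OF assms(2,1)] show ?thesis by (cases "snd u \<le> snd u'") (auto simp: abs_minus_commute)
qed

end

subsection \<open>Averages over linked cells\<close>

lemma Ico_subset_Icc: "a \<le> b \<Longrightarrow> c \<le> d \<Longrightarrow> {b..<c} \<subseteq> {a..d}" for a b c d :: real
  by auto

context cell_tower begin

text \<open>Wide enough for the whole block of four columns containing \<open>v\<close> and for the
  adjacent rows.\<close>

definition near :: "int \<Rightarrow> int \<times> int \<Rightarrow> (real \<times> real) set" where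
  "near n v = {(of_int (fst v) - 4) * wd n..(of_int (fst v) + 4) * wd n} \<times>
     {(of_int (snd v) - 2) * ht L n..(of_int (snd v) + 2) * ht L n}"

text \<open>9 is the sum of 1 for the cell and 8 for two cells of level
  \<open>n - 1\<close>.\<close>

lemma dd_near:
  assumes p: "p \<in> cell n v" and q: "q \<in> near n v" shows "dd p q \<le> 9 * wd n"
proof -
  let ?c = "(of_int (fst v) * wd n, of_int (snd v) * ht L n)"
  have c: "?c \<in> cell n v" by (simp add: cellY_eq distrib_right)
  have w: "wd (n - 1) = 4 * wd n" "ht L (n - 1) = M * ht L n" using wd_diff_nat[of n 1] ht_diff_nat[of n 1] by simp_all
  have M2: "2 * ht L n \<le> M * ht L n" using M_ge by (intro mult_right_mono) auto
  have pq: "\<bar>of_int (fst v) * wd n - fst q\<bar> \<le> 4 * wd n" "\<bar>of_int (snd v) * ht L n - snd q\<bar> \<le> 2 * ht L n"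
    using q unfolding near_def by (auto simp: algebra_simps abs_le_iff)
  have "\<bar>of_int (fst v) * wd n - fst q\<bar> \<le> wd (n - 1)" "\<bar>of_int (snd v) * ht L n - snd q\<bar> \<le> ht L (n - 1)"
    using pq(1) order_trans[OF pq(2) M2] w by simp_all
  then have "dd (of_int (fst v) * wd n, of_int (snd v) * ht L n) (fst q, snd q) \<le> 2 * wd (n - 1)"
    by (rule dd_close)
  then show ?thesis using dd_cell[OF p c] dd_triangle[of p q ?c] w by simp
qed

lemma dd_link:
  assumes "(w, v) \<in> link n" "q \<in> cell n v" shows "\<exists>p\<in>cell n w. dd p q \<le> wd n"
proof -
  have glued_pts: "\<exists>p\<in>cell n u. \<exists>p'\<in>cell n u'. dd p p' = 0" if g: "glued n u u'" for u u'
  proof -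
    obtain j x where e: "fst u = fst u'" "of_int (snd u') * ht L n = of_int (snd u) * ht L n + ht L j"
      and x: "of_int (fst u) * wd n \<le> x" "x \<le> (of_int (fst u) + 1) * wd n"
      and gl: "\<forall>y. of_int (snd u) * ht L n \<le> y \<longrightarrow> y \<le> (of_int (snd u) + 1) * ht L n \<longrightarrow> glue L j x y"
      using g by (auto simp: glued_def)
    let ?y = "of_int (snd u) * ht L n"
    have "glue L j x ?y" using gl by (simp add: distrib_right)
    moreover have "(x, ?y) \<in> cell n u" "(x, ?y + ht L j) \<in> cell n u'"
      using x e by (auto simp: cellY_eq distrib_right)
    ultimately show ?thesis using dd_glue by blast
  qed
  have "\<exists>p\<in>cell n w. \<exists>p'\<in>cell n v. dd p p' = 0"
    using assms(1) unfolding link_def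
  proof clarify
    assume "touching w v \<or> glued n w v \<or> glued n v w"
    then show ?thesis
    proof (elim disjE)
      assume t: "touching w v"
      define c where "c = (of_int (max (fst w) (fst v)) * wd n, of_int (max (snd w) (snd v)) * ht L n)"
      have "c \<in> cell n w" "c \<in> cell n v"
        using t by (auto simp: c_def cellY_eq touching_def intro!: mult_right_mono)
      then show ?thesis using dd_refl by blast
    next
      assume "glued n v w"
      then show ?thesis using glued_pts[of v w] dd_sym by metis
    qed (rule glued_pts)
  qed
  then obtain p p' where p: "p \<in> cell n w" "p' \<in> cell n v" "dd p p' = 0" by blast
  have "dd p q \<le> wd n" using dd_triangle[of p q p'] dd_cell[OF p(2) assms(2)] p(3) by simp
  then show ?thesis using p(1) by blast
qed

text \<open>Linked cells contain points at distance 0, so a link costs at most one further cell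
  diameter; the coefficient 2 is generous.\<close>

lemma dd_link_path:
  assumes "(u, v) \<in> link n ^^ k" "p \<in> cell n u" "q \<in> cell n v"
  shows "dd p q \<le> (2 * real k + 1) * wd n"
  using assms(1,3)
proof (induction k arbitrary: v q)
  case 0 then show ?case using dd_cell[OF assms(2)] by simp
next
  case (Suc k)
  then obtain w where w: "(u, w) \<in> link n ^^ k" "(w, v) \<in> link n" by auto
  obtain p' where p': "p' \<in> cell n w" "dd p' q \<le> wd n" using dd_link[OF w(2) Suc.prems(2)] by blast
  have "(2 * real (Suc k) + 1) * wd n = (2 * real k + 1) * wd n + wd n + wd n" by (simp add: algebra_simps)
  then show ?case using Suc.IH[OF w(1) p'(1)] p'(2) dd_triangle[of p q p'] wd_pos[of n] by linarith
qed

end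

context glued_gradient begin

section \<open>The Poincare inequality on one cell\<close>

definition gint :: "(real \<times> real) set \<Rightarrow> ennreal" where "gint S = (\<integral>\<^sup>+p\<in>S. G p \<partial>lborel)"

lemma gint_mono: "S \<subseteq> T \<Longrightarrow> gint S \<le> gint T"
  unfolding gint_def by (rule nn_set_integral_set_mono)

text \<open>The parent's mean is the average of its children's means, so the difference is an
  average of differences between siblings.\<close>

lemma mean_children_diff:
  assumes "u \<in> children v"
  shows "ennreal (area (n+1) * \<bar>cint (n+1) U u / area (n+1) - cint n U v / area n\<bar>) \<le> ennreal (wd (n+1)) * gint (hcell n v)"
proof (cases "gint (hcell n v)")
  case (real g)
  define N where "N = real (card (children v))"
  have N: "N = 4 * M" "0 < N" "area n = N * area (n+1)" using M_ge by (simp_all add: N_def card_children area_add1)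
  have le: "\<bar>cint (n+1) U u - cint (n+1) U u'\<bar> \<le> wd (n+1) * g" if "u' \<in> children v" for u'
    using children_step[OF assms that, of n] real unfolding gint_def
    by (simp add: ennreal_mult'[symmetric] ennreal_le_iff)
  have "area (n+1) * (cint (n+1) U u / area (n+1) - cint n U v / area n) = cint (n+1) U u - cint n U v / N"
    by (simp add: N right_diff_distrib)
  also have "\<dots> = (\<Sum>u'\<in>children v. cint (n+1) U u - cint (n+1) U u') / N"
    using N(2) by (simp add: cint_children[OF U_int, of n v] sum_subtractf N_def[symmetric] diff_divide_distrib)
  finally have "area (n+1) * \<bar>cint (n+1) U u / area (n+1) - cint n U v / area n\<bar> = \<bar>(\<Sum>u'\<in>children v. cint (n+1) U u - cint (n+1) U u')\<bar> / N"
    using N(2) by (metis abs_divide abs_mult abs_of_pos area_pos)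
  also have "\<dots> \<le> (\<Sum>u'\<in>children v. wd (n+1) * g) / N"
    using N(2) le by (intro divide_right_mono order_trans[OF sum_abs] sum_mono) auto
  also have "\<dots> = wd (n+1) * g" using N(2) by (simp add: N_def[symmetric])
  finally show ?thesis using real by (simp add: ennreal_mult'[symmetric] ennreal_leI)
qed (simp add: ennreal_mult_top)

text \<open>The factor is the number \<open>4 * M\<close> of children times
  \<open>wd (n+1)\<close>.\<close>

lemma dev_step: "dev n U v \<le> (\<Sum>u\<in>children v. dev (n+1) U u) + ennreal (M * wd n) * gint (hcell n v)"
proof -
  let ?A = "cint n U v / area n" and ?A' = "\<lambda>u. cint (n+1) U u / area (n+1)"
  have "dev n U v = (\<Sum>u\<in>children v. \<integral>\<^sup>+p\<in>hcell (n+1) u. ennreal \<bar>U p - ?A\<bar> \<partial>lborel)"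
    unfolding dev_def by (rule nn_integral_hcell_children) measurable
  also have "\<dots> \<le> (\<Sum>u\<in>children v. dev (n+1) U u + ennreal (wd (n+1)) * gint (hcell n v))"
  proof (intro sum_mono)
    fix u assume u: "u \<in> children v"
    have "(\<integral>\<^sup>+p\<in>hcell (n+1) u. ennreal \<bar>U p - ?A\<bar> \<partial>lborel) \<le>
        (\<integral>\<^sup>+p. ennreal \<bar>U p - ?A' u\<bar> * indicator (hcell (n+1) u) p + ennreal \<bar>?A' u - ?A\<bar> * indicator (hcell (n+1) u) p \<partial>lborel)"
      by (intro nn_integral_mono) (auto simp: indicator_def intro: ennreal_abs_diff_triangle)
    also have "\<dots> = dev (n+1) U u + ennreal \<bar>?A' u - ?A\<bar> * emeasure lborel (hcell (n+1) u)"
      unfolding dev_def by (subst nn_integral_add) (auto simp: nn_integral_cmult_indicator)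
    also have "ennreal \<bar>?A' u - ?A\<bar> * emeasure lborel (hcell (n+1) u) = ennreal (area (n+1) * \<bar>?A' u - ?A\<bar>)"
      by (simp add: emeasure_hcell ennreal_mult'[symmetric] mult.commute)
    also have "\<dots> \<le> ennreal (wd (n+1)) * gint (hcell n v)" by (rule mean_children_diff[OF u])
    finally show "(\<integral>\<^sup>+p\<in>hcell (n+1) u. ennreal \<bar>U p - ?A\<bar> \<partial>lborel) \<le> dev (n+1) U u + ennreal (wd (n+1)) * gint (hcell n v)"
      by (simp add: add_left_mono)
  qed
  also have "\<dots> = (\<Sum>u\<in>children v. dev (n+1) U u) + ennreal (real (card (children v))) * (ennreal (wd (n+1)) * gint (hcell n v))"
    by (simp add: sum.distrib ennreal_of_nat_eq_real_of_nat)
  also have "ennreal (real (card (children v))) * (ennreal (wd (n+1)) * gint (hcell n v)) = ennreal (M * wd n) * gint (hcell n v)"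
    using M_ge by (simp add: card_children mult.assoc[symmetric] ennreal_mult[symmetric] wd_add1)
  finally show ?thesis .
qed

text \<open>The integrals over the children add up to that over the parent, and
  \<open>2 * M * wd (n+1) + M * wd n \<le> 2 * M * wd n\<close> keeps the constant fixed through all
  levels.\<close>

lemma dev_le_devs: "dev n U v \<le> devs k n U v + ennreal (2 * M * wd n) * gint (hcell n v)"
proof (induction k arbitrary: n v)
  case (Suc k)
  have "dev n U v \<le> (\<Sum>u\<in>children v. dev (n+1) U u) + ennreal (M * wd n) * gint (hcell n v)" by (rule dev_step)
  also have "\<dots> \<le> (\<Sum>u\<in>children v. devs k (n+1) U u + ennreal (2 * M * wd (n+1)) * gint (hcell (n+1) u)) + ennreal (M * wd n) * gint (hcell n v)"
    by (intro add_right_mono sum_mono Suc)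
  also have "\<dots> = devs (Suc k) n U v + (ennreal (2 * M * wd (n+1)) * gint (hcell n v) + ennreal (M * wd n) * gint (hcell n v))"
    unfolding gint_def by (subst (2) nn_integral_hcell_children) (simp_all add: sum.distrib sum_distrib_left add.assoc)
  also have "\<dots> \<le> devs (Suc k) n U v + ennreal (2 * M * wd n) * gint (hcell n v)"
  proof (intro add_left_mono)
    have "ennreal (2 * M * wd (n+1)) * gint (hcell n v) + ennreal (M * wd n) * gint (hcell n v) =
        ennreal (2 * M * wd (n+1) + M * wd n) * gint (hcell n v)"
      using M_ge by (simp add: distrib_right ennreal_plus)
    also have "\<dots> \<le> ennreal (2 * M * wd n) * gint (hcell n v)"
      using M_ge by (intro mult_right_mono ennreal_leI) (auto simp: wd_add1)
    finally show "ennreal (2 * M * wd (n+1)) * gint (hcell n v) + ennreal (M * wd n) * gint (hcell n v) \<le> ennreal (2 * M * wd n) * gint (hcell n v)" .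
  qed
  finally show ?case .
qed simp

lemma cell_poincare: "dev n U v \<le> ennreal (2 * M * wd n) * gint (hcell n v)"
proof -
  have "(\<lambda>k. devs k n U v + ennreal (2 * M * wd n) * gint (hcell n v)) \<longlonglongrightarrow> 0 + ennreal (2 * M * wd n) * gint (hcell n v)"
    by (intro tendsto_add devs_tendsto_0[OF U_int] tendsto_const)
  then have "(\<lambda>k. devs k n U v + ennreal (2 * M * wd n) * gint (hcell n v)) \<longlonglongrightarrow> ennreal (2 * M * wd n) * gint (hcell n v)"
    by (simp only: add_0_left)
  then show ?thesis by (rule LIMSEQ_le_const) (intro exI allI impI dev_le_devs)
qed

section \<open>Differences of integrals along links and chains\<close>

lemma cint_diff_column:
  assumes "fst u div 4 = fst v div 4" "\<bar>snd u - snd v\<bar> \<le> 1" "near n u \<subseteq> S"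
  shows "ennreal \<bar>cint n U u - cint n U v\<bar> \<le> ennreal (wd n) * gint S"
proof -
  define a lo hi where "a = fst u div 4" and "lo = min (snd u) (snd v)" and "hi = max (snd u) (snd v)"
  have "ennreal \<bar>cint n U u - cint n U v\<bar> \<le> ennreal (wd n) *
      gint ({of_int (4 * a) * wd n..<of_int (4 * a + 4) * wd n}\<times>{of_int lo * ht L n..<(of_int hi + 1) * ht L n})"
  proof (cases "snd u \<le> snd v")
    case True
    then have "lo = snd u" "hi = snd v" by (simp_all add: lo_def hi_def)
    with True show ?thesis unfolding gint_def using column_step[of u a v n] assms(1) a_def by metis
  next
    case False
    then have "lo = snd v" "hi = snd u" "snd v \<le> snd u" by (simp_all add: lo_def hi_def)
    then show ?thesis unfolding gint_def abs_minus_commute[of "cint n U u"]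
      using column_step[of v a u n] assms(1) a_def by metis
  qed
  also have "\<dots> \<le> ennreal (wd n) * gint S"
  proof (intro mult_left_mono gint_mono order_trans[OF _ assms(3)])
    have "4 * a \<ge> fst u - 4" "4 * a + 4 \<le> fst u + 4" unfolding a_def by linarith+
    then have x: "(real_of_int (fst u) - 4) * wd n \<le> of_int (4 * a) * wd n" "real_of_int (4 * a + 4) * wd n \<le> (of_int (fst u) + 4) * wd n"
      by (intro mult_right_mono; simp)+
    have "lo \<ge> snd u - 2" "hi + 1 \<le> snd u + 2" using assms(2) unfolding lo_def hi_def by linarith+
    then have y: "(real_of_int (snd u) - 2) * ht L n \<le> of_int lo * ht L n" "(real_of_int hi + 1) * ht L n \<le> (of_int (snd u) + 2) * ht L n"
      by (intro mult_right_mono; simp)+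
    show "{of_int (4 * a) * wd n..<of_int (4 * a + 4) * wd n}\<times>{of_int lo * ht L n..<(of_int hi + 1) * ht L n} \<subseteq> near n u"
      unfolding near_def by (intro Sigma_mono Ico_subset_Icc x y)
  qed simp
  finally show ?thesis .
qed

lemma strip_near:
  assumes "(of_int (fst v) - 4) * wd n \<le> l" "r \<le> (of_int (fst v) + 4) * wd n"
  shows "(\<integral>\<^sup>+y\<in>{0..<ht L n}. rowint l r (of_int (snd v) * ht L n + y) \<partial>lborel) \<le> gint (near n v)"
  unfolding strip_integral gint_def
proof (intro nn_set_integral_set_mono)
  have *: "{b * h..<b * h + h} \<subseteq> {(b - 2) * h..(b + 2) * h}" if "0 < h" for b h :: real
    using that by (auto simp: algebra_simps)
  show "{l..<r} \<times> {of_int (snd v) * ht L n..<of_int (snd v) * ht L n + ht L n} \<subseteq> near n v"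
    using assms unfolding near_def by (intro Sigma_mono *) auto
qed

lemma cint_diff_horizontal:
  assumes "\<bar>fst u - fst v\<bar> \<le> 1" "snd u = snd v" "near n u \<subseteq> S"
  shows "ennreal \<bar>cint n U u - cint n U v\<bar> \<le> ennreal (wd n) * gint S"
proof -
  let ?l = "(of_int (fst u) - 1) * wd n" and ?r = "(of_int (fst u) + 2) * wd n"
  have "ennreal \<bar>cint n U u - cint n U v\<bar> \<le> ennreal (wd n) * (\<integral>\<^sup>+y\<in>{0..<ht L n}. rowint ?l ?r (of_int (snd u) * ht L n + y) \<partial>lborel)"
  proof (rule cint_diff_rows)
    fix x y assume xy: "0 \<le> x" "x < wd n" "0 \<le> y" "y < ht L n"
    have I: "of_int c * wd n + x \<in> {?l..?r}" if "\<bar>fst u - c\<bar> \<le> 1" for c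
    proof -
      have "(real_of_int (fst u) - 1) * wd n \<le> of_int c * wd n" "of_int c * wd n \<le> (of_int (fst u) + 1) * wd n"
        using that by (intro mult_right_mono; simp; linarith)+
      moreover have "(real_of_int (fst u) + 2) * wd n = (of_int (fst u) + 1) * wd n + wd n" by (simp add: algebra_simps)
      ultimately show ?thesis using xy(1,2) unfolding atLeastAtMost_iff by linarith
    qed
    show "ennreal \<bar>U (corner n u + (x, y)) - U (corner n v + (x, y))\<bar> \<le> rowint ?l ?r (of_int (snd u) * ht L n + y)"
      using row_bound[OF I I, of "fst u" "fst v"] assms(1,2) by (simp add: corner_def)
  qed measurable
  also have "\<dots> \<le> ennreal (wd n) * gint S"
    by (intro mult_left_mono order_trans[OF strip_near gint_mono[OF assms(3)]] mult_right_mono) auto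
  finally show ?thesis .
qed

lemma ennreal_double: "ennreal (2 * wd n) * a = ennreal (wd n) * a + ennreal (wd n) * a"
  by (simp add: distrib_right[symmetric] ennreal_plus[symmetric] del: ennreal_plus)

text \<open>Follow the row of \<open>u\<close> to the gluing line, jump for free, and follow the row
  of \<open>v\<close> back to the same abscissa.\<close>

lemma cint_diff_glued:
  assumes g: "glued n u v" and "near n u \<subseteq> S" "near n v \<subseteq> S"
  shows "ennreal \<bar>cint n U u - cint n U v\<bar> \<le> ennreal (2 * wd n) * gint S"
proof -
  obtain j z where e: "fst u = fst v" "of_int (snd v) * ht L n = of_int (snd u) * ht L n + ht L j"
    and z: "of_int (fst u) * wd n \<le> z" "z \<le> (of_int (fst u) + 1) * wd n"
    and gl: "\<forall>y. of_int (snd u) * ht L n \<le> y \<longrightarrow> y \<le> (of_int (snd u) + 1) * ht L n \<longrightarrow> glue L j z y"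
    using g by (auto simp: glued_def)
  let ?l = "of_int (fst u) * wd n" and ?r = "(of_int (fst u) + 1) * wd n"
  let ?F = "\<lambda>w y. rowint ?l ?r (of_int (snd w) * ht L n + y)"
  have "ennreal \<bar>cint n U u - cint n U v\<bar> \<le> ennreal (wd n) * (\<integral>\<^sup>+y\<in>{0..<ht L n}. ?F u y + ?F v y \<partial>lborel)"
  proof (rule cint_diff_rows)
    fix x y assume xy: "0 \<le> x" "x < wd n" "0 \<le> y" "y < ht L n"
    let ?y = "of_int (snd u) * ht L n + y" and ?y' = "of_int (snd v) * ht L n + y" and ?x = "of_int (fst u) * wd n + x"
    have "glue L j z ?y" using gl xy by (simp add: distrib_right)
    from U_glue[OF this] have eq: "U (z, ?y) = U (z, ?y')" by (simp add: e algebra_simps)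
    have "?x \<in> {?l..?r}" "z \<in> {?l..?r}" using xy z by (auto simp: distrib_right)
    then have "ennreal \<bar>U (?x, ?y) - U (z, ?y)\<bar> \<le> ?F u y" "ennreal \<bar>U (z, ?y) - U (?x, ?y')\<bar> \<le> ?F v y"
      using row_bound[of ?x ?l ?r z] row_bound[of z ?l ?r ?x] eq by metis+
    then have "ennreal \<bar>U (?x, ?y) - U (z, ?y)\<bar> + ennreal \<bar>U (z, ?y) - U (?x, ?y')\<bar> \<le> ?F u y + ?F v y"
      by (rule add_mono)
    then have "ennreal \<bar>U (?x, ?y) - U (?x, ?y')\<bar> \<le> ?F u y + ?F v y"
      using ennreal_abs_diff_triangle order_trans by blast
    then show "ennreal \<bar>U (corner n u + (x, y)) - U (corner n v + (x, y))\<bar> \<le> ?F u y + ?F v y"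
      using e(1) by (simp add: corner_def)
  qed measurable
  also have "(\<integral>\<^sup>+y\<in>{0..<ht L n}. ?F u y + ?F v y \<partial>lborel) = (\<integral>\<^sup>+y\<in>{0..<ht L n}. ?F u y \<partial>lborel) + (\<integral>\<^sup>+y\<in>{0..<ht L n}. ?F v y \<partial>lborel)"
    by (simp only: distrib_right) (intro nn_integral_add; measurable)
  also have "ennreal (wd n) * \<dots> \<le> ennreal (wd n) * (gint S + gint S)"
  proof (intro mult_left_mono add_mono)
    show "(\<integral>\<^sup>+y\<in>{0..<ht L n}. ?F u y \<partial>lborel) \<le> gint S"
      by (rule order_trans[OF strip_near gint_mono[OF assms(2)]]) (auto intro!: mult_right_mono)
    show "(\<integral>\<^sup>+y\<in>{0..<ht L n}. ?F v y \<partial>lborel) \<le> gint S"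
      by (rule order_trans[OF strip_near gint_mono[OF assms(3)]]) (auto simp: e intro!: mult_right_mono)
  qed simp
  finally show ?thesis by (simp add: ennreal_double distrib_left)
qed

lemma cint_diff_link:
  assumes "(u, v) \<in> link n" "near n u \<subseteq> S" "near n v \<subseteq> S"
  shows "ennreal \<bar>cint n U u - cint n U v\<bar> \<le> ennreal (2 * wd n) * gint S"
proof -
  consider "touching u v" | "glued n u v" | "glued n v u" using assms(1) by (auto simp: link_def)
  then show ?thesis
  proof cases
    case 1
    \<comment> \<open>The corner cell is reached horizontally from \<open>u\<close> and vertically
      from \<open>v\<close>, so only the neighbourhoods of \<open>u\<close> and \<open>v\<close>
      enter.\<close>
    let ?w = "(fst v, snd u)"
    have "ennreal \<bar>cint n U u - cint n U v\<bar> \<le> ennreal \<bar>cint n U u - cint n U ?w\<bar> + ennreal \<bar>cint n U ?w - cint n U v\<bar>"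
      by (rule ennreal_abs_diff_triangle)
    also have "\<dots> \<le> ennreal (wd n) * gint S + ennreal (wd n) * gint S"
      using 1 cint_diff_column[of v ?w n S] cint_diff_horizontal[of u ?w n S] assms(2,3)
      by (intro add_mono) (auto simp: touching_def abs_minus_commute)
    finally show ?thesis by (simp add: ennreal_double)
  next
    case 2 then show ?thesis using cint_diff_glued assms by blast
  next
    case 3 then show ?thesis using cint_diff_glued[of n v u S] assms by (simp add: abs_minus_commute)
  qed
qed

text \<open>The radius adds the length \<open>2 * k + 1\<close> of the chain and the 9 of
  \<open>dd_near\<close>.\<close>

lemma cint_diff_path:
  assumes "(u, v) \<in> link n ^^ k" "p \<in> cell n u" "\<And>q. dd p q \<le> (2 * real k + 10) * wd n \<Longrightarrow> q \<in> S"
  shows "ennreal \<bar>cint n U u - cint n U v\<bar> \<le> ennreal (2 * real k * wd n) * gint S"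
  using assms(1,3)
proof (induction k arbitrary: v)
  case 0 then show ?case by simp
next
  case (Suc k)
  then obtain w where w: "(u, w) \<in> link n ^^ k" "(w, v) \<in> link n" by auto
  have near: "near n x \<subseteq> S" if x: "(u, x) \<in> link n ^^ l" "l \<le> Suc k" for x l
  proof
    fix q assume q: "q \<in> near n x"
    let ?c = "(of_int (fst x) * wd n, of_int (snd x) * ht L n)"
    have c: "?c \<in> cell n x" by (simp add: cellY_eq distrib_right)
    have "dd p q \<le> (2 * real l + 1) * wd n + 9 * wd n"
      using dd_link_path[OF x(1) assms(2) c] dd_near[OF c q] dd_triangle[of p q ?c] by linarith
    also have "\<dots> = (2 * real l + 10) * wd n" by (simp add: algebra_simps)
    also have "\<dots> \<le> (2 * real (Suc k) + 10) * wd n" using x(2) by (intro mult_right_mono) auto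
    finally show "q \<in> S" by (rule Suc.prems(2))
  qed
  have "(2 * real k + 10) * wd n \<le> (2 * real (Suc k) + 10) * wd n" by (intro mult_right_mono) auto
  then have IH: "ennreal \<bar>cint n U u - cint n U w\<bar> \<le> ennreal (2 * real k * wd n) * gint S"
    by (intro Suc.IH[OF w(1)] Suc.prems(2)) (erule order_trans)
  have "ennreal \<bar>cint n U u - cint n U v\<bar> \<le> ennreal \<bar>cint n U u - cint n U w\<bar> + ennreal \<bar>cint n U w - cint n U v\<bar>"
    by (rule ennreal_abs_diff_triangle)
  also have "\<dots> \<le> ennreal (2 * real k * wd n) * gint S + ennreal (2 * wd n) * gint S"
    using cint_diff_link[OF w(2) near[OF w(1)] near[OF Suc.prems(1)]] IH by (intro add_mono) auto
  also have "\<dots> = ennreal (2 * real (Suc k) * wd n) * gint S"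
  proof -
    have "ennreal (2 * real (Suc k) * wd n) = ennreal (2 * real k * wd n) + ennreal (2 * wd n)"
      by (subst ennreal_plus[symmetric]) (auto simp: algebra_simps)
    then show ?thesis by (simp add: distrib_right)
  qed
  finally show ?case .
qed

end

subsection \<open>The Poincare inequality on balls\<close>

text \<open>Replacing the mean by any constant costs a factor 2, which leaves \<open>c\<close> free
  to be the mean over a single cell.\<close>

lemma mean_deviation_le:
  fixes u :: "'a \<Rightarrow> real"
  assumes u: "integrable N u" and B [measurable]: "B \<in> sets N" and fin: "emeasure N B < \<infinity>" and pos: "0 < measure N B"
  shows "ennreal ((LINT x:B|N. \<bar>u x - (LINT x:B|N. u x) / measure N B\<bar>) / measure N B) \<le>
    ennreal (2 / measure N B) * (\<integral>\<^sup>+x\<in>B. ennreal \<bar>u x - c\<bar> \<partial>N)"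
proof -
  define m a where "m = measure N B" and "a = (LINT x:B|N. u x) / measure N B"
  have const: "set_integrable N B (\<lambda>x. b)" for b :: real
    using fin by (simp add: set_integrable_def integrable_mult_left integrable_indicator_iff)
  have su: "set_integrable N B u" unfolding set_integrable_def by (intro integrable_mult_indicator u B)
  have dev: "set_integrable N B (\<lambda>x. u x - b)" for b by (intro set_integral_diff su const)
  have devabs: "set_integrable N B (\<lambda>x. \<bar>u x - b\<bar>)" for b using dev by (rule set_integrable_abs)
  define I where "I = (LINT x:B|N. \<bar>u x - c\<bar>)"
  have LINT_const: "(LINT x:B|N. b) = b * m" for b :: real by (simp add: set_lebesgue_integral_def m_def)
  have "m * (a - c) = (LINT x:B|N. u x - c)"
    using pos by (simp add: set_integral_diff[OF su const] LINT_const a_def m_def[symmetric] algebra_simps)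
  then have "m * \<bar>a - c\<bar> = \<bar>LINT x:B|N. u x - c\<bar>" using pos by (metis abs_mult abs_of_pos m_def)
  also have "\<dots> \<le> I"
    using integral_norm_bound[of N "\<lambda>x. indicator B x *\<^sub>R (u x - c)"] unfolding I_def set_lebesgue_integral_def
    by (simp add: abs_mult)
  finally have ac: "m * \<bar>a - c\<bar> \<le> I" .
  have "(LINT x:B|N. \<bar>u x - a\<bar>) \<le> (LINT x:B|N. \<bar>u x - c\<bar> + \<bar>a - c\<bar>)"
    by (intro set_integral_mono set_integral_add devabs const) auto
  also have "\<dots> = I + m * \<bar>a - c\<bar>" unfolding I_def by (simp add: set_integral_add[OF devabs const] LINT_const)
  also have "\<dots> \<le> 2 * I" using ac by simp
  finally have "(LINT x:B|N. \<bar>u x - a\<bar>) / m \<le> 2 / m * I" using pos by (simp add: m_def divide_right_mono)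
  then have "ennreal ((LINT x:B|N. \<bar>u x - a\<bar>) / m) \<le> ennreal (2 / m) * ennreal I"
    using pos by (simp add: ennreal_mult'[symmetric] m_def ennreal_leI)
  also have "ennreal I = (\<integral>\<^sup>+x\<in>B. ennreal \<bar>u x - c\<bar> \<partial>N)"
  proof -
    have "(\<integral>\<^sup>+x. ennreal (indicator B x *\<^sub>R \<bar>u x - c\<bar>) \<partial>N) = ennreal I"
      unfolding I_def set_lebesgue_integral_def using devabs[of c]
      by (intro nn_integral_eq_integral) (auto simp: set_integrable_def)
    then show ?thesis by (metis (no_types, lifting) indicator_mult_ennreal mult.commute nn_integral_cong real_scaleR_def)
  qed
  finally show ?thesis by (simp add: m_def a_def)
qed

context cell_tower begin

section \<open>Volumes of balls\<close>

lemma wd_between: assumes "0 < r" shows "\<exists>n. wd (n + 1) < r \<and> r \<le> wd n"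
proof -
  define n where "n = \<lfloor>- log 4 r\<rfloor>"
  have r: "r = 4 powr (log 4 r)" using assms by simp
  have n: "of_int n \<le> - log 4 r" "- log 4 r < of_int n + 1" unfolding n_def by linarith+
  have "4 powr (- real_of_int (n + 1)) < 4 powr (log 4 r)" "4 powr (log 4 r) \<le> 4 powr (- real_of_int n)"
    using n by (simp_all)
  then show ?thesis unfolding wd_def m_h_def using r by metis
qed

definition pball :: "real \<times> real \<Rightarrow> real \<Rightarrow> (real \<times> real) set" where
  "pball p r = {q. dd p q < r}"

lemma vimage_mball: "piInf L -` mball (Xinf L) (dInf L) (piInf L p) r = pball p r"
  by (auto simp: mball_def dd_def pball_def)

lemma pball_measurable [measurable]: "pball p r \<in> sets borel"
  using open_piInf_vimage[OF mball_mopen[OF piInf_in]] unfolding vimage_mball by auto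

lemma idx_in_cell: "q \<in> cell n (idx n q)"
  using cell_cover[of "fst q" "snd q" n] by (simp add: idx_def)

lemma pball_cells:
  obtains W where "finite W" "card W \<le> 63" "\<And>q. q \<in> pball p (wd (n+1)) \<Longrightarrow> idx n q \<in> W"
    "\<And>q. q \<in> pball p (wd (n+1)) \<Longrightarrow> \<exists>k\<le>3969. (idx n p, idx n q) \<in> link n ^^ k"
proof -
  obtain W where W: "finite W" "card W \<le> 63"
    "\<And>q v. dd p q < wd (n+1) \<Longrightarrow> q \<in> cell n v \<Longrightarrow> v \<in> W \<and> (\<exists>k\<le>3969. (idx n p, v) \<in> link n ^^ k)"
    using ball_cells[of "fst p" "snd p" n "idx n p"] idx_in_cell[of p n] by auto
  show ?thesis
    by (rule that[OF W(1,2)]) (use W(3) idx_in_cell in \<open>auto simp: pball_def\<close>)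
qed

lemma emeasure_pball_le: assumes "r \<le> wd (n + 1)" shows "emeasure lborel (pball p r) \<le> ennreal (63 * area n)"
proof -
  obtain W where W: "finite W" "card W \<le> 63" "\<And>q. q \<in> pball p (wd (n+1)) \<Longrightarrow> idx n q \<in> W" using pball_cells[of p n] by metis
  have "pball p r \<subseteq> (\<Union>v\<in>W. hcell n v)" using W(3) assms by (fastforce simp: pball_def hcell_def)
  then have "emeasure lborel (pball p r) \<le> emeasure lborel (\<Union>v\<in>W. hcell n v)" by (intro emeasure_mono) (use W(1) in auto)
  also have "\<dots> \<le> (\<Sum>v\<in>W. emeasure lborel (hcell n v))" using W(1) by (intro emeasure_subadditive_finite) auto
  also have "\<dots> = ennreal (real (card W) * area n)" by (simp add: emeasure_hcell ennreal_mult'[symmetric] ennreal_of_nat_eq_real_of_nat)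
  also have "\<dots> \<le> ennreal (63 * area n)" using W(2) by (intro ennreal_leI mult_right_mono) auto
  finally show ?thesis .
qed

lemma emeasure_pball_ge: assumes "wd n < r" shows "ennreal (area n) \<le> emeasure lborel (pball p r)"
proof -
  have "hcell n (idx n p) \<subseteq> pball p r"
    using dd_cell[OF idx_in_cell] hcell_subset_cell assms unfolding pball_def by fastforce
  then have "emeasure lborel (hcell n (idx n p)) \<le> emeasure lborel (pball p r)" by (intro emeasure_mono) auto
  then show ?thesis by (simp add: emeasure_hcell)
qed

lemma area_diff_nat: "area (n - int k) = area n * (4 * M) ^ k"
  by (simp add: area_def wd_diff_nat ht_diff_nat power_mult_distrib)

lemma pball_finite: "emeasure lborel (pball p r) < \<infinity>"
proof -
  obtain i where "r \<le> wd i" using wd_ht_large[of r 0] by blast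
  then have "emeasure lborel (pball p r) \<le> ennreal (63 * area (i - 1))" by (intro emeasure_pball_le) simp
  then show ?thesis using le_less_trans ennreal_less_top by (metis infinity_ennreal_def)
qed

lemma emeasure_pball: "emeasure lborel (pball p r) = ennreal (measure lborel (pball p r))"
  using pball_finite[of p r] by (intro emeasure_eq_ennreal_measure) auto

lemma measure_pball_pos: assumes "0 < r" shows "0 < measure lborel (pball p r)"
proof -
  obtain n where "wd n < r" using wd_small[OF assms] by blast
  then have "ennreal (area n) \<le> ennreal (measure lborel (pball p r))"
    using emeasure_pball_ge emeasure_pball by metis
  then show ?thesis by (metis area_pos ennreal_le_iff measure_nonneg less_le_trans)
qed

text \<open>The large ball lies in 63 cells of a coarse level, the small one contains a half-open
  cell of level \<open>n + 1\<close>, and 11 levels separate the two.\<close>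

lemma measure_pball_doubling:
  assumes "0 < r" shows "measure lborel (pball p (128000 * r)) \<le> 63 * (4 * M) ^ 11 * measure lborel (pball p r)"
proof -
  obtain n where n: "wd (n + 1) < r" "r \<le> wd n" using wd_between[OF assms] by blast
  \<comment> \<open>262144 is \<open>4 ^ 9\<close>, the first power of 4 above 128000.\<close>
  have "wd (n + 1 - int 11 + 1) = 262144 * wd n" using wd_diff_nat[of n 9] by simp
  then have "128000 * r \<le> wd (n + 1 - int 11 + 1)" using n(2) wd_pos[of n] by linarith
  then have "emeasure lborel (pball p (128000 * r)) \<le> ennreal (63 * area (n + 1 - int 11))" by (rule emeasure_pball_le)
  also have "\<dots> = ennreal (63 * (4 * M) ^ 11) * ennreal (area (n + 1))"
    unfolding area_diff_nat using M_ge by (simp add: ennreal_mult'[symmetric] mult_ac)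
  also have "\<dots> \<le> ennreal (63 * (4 * M) ^ 11) * emeasure lborel (pball p r)" by (intro mult_left_mono emeasure_pball_ge n(1)) simp
  also have "\<dots> = ennreal (63 * (4 * M) ^ 11 * measure lborel (pball p r))"
    unfolding emeasure_pball by (rule ennreal_mult[symmetric]) (use M_ge in auto)
  finally have "ennreal (measure lborel (pball p (128000 * r))) \<le> ennreal (63 * (4 * M) ^ 11 * measure lborel (pball p r))"
    unfolding emeasure_pball .
  moreover have "0 \<le> 63 * (4 * M) ^ 11 * measure lborel (pball p r)" using M_ge by simp
  ultimately show ?thesis by (simp only: ennreal_le_iff)
qed

end

context glued_gradient begin

lemma plane_poincare:
  assumes "0 < r"
  shows "\<exists>c. (\<integral>\<^sup>+q\<in>pball p r. ennreal \<bar>U q - c\<bar> \<partial>lborel) \<le> ennreal (63 * (2 * M + 7938) * 16 * r) * gint (pball p (128000 * r))"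
proof -
  obtain n' where "wd (n' + 1) < r" "r \<le> wd n'" using wd_between[OF assms] by blast
  \<comment> \<open>Shifted one level down in the index, since \<open>pball_cells\<close> controls
    balls of radius \<open>wd (n+1)\<close>.\<close>
  then obtain n where n: "wd (n + 2) < r" "r \<le> wd (n + 1)" using that[of "n' - 1"] by (metis add.assoc diff_add_cancel one_add_one)
  have wr: "wd n < 16 * r" using n(1) wd_add_nat[of n 2] by simp
  define S where "S = pball p (128000 * r)"
  obtain W where W: "finite W" "card W \<le> 63" "\<And>q. q \<in> pball p (wd (n+1)) \<Longrightarrow> idx n q \<in> W"
    "\<And>q. q \<in> pball p (wd (n+1)) \<Longrightarrow> \<exists>k\<le>3969. (idx n p, idx n q) \<in> link n ^^ k" using pball_cells[of p n] by metis
  define W' where "W' = {v\<in>W. \<exists>k\<le>3969. (idx n p, v) \<in> link n ^^ k}"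
  have W': "finite W'" "card W' \<le> 63" using W(1,2) card_mono[of W W'] by (auto simp: W'_def)
  have inW': "idx n q \<in> W'" if "q \<in> pball p r" for q
  proof -
    have "q \<in> pball p (wd (n+1))" using that n(2) by (auto simp: pball_def)
    then show ?thesis using W(3,4) by (auto simp: W'_def)
  qed
  \<comment> \<open>7948 = 2 * 3969 + 10 is the radius for the longest chain, and 16 * 7948 = 127168
    explains 128000.\<close>
  have inS: "q \<in> S" if "dd p q \<le> 7948 * wd n" for q using that wr assms unfolding S_def pball_def by simp
  define c where "c = cint n U (idx n p) / area n"
  have cell: "(\<integral>\<^sup>+q\<in>hcell n v. ennreal \<bar>U q - c\<bar> \<partial>lborel) \<le> ennreal ((2 * M + 7938) * wd n) * gint S" if v: "v \<in> W'" for v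
  proof -
    obtain k where k: "k \<le> 3969" "(idx n p, v) \<in> link n ^^ k" using v by (auto simp: W'_def)
    let ?m = "cint n U v / area n"
    have kw: "(2 * real k + 10) * wd n \<le> 7948 * wd n" using k(1) by (intro mult_right_mono) auto
    have "ennreal \<bar>cint n U (idx n p) - cint n U v\<bar> \<le> ennreal (2 * real k * wd n) * gint S"
      by (rule cint_diff_path[OF k(2) idx_in_cell inS[OF order_trans[OF _ kw]]])
    also have "\<dots> \<le> ennreal (7938 * wd n) * gint S"
      using k(1) by (intro mult_right_mono ennreal_leI) auto
    finally have 1: "ennreal \<bar>cint n U (idx n p) - cint n U v\<bar> \<le> ennreal (7938 * wd n) * gint S" .
    have "hcell n v \<subseteq> S"
    proof
      fix q assume "q \<in> hcell n v"
      then have "dd p q \<le> (2 * real k + 1) * wd n" using dd_link_path[OF k(2) idx_in_cell] hcell_subset_cell by blast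
      also have "\<dots> \<le> 7948 * wd n" using k(1) by (intro mult_right_mono) auto
      finally show "q \<in> S" by (rule inS)
    qed
    then have 2: "dev n U v \<le> ennreal (2 * M * wd n) * gint S"
      using cell_poincare[of n v] gint_mono[of "hcell n v" S] by (meson mult_left_mono order_trans zero_le)
    have "(\<integral>\<^sup>+q\<in>hcell n v. ennreal \<bar>U q - c\<bar> \<partial>lborel) \<le>
        (\<integral>\<^sup>+q. ennreal \<bar>U q - ?m\<bar> * indicator (hcell n v) q + ennreal \<bar>?m - c\<bar> * indicator (hcell n v) q \<partial>lborel)"
      by (intro nn_integral_mono) (auto simp: indicator_def intro: ennreal_abs_diff_triangle)
    also have "\<dots> = dev n U v + ennreal \<bar>?m - c\<bar> * emeasure lborel (hcell n v)"
      unfolding dev_def by (subst nn_integral_add) (auto simp: nn_integral_cmult_indicator)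
    also have "ennreal \<bar>?m - c\<bar> * emeasure lborel (hcell n v) = ennreal \<bar>cint n U (idx n p) - cint n U v\<bar>"
      by (simp add: c_def emeasure_hcell ennreal_mult'[symmetric] diff_divide_distrib[symmetric] abs_divide abs_minus_commute)
    also have "dev n U v + \<dots> \<le> ennreal (2 * M * wd n) * gint S + ennreal (7938 * wd n) * gint S"
      by (intro add_mono 1 2)
    also have "\<dots> = ennreal ((2 * M + 7938) * wd n) * gint S"
      using M_ge by (simp add: distrib_right ennreal_plus)
    finally show ?thesis .
  qed
  have "(\<integral>\<^sup>+q\<in>pball p r. ennreal \<bar>U q - c\<bar> \<partial>lborel) \<le> (\<integral>\<^sup>+q. (\<Sum>v\<in>W'. ennreal \<bar>U q - c\<bar> * indicator (hcell n v) q) \<partial>lborel)"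
  proof (intro nn_integral_mono)
    fix q
    show "ennreal \<bar>U q - c\<bar> * indicator (pball p r) q \<le> (\<Sum>v\<in>W'. ennreal \<bar>U q - c\<bar> * indicator (hcell n v) q)"
    proof (cases "q \<in> pball p r")
      case True
      have "ennreal \<bar>U q - c\<bar> * indicator (hcell n (idx n q)) q \<le> (\<Sum>v\<in>W'. ennreal \<bar>U q - c\<bar> * indicator (hcell n v) q)"
        using inW'[OF True] W'(1) by (intro member_le_sum) auto
      then show ?thesis using True by (simp add: hcell_def)
    qed simp
  qed
  also have "\<dots> = (\<Sum>v\<in>W'. \<integral>\<^sup>+q\<in>hcell n v. ennreal \<bar>U q - c\<bar> \<partial>lborel)"
    by (intro nn_integral_sum) measurable
  also have "\<dots> \<le> (\<Sum>v\<in>W'. ennreal ((2 * M + 7938) * wd n) * gint S)" by (intro sum_mono cell)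
  also have "\<dots> = ennreal (real (card W') * ((2 * M + 7938) * wd n)) * gint S"
    using M_ge by (simp add: ennreal_of_nat_eq_real_of_nat ennreal_mult mult.assoc)
  also have "\<dots> \<le> ennreal (63 * (2 * M + 7938) * 16 * r) * gint S"
  proof (intro mult_right_mono ennreal_leI)
    have "real (card W') * ((2 * M + 7938) * wd n) \<le> 63 * ((2 * M + 7938) * (16 * r))"
      using W'(2) M_ge wr by (intro mult_mono) auto
    then show "real (card W') * ((2 * M + 7938) * wd n) \<le> 63 * (2 * M + 7938) * 16 * r" by (simp add: mult_ac)
  qed simp
  finally show ?thesis unfolding S_def by blast
qed

end

context cell_tower begin

section \<open>Rows as rectifiable curves\<close>

lemma row_curve_length:
  assumes "a \<le> b" shows "curve_length (dInf L) (\<lambda>t. piInf L (t, y)) a b = ennreal (b - a)"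
proof -
  have d: "dInf L (piInf L (s, y)) (piInf L (t, y)) = \<bar>s - t\<bar>" for s t using dd_row[of s y t] by (simp add: dd_def)
  have "(\<Sum>i<n. ennreal (dInf L (piInf L (t i, y)) (piInf L (t (Suc i), y)))) = ennreal (b - a)"
    if t: "t 0 = a" "t n = b" "\<forall>i<n. t i \<le> t (Suc i)" for n and t :: "nat \<Rightarrow> real"
  proof -
    have "(\<Sum>i<n. ennreal (dInf L (piInf L (t i, y)) (piInf L (t (Suc i), y)))) = (\<Sum>i<n. ennreal (t (Suc i) - t i))"
      using t(3) by (intro sum.cong) (auto simp: d)
    also have "\<dots> = ennreal (\<Sum>i<n. t (Suc i) - t i)" using t(3) by (intro sum_ennreal) auto
    also have "\<dots> = ennreal (b - a)" by (simp add: sum_lessThan_telescope t)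
    finally show ?thesis .
  qed
  moreover
  have "(1, \<lambda>i. if i = 0 then a else b) \<in> {(n::nat, t::nat \<Rightarrow> real). t 0 = a \<and> t n = b \<and> (\<forall>i<n. t i \<le> t (Suc i))}"
    using assms by auto
  then have "{(n::nat, t::nat \<Rightarrow> real). t 0 = a \<and> t n = b \<and> (\<forall>i<n. t i \<le> t (Suc i))} \<noteq> {}" by blast
  ultimately show ?thesis unfolding curve_length_def by (intro SUP_eq_const) auto
qed

lemma row_rectifiable:
  assumes "a \<le> b" shows "rectifiable_curve (Xinf L) (dInf L) (\<lambda>t. piInf L (t, y)) a b"
  unfolding rectifiable_curve_def curve_cont_def
  using assms dd_row[of _ y] by (auto simp: row_curve_length dd_def)

lemma row_line_integral:
  assumes "a \<le> b" and g [measurable]: "g \<in> borel_measurable (mborel (Xinf L) (dInf L))"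
  shows "line_integral (dInf L) g (\<lambda>t. piInf L (t, y)) a b = (\<integral>\<^sup>+\<xi>\<in>{a..b}. g (piInf L (\<xi>, y)) \<partial>lborel)"
proof -
  have arc: "arclen_param (dInf L) (\<lambda>t. piInf L (t, y)) a b s = piInf L (a + s, y)" if "s \<in> {0..b - a}" for s
  proof -
    \<comment> \<open>The length of the row from \<open>a\<close> to \<open>t\<close> is
      \<open>t - a\<close>, so the chosen parameter is unique.\<close>
    have "(SOME t. t \<in> {a..b} \<and> enn2real (curve_length (dInf L) (\<lambda>t. piInf L (t, y)) a t) = s) = a + s"
      using that by (intro some_equality) (auto simp: row_curve_length)
    then show ?thesis by (simp add: arclen_param_def)
  qed
  have m: "(\<lambda>\<xi>. g (piInf L (\<xi>, y))) \<in> borel_measurable borel"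
    by (rule measurable_compose[OF _ g], rule measurable_compose[OF _ piInf_measurable]) (simp add: borel_measurable_Pair)
  have "line_integral (dInf L) g (\<lambda>t. piInf L (t, y)) a b = (\<integral>\<^sup>+s\<in>{0..b - a}. g (piInf L (a + s, y)) \<partial>lborel)"
    unfolding line_integral_def using assms(1)
    by (intro nn_integral_cong) (auto simp: row_curve_length arc indicator_def)
  also have "\<dots> = (\<integral>\<^sup>+s. g (piInf L (a + s, y)) * indicator {a..b} (a + s) \<partial>lborel)"
    by (intro nn_integral_cong) (auto simp: indicator_def)
  also have "\<dots> = (\<integral>\<^sup>+\<xi>\<in>{a..b}. g (piInf L (\<xi>, y)) \<partial>lborel)"
    by (subst (2) nn_integral_real_affine[where c = 1 and t = a]) (use m in auto)
  finally show ?thesis .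
qed

lemma upper_gradient_glued_gradient:
  assumes u: "integrable (muInf L) u" and g: "upper_gradient (Xinf L) (dInf L) u g"
  shows "glued_gradient L (\<lambda>p. u (piInf L p)) (\<lambda>p. g (piInf L p))"
proof (unfold_locales)
  have pi: "piInf L \<in> lborel \<rightarrow>\<^sub>M mborel (Xinf L) (dInf L)" by simp
  have gm: "g \<in> borel_measurable (mborel (Xinf L) (dInf L))" using g by (simp add: upper_gradient_def)
  show "integrable lborel (\<lambda>p. u (piInf L p))" using u unfolding muInf_def by (rule integrable_distr[OF pi])
  show "(\<lambda>p. g (piInf L p)) \<in> borel_measurable borel" by (rule measurable_compose[OF piInf_measurable gm])
  show "ennreal \<bar>u (piInf L (x, y)) - u (piInf L (x', y))\<bar> \<le> (\<integral>\<^sup>+\<xi>\<in>{x..x'}. g (piInf L (\<xi>, y)) \<partial>lborel)" if "x \<le> x'" for x x' y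
  proof -
    have "\<forall>\<gamma> a b. rectifiable_curve (Xinf L) (dInf L) \<gamma> a b \<longrightarrow> ennreal \<bar>u (\<gamma> a) - u (\<gamma> b)\<bar> \<le> line_integral (dInf L) g \<gamma> a b"
      using g unfolding upper_gradient_def by (rule conjunct2)
    from this[rule_format, OF row_rectifiable[OF that, of y]] show ?thesis
      unfolding row_line_integral[OF that gm, of y] .
  qed
  show "u (piInf L (x, y)) = u (piInf L (x, y + ht L j))" if "glue L j x y" for j x y
    using piInf_glue[OF that] by simp
qed

text \<open>The plane estimate transfers because preimages of balls are the sets
  \<open>pball\<close>; doubling exchanges the measure of the ball for that of the enlarged
  ball.\<close>

lemma ball_poincare:
  assumes p: "P \<in> Xinf L" and r: "0 < r" and u: "integrable (muInf L) u" and g: "upper_gradient (Xinf L) (dInf L) u g"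
  defines "B \<equiv> mball (Xinf L) (dInf L) P r" and "B' \<equiv> mball (Xinf L) (dInf L) P (128000 * r)"
  shows "ennreal ((LINT x:B|muInf L. \<bar>u x - (LINT x:B|muInf L. u x) / measure (muInf L) B\<bar>) / measure (muInf L) B)
    \<le> ennreal (2 * (63 * (2 * M + 7938) * 16) * (63 * (4 * M) ^ 11) * r / measure (muInf L) B') * (\<integral>\<^sup>+ x \<in> B'. g x \<partial>muInf L)"
proof -
  interpret glued_gradient L "\<lambda>p. u (piInf L p)" "\<lambda>p. g (piInf L p)" by (rule upper_gradient_glued_gradient[OF u g])
  obtain p0 where p0: "P = piInf L p0" using p by (auto simp: Xinf_eq)
  have pi: "piInf L \<in> lborel \<rightarrow>\<^sub>M mborel (Xinf L) (dInf L)" by simp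
  have [measurable]: "g \<in> borel_measurable (mborel (Xinf L) (dInf L))" using g by (simp add: upper_gradient_def)
  have [measurable]: "u \<in> borel_measurable (mborel (Xinf L) (dInf L))"
    using borel_measurable_integrable[OF u] by (simp add: muInf_def)
  have [measurable]: "mball (Xinf L) (dInf L) P s \<in> sets (mborel (Xinf L) (dInf L))" for s
    unfolding sets_mborel using mball_mopen[OF p] by (intro sigma_sets.Basic) simp
  have vim: "piInf L -` mball (Xinf L) (dInf L) P s = pball p0 s" for s by (simp add: p0 vimage_mball)
  have em: "emeasure (muInf L) (mball (Xinf L) (dInf L) P s) = emeasure lborel (pball p0 s)" for s
    unfolding muInf_def by (subst emeasure_distr[OF pi]) (simp_all add: vim)
  then have me: "measure (muInf L) (mball (Xinf L) (dInf L) P s) = measure lborel (pball p0 s)" for s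
    by (simp add: measure_def)
  have nn: "(\<integral>\<^sup>+x\<in>mball (Xinf L) (dInf L) P s. f x \<partial>muInf L) = (\<integral>\<^sup>+q\<in>pball p0 s. f (piInf L q) \<partial>lborel)"
    if [measurable]: "f \<in> borel_measurable (mborel (Xinf L) (dInf L))" for f :: "_ \<Rightarrow> ennreal" and s
  proof -
    have "indicator (mball (Xinf L) (dInf L) P s) (piInf L q) = (indicator (pball p0 s) q :: ennreal)" for q
      using vim[of s] by (auto simp: indicator_def)
    then show ?thesis unfolding muInf_def by (subst nn_integral_distr[OF pi]) simp_all
  qed
  define C0 D m m' where "C0 = 63 * (2 * M + 7938) * 16" and "D = 63 * (4 * M) ^ 11"
    and "m = measure (muInf L) B" and "m' = measure (muInf L) B'"
  have pos: "0 < C0" "0 < D" "0 < m" "0 < m'" "m' \<le> D * m"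
    using M_ge r measure_pball_pos[of r p0] measure_pball_pos[of "128000 * r" p0] measure_pball_doubling[OF r, of p0]
    by (simp_all add: C0_def D_def m_def m'_def B_def B'_def me)
  obtain c where c: "(\<integral>\<^sup>+q\<in>pball p0 r. ennreal \<bar>u (piInf L q) - c\<bar> \<partial>lborel) \<le> ennreal (C0 * r) * gint (pball p0 (128000 * r))"
    using plane_poincare[OF r, of p0] unfolding C0_def by blast
  have "ennreal ((LINT x:B|muInf L. \<bar>u x - (LINT x:B|muInf L. u x) / m\<bar>) / m) \<le> ennreal (2 / m) * (\<integral>\<^sup>+x\<in>B. ennreal \<bar>u x - c\<bar> \<partial>muInf L)"
    unfolding m_def
  proof (rule mean_deviation_le[OF u])
    show "B \<in> sets (muInf L)" by (simp add: B_def muInf_def)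
    show "emeasure (muInf L) B < \<infinity>" unfolding B_def em by (rule pball_finite)
    show "0 < measure (muInf L) B" using pos by (simp add: m_def)
  qed
  also have "(\<integral>\<^sup>+x\<in>B. ennreal \<bar>u x - c\<bar> \<partial>muInf L) = (\<integral>\<^sup>+q\<in>pball p0 r. ennreal \<bar>u (piInf L q) - c\<bar> \<partial>lborel)"
    unfolding B_def by (rule nn) measurable
  also have "ennreal (2 / m) * \<dots> \<le> ennreal (2 / m) * (ennreal (C0 * r) * gint (pball p0 (128000 * r)))"
    by (intro mult_left_mono c) simp
  also have "gint (pball p0 (128000 * r)) = (\<integral>\<^sup>+ x \<in> B'. g x \<partial>muInf L)"
    unfolding B'_def gint_def by (rule nn[symmetric]) measurable
  also have "ennreal (2 / m) * (ennreal (C0 * r) * (\<integral>\<^sup>+ x \<in> B'. g x \<partial>muInf L)) \<le> ennreal (2 * C0 * D * r / m') * (\<integral>\<^sup>+ x \<in> B'. g x \<partial>muInf L)"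
  proof -
    have "2 / m * (C0 * r) = 2 * C0 * r * D / (D * m)" using pos by simp
    also have "\<dots> \<le> 2 * C0 * r * D / m'" using pos r by (intro divide_left_mono) auto
    finally have "ennreal (2 / m * (C0 * r)) \<le> ennreal (2 * C0 * D * r / m')" by (simp add: ennreal_leI mult_ac)
    moreover have "ennreal (2 / m) * ennreal (C0 * r) = ennreal (2 / m * (C0 * r))"
      using pos r by (intro ennreal_mult[symmetric]) auto
    ultimately have "ennreal (2 / m) * ennreal (C0 * r) \<le> ennreal (2 * C0 * D * r / m')" by simp
    then show ?thesis by (simp add: mult.assoc[symmetric] mult_right_mono)
  qed
  finally show ?thesis unfolding C0_def D_def m_def m'_def .
qed

end

theorem mainTheorem17:
  fixes L :: nat
  assumes "L \<ge> 100"
  shows "\<exists>C \<Lambda>::real. C \<ge> 1 \<and> \<Lambda> \<ge> 1 \<and>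
    (\<forall>p \<in> Xinf L. \<forall>r > 0. \<forall>(u :: (real \<times> real) set \<Rightarrow> real) (g :: (real \<times> real) set \<Rightarrow> ennreal).
       integrable (muInf L) u \<longrightarrow> upper_gradient (Xinf L) (dInf L) u g \<longrightarrow>
       (let B = mball (Xinf L) (dInf L) p r;
            \<Lambda>B = mball (Xinf L) (dInf L) p (\<Lambda> * r);
            uB = (LINT x:B|muInf L. u x) / measure (muInf L) B
        in ennreal ((LINT x:B|muInf L. \<bar>u x - uB\<bar>) / measure (muInf L) B)
             \<le> ennreal (C * r / measure (muInf L) \<Lambda>B) * (\<integral>\<^sup>+ x \<in> \<Lambda>B. g x \<partial>muInf L)))"
proof -
  interpret cell_tower L using assms by unfold_locales
  \<comment> \<open>\<open>C\<close> is the product of 2 from \<open>mean_deviation_le\<close>, the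
    constant of \<open>plane_poincare\<close> and the doubling constant.\<close>
  have "1 \<le> (4 * M) ^ 11" using M_ge by (intro one_le_power) simp
  then have "1 * 1 \<le> (2 * (63 * (2 * M + 7938) * 16)) * (63 * (4 * M) ^ 11)"
    using M_ge by (intro mult_mono) auto
  then show ?thesis
    using ball_poincare by (intro exI[of _ "2 * (63 * (2 * M + 7938) * 16) * (63 * (4 * M) ^ 11)"] exI[of _ 128000])
      (simp only: Let_def, auto)
qed

end
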